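(* Let $n\in\mathbb N$ and let $F=[(F_\varepsilon)_\varepsilon]\in\mathcal G(\mathbb R^n)^n$ satisfy: (i) there exist $C,\varepsilon_0>0$ such that $|F_\varepsilon(x)|\le C(1+|x|)$ for all $x\in\mathbb R^n$ and all $\varepsilon<\varepsilon_0$; and (ii) for every compact $K\subset\mathbb R^n$, $\sup_{x\in K}|\nabla F_\varepsilon(x)|=O(|\log\varepsilon|)$ as $\varepsilon\to0$. Then there exists a unique generalized function $\Phi\in\mathcal G[\mathbb R^{1+n},\mathbb R^n]$ (the generalized flow of $\dot x=F(x)$) such that $$\frac{d}{dt}\Phi(t,x)=F(\Phi(t,x))\quad\text{in }\mathcal G[\mathbb R^{1+n},\mathbb R^n],$$ $$\Phi(0,\cdot)=\mathrm{id}_{\mathbb R^n}\quad\text{in }\mathcal G[\mathbb R^n,\mathbb R^n],$$ $$\Phi(t+s,\cdot)=\Phi(t,\Phi(s,\cdot))\quad\text{in }\mathcal G[\mathbb R^{2+n},\mathbb R^n].$$ Moreover, $\frac{d}{dt}\Phi$ is c-bounded. If, in addition, there exist $C,\varepsilon_0>0$ such that $|F_\varepsilon(0)|\le C$ and $|\nabla F_\varepsilon(x)|\le C$ for all $x\in\mathbb R^n$ and all $\varepsilon<\varepsilon_0$, then $\nabla_x\Phi$ is c-bounded as well.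
   Context: Let $I=(0,1]$; all $O(\cdot)$ are for $\varepsilon\to0$. $\mathcal E_M(\mathbb R^d)$ is the set of nets $(u_\varepsilon)_{\varepsilon\in I}$ in $C^\infty(\mathbb R^d)$ such that for every compact $K$ and every multi-index $\alpha$ there is $N\in\mathbb N$ with $\sup_K|\partial^\alpha u_\varepsilon|=O(\varepsilon^{-N})$. $\mathcal N(\mathbb R^d)$ is the set of $(u_\varepsilon)_\varepsilon\in\mathcal E_M(\mathbb R^d)$ such that for every compact $K$ and every $q\in\mathbb N_0$, $\sup_K|u_\varepsilon|=O(\varepsilon^q)$. The (special) Colombeau algebra is $\mathcal G(\mathbb R^d)=\mathcal E_M(\mathbb R^d)/\mathcal N(\mathbb R^d)$, and classes are written $u=[(u_\varepsilon)_\varepsilon]$. Derivatives are defined on representatives. A net of maps $u_\varepsilon\in C^\infty(\mathbb R^d,\mathbb R^k)$ is c-bounded if for each compact $K\subset\mathbb R^d$ there are $\varepsilon_0>0$ and a compact $K'\subset\mathbb R^k$ with $u_\varepsilon(K)\subseteq K'$ for all $\varepsilon<\varepsilon_0$. $\mathcal G[\mathbb R^d,\mathbb R^k]$ is the space of c-bounded generalized functions: c-bounded nets with components in $\mathcal E_M(\mathbb R^d)$, modulo nets whose difference has components in $\mathcal N(\mathbb R^d)$. A generalized function is called c-bounded if its representatives are c-bounded nets. Here $\nabla_x\Phi$ is regarded as a matrix-valued function of $(t,x)\in\mathbb R^{1+n}$. All compositions are defined on representatives (e.g. $F\circ\Phi=[(F_\varepsilon\circ\Phi^\varepsilon)_\varepsilon]$)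 and are well-defined because the inner functions are c-bounded. In the last of the three equations both sides are regarded as functions of $(t,s,x)\in\mathbb R^{2+n}$. The pointwise bounds on $F_\varepsilon$ are conditions on some representative $(F_\varepsilon)_\varepsilon$ of $F$. *)

theory Defs
  imports "HOL-Analysis.Analysis" "HOL-Library.Landau_Symbols"
begin

text \<open>
  A net \<open>(u\<^sub>\<epsilon>)\<close> with \<open>\<epsilon> \<in> I = (0,1]\<close> is a function of a real parameter; its values for
  \<open>\<epsilon> \<notin> (0,1]\<close> are never inspected, so nets that agree on \<open>(0,1]\<close> represent the same
  generalized function. Domains \<open>\<real>\<^sup>d\<close> and targets \<open>\<real>\<^sup>k\<close> are Euclidean spaces: \<open>\<real>\<^sup>1\<^sup>+\<^sup>n\<close> is
  \<open>real \<times> real^'n\<close>, \<open>\<real>\<^sup>2\<^sup>+\<^sup>n\<close> is \<open>real \<times> real \<times> real^'n\<close>, and \<open>n \<times> n\<close> matrices are \<open>real^'n^'n\<close>.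
\<close>

type_synonym ('a, 'b) fnet = "real \<Rightarrow> 'a \<Rightarrow> 'b"
type_synonym ('a, 'b) gfun = "('a, 'b) fnet set"

text \<open>
  A multi-index is given by a list of standard basis vectors, one for each derivative taken.
  By Schwarz's theorem only the multiplicities of the basis vectors matter for smooth functions.
\<close>

definition partial :: "'a::euclidean_space \<Rightarrow> ('a \<Rightarrow> real) \<Rightarrow> 'a \<Rightarrow> real" where
  "partial b f = (\<lambda>x. frechet_derivative f (at x) b)"

definition partials :: "'a::euclidean_space list \<Rightarrow> ('a \<Rightarrow> real) \<Rightarrow> 'a \<Rightarrow> real" where
  "partials bs f = foldr partial bs f"

definition smooth :: "('a::euclidean_space \<Rightarrow> real) \<Rightarrow> bool" where
  "smooth f \<longleftrightarrow> (\<forall>bs \<in> lists Basis. partials bs f differentiable_on UNIV)"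

text \<open>
  Compact sets are taken nonempty in the growth conditions only because the supremum of the
  empty set of reals is unspecified. The filter \<^term>\<open>at_right (0::real)\<close> expresses
  \<open>\<epsilon> \<rightarrow> 0\<close> within \<open>(0,1]\<close>.
\<close>

definition moderate :: "('a::euclidean_space, real) fnet set" where
  "moderate = {u. (\<forall>\<epsilon> \<in> {0<..1}. smooth (u \<epsilon>)) \<and>
     (\<forall>K. compact K \<and> K \<noteq> {} \<longrightarrow> (\<forall>bs \<in> lists Basis. \<exists>N::nat.
        (\<lambda>\<epsilon>. SUP x\<in>K. \<bar>partials bs (u \<epsilon>) x\<bar>) \<in> O[at_right 0](\<lambda>\<epsilon>. 1 / \<epsilon> ^ N)))}"

definition negligible_nets :: "('a::euclidean_space, real) fnet set" where
  "negligible_nets = {u \<in> moderate. \<forall>K. compact K \<and> K \<noteq> {} \<longrightarrow> (\<forall>q::nat.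
     (\<lambda>\<epsilon>. SUP x\<in>K. \<bar>u \<epsilon> x\<bar>) \<in> O[at_right 0](\<lambda>\<epsilon>. \<epsilon> ^ q))}"

definition moderate_vec :: "('a::euclidean_space, 'b::euclidean_space) fnet set" where
  "moderate_vec = {u. \<forall>b \<in> Basis. (\<lambda>\<epsilon> x. u \<epsilon> x \<bullet> b) \<in> moderate}"

definition c_bounded :: "('a::euclidean_space, 'b::euclidean_space) fnet \<Rightarrow> bool" where
  "c_bounded u \<longleftrightarrow> (\<forall>K. compact K \<longrightarrow>
     (\<exists>\<epsilon>\<^sub>0>0. \<exists>K'. compact K' \<and> (\<forall>\<epsilon> \<in> {0<..1}. \<epsilon> < \<epsilon>\<^sub>0 \<longrightarrow> u \<epsilon> ` K \<subseteq> K')))"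

definition colombeau_rel ::
    "(('a::euclidean_space, 'b::euclidean_space) fnet \<times> ('a, 'b) fnet) set" where
  "colombeau_rel = {(u, v). u \<in> moderate_vec \<and> v \<in> moderate_vec \<and>
     (\<forall>b \<in> Basis. (\<lambda>\<epsilon> x. (u \<epsilon> x - v \<epsilon> x) \<bullet> b) \<in> negligible_nets)}"

text \<open>
  \<open>\<G>(\<real>\<^sup>d)\<^sup>k\<close>, with a \<open>k\<close>-tuple of classes identified with the class of the \<open>\<real>\<^sup>k\<close>-valued net.
\<close>

definition colombeau :: "('a::euclidean_space, 'b::euclidean_space) gfun set" where
  "colombeau = moderate_vec // colombeau_rel"

text \<open>
  \<open>\<G>[\<real>\<^sup>d,\<real>\<^sup>k]\<close>. A moderate net that differs from a c-bounded one by a negligible net is itself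
  c-bounded, so the classes of c-bounded nets may be formed with the relation used for \<open>\<G>(\<real>\<^sup>d)\<^sup>k\<close>;
  in particular equality in \<open>\<G>[\<real>\<^sup>d,\<real>\<^sup>k]\<close> is equality of classes.
\<close>

definition colombeau_cb :: "('a::euclidean_space, 'b::euclidean_space) gfun set" where
  "colombeau_cb = {u \<in> moderate_vec. c_bounded u} // colombeau_rel"

definition c_bounded_gfun :: "('a::euclidean_space, 'b::euclidean_space) gfun \<Rightarrow> bool" where
  "c_bounded_gfun U \<longleftrightarrow> U \<in> colombeau \<and> (\<forall>u \<in> U. c_bounded u)"

definition gclass :: "('a::euclidean_space, 'b::euclidean_space) fnet \<Rightarrow> ('a, 'b) gfun" where
  "gclass u = colombeau_rel `` {u}"

text \<open>
  Operations on classes defined through representatives: the union over all representatives is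
  the usual way to descend to a quotient, and is a single class when the operation is well-defined.
\<close>

definition gmap :: "(('a, 'b) fnet \<Rightarrow> ('c::euclidean_space, 'd::euclidean_space) fnet) \<Rightarrow>
    ('a, 'b) gfun \<Rightarrow> ('c, 'd) gfun" where
  "gmap T U = (\<Union>u \<in> U. gclass (T u))"

definition gcomp :: "('b, 'c::euclidean_space) gfun \<Rightarrow> ('a::euclidean_space, 'b) gfun \<Rightarrow>
    ('a, 'c) gfun" where
  "gcomp U V = (\<Union>u \<in> U. \<Union>v \<in> V. gclass (\<lambda>\<epsilon>. u \<epsilon> \<circ> v \<epsilon>))"

definition ddt :: "(real \<times> (real^'n), real^'n) gfun \<Rightarrow> (real \<times> (real^'n), real^'n) gfun" where
  "ddt = gmap (\<lambda>\<phi> \<epsilon> (t, x). vector_derivative (\<lambda>\<tau>. \<phi> \<epsilon> (\<tau>, x)) (at t))"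

definition grad_x :: "(real \<times> (real^'n), real^'n) gfun \<Rightarrow> (real \<times> (real^'n), real^'n^'n) gfun" where
  "grad_x = gmap (\<lambda>\<phi> \<epsilon> (t, x). jacobian (\<lambda>y. \<phi> \<epsilon> (t, y)) (at x))"

text \<open>\<open>\<Phi>(0,\<cdot>)\<close>, \<open>\<Phi>(t+s,x)\<close> and \<open>\<Phi>(t,\<Phi>(s,x))\<close>, the last two as functions of \<open>(t,s,x)\<close>.\<close>

definition at_time_0 :: "(real \<times> (real^'n), real^'n) gfun \<Rightarrow> (real^'n, real^'n) gfun" where
  "at_time_0 = gmap (\<lambda>\<phi> \<epsilon> x. \<phi> \<epsilon> (0, x))"

definition flow_sum ::
    "(real \<times> (real^'n), real^'n) gfun \<Rightarrow> (real \<times> real \<times> (real^'n), real^'n) gfun" where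
  "flow_sum = gmap (\<lambda>\<phi> \<epsilon> (t, s, x). \<phi> \<epsilon> (t + s, x))"

definition flow_iterate ::
    "(real \<times> (real^'n), real^'n) gfun \<Rightarrow> (real \<times> real \<times> (real^'n), real^'n) gfun" where
  "flow_iterate \<Phi> = gcomp \<Phi> (gmap (\<lambda>\<phi> \<epsilon> (t, s, x). (t, \<phi> \<epsilon> (s, x))) \<Phi>)"

definition is_generalized_flow ::
    "(real^'n, real^'n) gfun \<Rightarrow> (real \<times> (real^'n), real^'n) gfun \<Rightarrow> bool" where
  "is_generalized_flow F \<Phi> \<longleftrightarrow> \<Phi> \<in> colombeau_cb \<and>
     ddt \<Phi> = gcomp F \<Phi> \<and>
     at_time_0 \<Phi> = gclass (\<lambda>\<epsilon> x. x) \<and>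
     flow_sum \<Phi> = flow_iterate \<Phi>"

end

theory Submission
  imports Defs
begin

text \<open>
  The flow is represented by Picard iterates; we write \<open>e\<close> for the parameter of a net. For a
  representative \<open>f\<close> of \<open>F\<close> the iterates \<open>\<phi>\<^sub>0 = x\<close>, \<open>\<phi>\<^sub>k\<^sub>+\<^sub>1 = x + \<integral>\<^sub>0\<^sup>t f(\<phi>\<^sub>k)\<close> are smooth without any
  theorem on ordinary differential equations, and all estimates are uniform in \<open>k\<close>: linear growth of
  \<open>f\<close> bounds the \<open>\<phi>\<^sub>k\<close> locally, and their spatial derivatives satisfy linear recursions whose
  coefficients are \<open>O(\<bar>log e\<bar>)\<close>, so that the weights \<open>exp(L \<bar>log e\<bar> \<bar>t\<bar>)\<close>, which are powers of \<open>1 / e\<close>,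
  make every derivative moderate. Since successive iterates differ by at most a moderate factor
  times \<open>3\<^sup>-\<^sup>k\<close>, the iterate number \<open>\<lceil>1/e\<rceil> + 1\<close> solves the equation up to a negligible error. By
  Gronwall's inequality, again with Lipschitz constants \<open>O(\<bar>log e\<bar>)\<close>, two c-bounded nets that solve
  the equation up to negligible errors with negligibly different initial values differ by a
  negligible net; this gives both uniqueness and the flow property.
\<close>

section \<open>Families of moderate functions\<close>

text \<open>Equality in the algebra is equality up to negligible nets, so a residual smaller than
  every power of e is as good as an exact solution. The price is that the number of iterations must
  grow like 1 / e. An exponent found for each fixed k could depend on k and would then say nothing
  at k of order 1 / e; hence every predicate below is uniform in k.

  The logarithm in (ii) is what keeps the exponential weights moderate: with coefficients growing
  like a power of 1 / e they would outgrow every power of 1 / e. Higher derivatives do not spoil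
  this. Differentiating the recursion again leaves its homogeneous coefficients, the first
  derivatives of f at the iterates, unchanged; all higher derivatives of f enter the inhomogeneity,
  where moderateness suffices. Finally exp (-1 / e) beats every power that has accumulated.

  A second obstacle is that the growth bound, the logarithmic bound and the bounded gradient may be
  witnessed by three different representatives. A negligible net has negligible derivatives, so the
  logarithmic bound passes from one representative to another; uniqueness identifies the flows built
  from different ones.\<close>

text \<open>
  Nets carry an additional index \<open>k\<close> in which all bounds are uniform; it will be the number of
  Picard iterations. For a plain net it is of type \<^typ>\<open>unit\<close>. Powers of \<open>1 / e\<close> need no
  constant factor because a constant is absorbed by one more power.
\<close>

definition locally_moderate :: "(real \<Rightarrow> 'k \<Rightarrow> 'a::euclidean_space \<Rightarrow> 'b::euclidean_space) \<Rightarrow> bool" where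
  "locally_moderate u \<longleftrightarrow> (\<forall>K. compact K \<longrightarrow>
     (\<exists>N::nat. \<forall>\<^sub>F e in at_right 0. \<forall>k. \<forall>x\<in>K. norm (u e k x) \<le> (1 / e) ^ N))"

text \<open>The recursion takes one directional derivative along a basis vector at a time instead of
  a multi-index. Each closure property then becomes a single induction on the order with one use of
  the Leibniz or chain rule, and no formula for higher derivatives of products or compositions is
  involved.\<close>

primrec moderate_upto ::
    "nat \<Rightarrow> (real \<Rightarrow> 'k \<Rightarrow> 'a::euclidean_space \<Rightarrow> 'b::euclidean_space) \<Rightarrow> bool" where
  "moderate_upto 0 u \<longleftrightarrow> locally_moderate u \<and> (\<forall>e\<in>{0<..1}. \<forall>k. continuous_on UNIV (u e k))"
| "moderate_upto (Suc m) u \<longleftrightarrow> locally_moderate u \<and>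
     (\<forall>e\<in>{0<..1}. \<forall>k x. u e k differentiable at x) \<and>
     (\<forall>b\<in>Basis. moderate_upto m (\<lambda>e k x. frechet_derivative (u e k) (at x) b))"

text \<open>The analogue of c-boundedness for families, with a radius in place of a compact target;
  for the index type \<open>unit\<close> it is c-boundedness itself
  (\<open>c_bounded_iff\<close>).\<close>

definition locally_bounded ::
    "(real \<Rightarrow> 'k \<Rightarrow> 'a::euclidean_space \<Rightarrow> 'b::euclidean_space) \<Rightarrow> bool" where
  "locally_bounded u \<longleftrightarrow> (\<forall>K. compact K \<longrightarrow>
     (\<exists>R. \<forall>\<^sub>F e in at_right 0. \<forall>k. \<forall>x\<in>K. norm (u e k x) \<le> R))"

lemma eventually_small:
  fixes d :: real
  assumes "d > 0"
  shows "\<forall>\<^sub>F e in at_right 0. 0 < e \<and> e \<le> 1 \<and> e < d"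
proof -
  have "\<forall>\<^sub>F e in at_right 0. e \<in> {0<..<min 1 d}"
    using eventually_at_right_real[of 0 "min 1 d"] assms by simp
  then show ?thesis by (rule eventually_mono) auto
qed

lemma eventually_unit: "\<forall>\<^sub>F e in at_right 0. 0 < e \<and> e \<le> (1::real)"
  using eventually_small[of 1] by (auto elim: eventually_mono)

lemma eventually_inverse_ge:
  fixes c :: real
  shows "\<forall>\<^sub>F e in at_right 0. 0 < e \<and> e \<le> 1 \<and> c \<le> 1 / e"
proof -
  have "\<forall>\<^sub>F e in at_right 0. 0 < e \<and> e \<le> 1 \<and> e < 1 / (\<bar>c\<bar> + 1)"
    by (rule eventually_small) auto
  then show ?thesis
  proof (rule eventually_mono)
    fix e :: real assume *: "0 < e \<and> e \<le> 1 \<and> e < 1 / (\<bar>c\<bar> + 1)"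
    then have "e * (\<bar>c\<bar> + 1) < 1" by (simp add: pos_less_divide_eq)
    moreover have "c * e \<le> (\<bar>c\<bar> + 1) * e" using * by (intro mult_right_mono) auto
    ultimately have "c * e \<le> 1" by (simp add: mult.commute)
    then show "0 < e \<and> e \<le> 1 \<and> c \<le> 1 / e" using * by (simp add: pos_le_divide_eq)
  qed
qed

lemma locally_moderateI:
  fixes u :: "real \<Rightarrow> 'k \<Rightarrow> 'a::euclidean_space \<Rightarrow> 'b::euclidean_space"
  assumes "\<And>K. compact K \<Longrightarrow> \<exists>N::nat. \<exists>c. \<forall>\<^sub>F e in at_right 0. \<forall>k. \<forall>x\<in>K. norm (u e k x) \<le> c * (1 / e) ^ N"
  shows "locally_moderate u"
  unfolding locally_moderate_def
proof (intro allI impI)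
  fix K :: "'a set" assume "compact K"
  then obtain N c where *: "\<forall>\<^sub>F e in at_right 0. \<forall>k. \<forall>x\<in>K. norm (u e k x) \<le> c * (1 / e) ^ N"
    using assms by blast
  have "\<forall>\<^sub>F e in at_right 0. \<forall>k. \<forall>x\<in>K. norm (u e k x) \<le> (1 / e) ^ Suc N"
    using * eventually_inverse_ge[of c]
  proof eventually_elim
    case (elim e)
    have "c * (1 / e) ^ N \<le> (1 / e) * (1 / e) ^ N"
      using elim by (intro mult_right_mono) auto
    then show ?case using elim by (auto intro: order_trans)
  qed
  then show "\<exists>N. \<forall>\<^sub>F e in at_right 0. \<forall>k. \<forall>x\<in>K. norm (u e k x) \<le> (1 / e) ^ N" by blast
qed

lemma locally_moderateD:
  assumes "locally_moderate u" "compact K"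
  obtains N :: nat where "\<forall>\<^sub>F e in at_right 0. \<forall>k. \<forall>x\<in>K. norm (u e k x) \<le> (1 / e) ^ N"
  using assms unfolding locally_moderate_def by blast

lemma locally_bounded_imp_moderate: "locally_bounded u \<Longrightarrow> locally_moderate u"
  unfolding locally_bounded_def
  by (rule locally_moderateI, rule exI[of _ 0]) simp

lemma locally_moderate_cong:
  fixes u v :: "real \<Rightarrow> 'k \<Rightarrow> 'a::euclidean_space \<Rightarrow> 'b::euclidean_space"
  assumes "\<And>e k x. e \<in> {0<..1} \<Longrightarrow> u e k x = v e k x" "locally_moderate u"
  shows "locally_moderate v"
  unfolding locally_moderate_def
proof (intro allI impI)
  fix K :: "'a set" assume "compact K"
  then obtain N where "\<forall>\<^sub>F e in at_right 0. \<forall>k. \<forall>x\<in>K. norm (u e k x) \<le> (1 / e) ^ N"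
    using assms(2) locally_moderateD by blast
  then have "\<forall>\<^sub>F e in at_right 0. \<forall>k. \<forall>x\<in>K. norm (v e k x) \<le> (1 / e) ^ N"
    using eventually_unit by eventually_elim (use assms(1) in auto)
  then show "\<exists>N. \<forall>\<^sub>F e in at_right 0. \<forall>k. \<forall>x\<in>K. norm (v e k x) \<le> (1 / e) ^ N" by blast
qed

lemma moderate_upto_imp_locally_moderate: "moderate_upto m u \<Longrightarrow> locally_moderate u"
  by (cases m) auto

lemma moderate_upto_cong:
  "moderate_upto m u \<Longrightarrow> (\<And>e k x. e \<in> {0<..1} \<Longrightarrow> u e k x = v e k x) \<Longrightarrow> moderate_upto m v"
proof (induction m arbitrary: u v)
  case 0
  have eq: "u e k = v e k" if "e \<in> {0<..1}" for e k using 0(2)[OF that] by auto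
  show ?case using 0(1) locally_moderate_cong[of u v] eq by auto
next
  case (Suc m)
  have eq: "u e k = v e k" if "e \<in> {0<..1}" for e k using Suc(3)[OF that] by auto
  have "moderate_upto m (\<lambda>e k x. frechet_derivative (v e k) (at x) b)" if "b \<in> Basis" for b
    by (rule Suc.IH[of "\<lambda>e k x. frechet_derivative (u e k) (at x) b"])
      (use Suc(2) that eq in auto)
  then show ?case using Suc(2) locally_moderate_cong[of u v] eq by auto
qed

lemma moderate_upto_SucI:
  assumes "locally_moderate u"
    and "\<And>e k x. e \<in> {0<..1} \<Longrightarrow> (u e k has_derivative D e k x) (at x)"
    and "\<And>b. b \<in> Basis \<Longrightarrow> moderate_upto m (\<lambda>e k x. D e k x b)"
  shows "moderate_upto (Suc m) u"
proof -
  have "moderate_upto m (\<lambda>e k x. frechet_derivative (u e k) (at x) b)" if "b \<in> Basis" for b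
    by (rule moderate_upto_cong[OF assms(3)[OF that]])
      (use frechet_derivative_at[OF assms(2)] in simp)
  moreover have "u e k differentiable at x" if "e \<in> {0<..1}" for e k x
    using assms(2)[OF that] by (rule differentiableI)
  ultimately show ?thesis using assms(1) by auto
qed

lemma moderate_upto_derivative:
  "moderate_upto (Suc m) u \<Longrightarrow> b \<in> Basis \<Longrightarrow>
    moderate_upto m (\<lambda>e k x. frechet_derivative (u e k) (at x) b)"
  by simp

lemma moderate_upto_has_derivative:
  assumes "moderate_upto (Suc m) u" "e \<in> {0<..1}"
  shows "(u e k has_derivative frechet_derivative (u e k) (at x)) (at x)"
  using assms by (simp add: frechet_derivative_works[symmetric])

lemma moderate_upto_continuous_on:
  assumes "moderate_upto m u" "e \<in> {0<..1}"
  shows "continuous_on UNIV (u e k)"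
proof (cases m)
  case (Suc n)
  then have "\<And>x. u e k differentiable at x" using assms by auto
  then show ?thesis
    by (meson continuous_at_imp_continuous_on differentiable_imp_continuous_within)
qed (use assms in auto)

lemma moderate_upto_Suc_imp: "moderate_upto (Suc m) u \<Longrightarrow> moderate_upto m u"
proof (induction m arbitrary: u)
  case 0
  then show ?case using moderate_upto_continuous_on[OF 0] by auto
next
  case (Suc m)
  then show ?case by auto
qed

lemma locally_moderate_const: "locally_moderate (\<lambda>e k x. c)"
  by (rule locally_moderateI) (auto intro!: exI[of _ 0] exI[of _ "norm c"])

lemma moderate_upto_const: "moderate_upto m (\<lambda>e k x. c)"
  by (induction m arbitrary: c) (auto simp: locally_moderate_const)

lemma locally_bounded_const:
  fixes A :: "'a::euclidean_space \<Rightarrow> 'b::euclidean_space"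
  assumes "continuous_on UNIV A"
  shows "locally_bounded (\<lambda>e k. A)"
  unfolding locally_bounded_def
proof (intro allI impI)
  fix K :: "'a set" assume "compact K"
  then have "bounded (A ` K)"
    by (intro compact_imp_bounded compact_continuous_image continuous_on_subset[OF assms]) auto
  then obtain R where "\<forall>x\<in>K. norm (A x) \<le> R" unfolding bounded_iff by auto
  then show "\<exists>R. \<forall>\<^sub>F e in at_right 0. \<forall>k. \<forall>x\<in>K. norm (A x) \<le> R"
    by (intro exI[of _ R] always_eventually) auto
qed

lemma moderate_upto_linear:
  fixes A :: "'a::euclidean_space \<Rightarrow> 'b::euclidean_space"
  assumes "bounded_linear A"
  shows "moderate_upto m (\<lambda>e k. A)"
proof -
  have "locally_bounded (\<lambda>e k. A)"
    by (rule locally_bounded_const[OF linear_continuous_on[OF assms]])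
  then have *: "locally_moderate (\<lambda>e k. A)" by (rule locally_bounded_imp_moderate)
  show ?thesis
  proof (cases m)
    case 0
    then show ?thesis using * linear_continuous_on[OF assms] by simp
  next
    case (Suc n)
    have 1: "(A has_derivative A) (at x)" for x
      using assms by (rule bounded_linear_imp_has_derivative)
    have "frechet_derivative A (at x) = A" for x
      using frechet_derivative_at[OF 1] by simp
    moreover have "A differentiable at x" for x
      using 1 by (rule differentiableI)
    ultimately show ?thesis using * by (simp add: Suc moderate_upto_const)
  qed
qed

section \<open>Closure under sums, bilinear operations, reindexing and composition\<close>

lemma locally_moderate_add:
  fixes u v :: "real \<Rightarrow> 'k \<Rightarrow> 'a::euclidean_space \<Rightarrow> 'b::euclidean_space"
  assumes "locally_moderate u" "locally_moderate v"
  shows "locally_moderate (\<lambda>e k x. u e k x + v e k x)"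
proof (rule locally_moderateI)
  fix K :: "'a set" assume K: "compact K"
  obtain N where N: "\<forall>\<^sub>F e in at_right 0. \<forall>k. \<forall>x\<in>K. norm (u e k x) \<le> (1 / e) ^ N"
    by (rule locally_moderateD[OF assms(1) K])
  obtain M where M: "\<forall>\<^sub>F e in at_right 0. \<forall>k. \<forall>x\<in>K. norm (v e k x) \<le> (1 / e) ^ M"
    by (rule locally_moderateD[OF assms(2) K])
  have "\<forall>\<^sub>F e in at_right 0. \<forall>k. \<forall>x\<in>K. norm (u e k x + v e k x) \<le> 2 * (1 / e) ^ (N + M)"
    using N M eventually_unit
  proof eventually_elim
    case (elim e)
    have le: "(1 / e) ^ N \<le> (1 / e) ^ (N + M)" "(1 / e) ^ M \<le> (1 / e) ^ (N + M)"
      using elim by (intro power_increasing; simp)+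
    have "norm (u e k x + v e k x) \<le> 2 * (1 / e) ^ (N + M)" if "x \<in> K" for k x
    proof -
      have "norm (u e k x) \<le> (1 / e) ^ N" "norm (v e k x) \<le> (1 / e) ^ M"
        using elim that by auto
      then show ?thesis using le norm_triangle_ineq[of "u e k x" "v e k x"] by linarith
    qed
    then show ?case by blast
  qed
  then show "\<exists>N c. \<forall>\<^sub>F e in at_right 0. \<forall>k. \<forall>x\<in>K. norm (u e k x + v e k x) \<le> c * (1 / e) ^ N"
    by blast
qed

lemma moderate_upto_add:
  "moderate_upto m u \<Longrightarrow> moderate_upto m v \<Longrightarrow> moderate_upto m (\<lambda>e k x. u e k x + v e k x)"
proof (induction m arbitrary: u v)
  case 0
  then show ?case by (auto intro!: locally_moderate_add continuous_on_add)
next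
  case (Suc m)
  show ?case
  proof (rule moderate_upto_SucI)
    show "locally_moderate (\<lambda>e k x. u e k x + v e k x)"
      using Suc by (auto intro!: locally_moderate_add)
    show "((\<lambda>x. u e k x + v e k x) has_derivative
        (\<lambda>b. frechet_derivative (u e k) (at x) b + frechet_derivative (v e k) (at x) b)) (at x)"
      if "e \<in> {0<..1}" for e k x
      using Suc.prems that by (intro has_derivative_add moderate_upto_has_derivative)
  qed (use Suc in auto)
qed

lemma moderate_upto_sum:
  "(\<And>i. i \<in> S \<Longrightarrow> moderate_upto m (u i)) \<Longrightarrow> moderate_upto m (\<lambda>e k x. \<Sum>i\<in>S. u i e k x)"
  by (induction S rule: infinite_finite_induct)
    (auto intro: moderate_upto_const moderate_upto_add)

lemma locally_moderate_bilinear: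
  fixes u :: "real \<Rightarrow> 'k \<Rightarrow> 'a::euclidean_space \<Rightarrow> 'c::euclidean_space" and v :: "real \<Rightarrow> 'k \<Rightarrow> 'a::euclidean_space \<Rightarrow> 'd::euclidean_space" and bop :: "'c \<Rightarrow> 'd \<Rightarrow> 'b::euclidean_space"
  assumes "bounded_bilinear bop" "locally_moderate u" "locally_moderate v"
  shows "locally_moderate (\<lambda>e k x. bop (u e k x) (v e k x))"
proof (rule locally_moderateI)
  fix K :: "'a set" assume K: "compact K"
  obtain N where N: "\<forall>\<^sub>F e in at_right 0. \<forall>k. \<forall>x\<in>K. norm (u e k x) \<le> (1 / e) ^ N"
    by (rule locally_moderateD[OF assms(2) K])
  obtain M where M: "\<forall>\<^sub>F e in at_right 0. \<forall>k. \<forall>x\<in>K. norm (v e k x) \<le> (1 / e) ^ M"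
    by (rule locally_moderateD[OF assms(3) K])
  obtain c where c: "c > 0" "\<And>a b. norm (bop a b) \<le> norm a * norm b * c"
    using bounded_bilinear.pos_bounded[OF assms(1)] by blast
  have "\<forall>\<^sub>F e in at_right 0. \<forall>k. \<forall>x\<in>K. norm (bop (u e k x) (v e k x)) \<le> c * (1 / e) ^ (N + M)"
    using N M eventually_unit
  proof eventually_elim
    case (elim e)
    show ?case
    proof (intro allI ballI)
      fix k x assume "x \<in> K"
      have "norm (bop (u e k x) (v e k x)) \<le> norm (u e k x) * norm (v e k x) * c" by (rule c)
      also have "\<dots> \<le> (1 / e) ^ N * (1 / e) ^ M * c"
        using elim \<open>x \<in> K\<close> c by (intro mult_mono) auto
      finally show "norm (bop (u e k x) (v e k x)) \<le> c * (1 / e) ^ (N + M)"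
        by (simp add: power_add mult_ac)
    qed
  qed
  then show "\<exists>N c. \<forall>\<^sub>F e in at_right 0. \<forall>k. \<forall>x\<in>K. norm (bop (u e k x) (v e k x)) \<le> c * (1 / e) ^ N"
    by blast
qed

lemma moderate_upto_bilinear:
  fixes u :: "real \<Rightarrow> 'k \<Rightarrow> 'a::euclidean_space \<Rightarrow> 'c::euclidean_space" and v :: "real \<Rightarrow> 'k \<Rightarrow> 'a::euclidean_space \<Rightarrow> 'd::euclidean_space" and bop :: "'c \<Rightarrow> 'd \<Rightarrow> 'b::euclidean_space"
  assumes "bounded_bilinear bop"
  shows "moderate_upto m u \<Longrightarrow> moderate_upto m v \<Longrightarrow>
    moderate_upto m (\<lambda>e k x. bop (u e k x) (v e k x))"
proof (induction m arbitrary: u v)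
  case 0
  have "continuous_on UNIV (\<lambda>x. bop (u e k x) (v e k x))" if "e \<in> {0<..1}" for e k
    by (rule bounded_bilinear.continuous_on[OF assms]) (use 0 that in simp_all)
  then show ?case using 0 locally_moderate_bilinear[OF assms, of u v] by simp
next
  case (Suc m)
  show ?case
  proof (rule moderate_upto_SucI)
    show "locally_moderate (\<lambda>e k x. bop (u e k x) (v e k x))"
      using Suc.prems by (intro locally_moderate_bilinear[OF assms]) auto
    show "((\<lambda>x. bop (u e k x) (v e k x)) has_derivative
        (\<lambda>b. bop (u e k x) (frechet_derivative (v e k) (at x) b) +
          bop (frechet_derivative (u e k) (at x) b) (v e k x))) (at x)"
      if "e \<in> {0<..1}" for e k x
      using Suc.prems that
      by (intro bounded_bilinear.FDERIV[OF assms] moderate_upto_has_derivative)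
    show "moderate_upto m (\<lambda>e k x. bop (u e k x) (frechet_derivative (v e k) (at x) b) +
          bop (frechet_derivative (u e k) (at x) b) (v e k x))" if "b \<in> Basis" for b
      using Suc.prems that
      by (intro moderate_upto_add Suc.IH moderate_upto_derivative moderate_upto_Suc_imp[of m u]
          moderate_upto_Suc_imp[of m v])
  qed
qed

lemma moderate_upto_linear_comp:
  assumes "bounded_linear A"
  shows "moderate_upto m u \<Longrightarrow> moderate_upto m (\<lambda>e k x. A (u e k x))"
proof -
  \<comment> \<open>A linear map becomes a bilinear one by letting a scalar act on its value; with
    the constant net 1 as the scalar factor, the bilinear case applies.\<close>
  have "bounded_bilinear (\<lambda>x (r::real). r *\<^sub>R A x)"
    by (rule bounded_bilinear.comp1[OF bounded_bilinear.flip[OF bounded_bilinear_scaleR] assms])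
  from moderate_upto_bilinear[OF this, of m u "\<lambda>e k x. 1"]
  show "moderate_upto m u \<Longrightarrow> moderate_upto m (\<lambda>e k x. A (u e k x))"
    by (simp add: moderate_upto_const)
qed

lemma moderate_upto_diff:
  "moderate_upto m u \<Longrightarrow> moderate_upto m v \<Longrightarrow> moderate_upto m (\<lambda>e k x. u e k x - v e k x)"
  using moderate_upto_add[of m u "\<lambda>e k x. - v e k x"]
    moderate_upto_linear_comp[OF bounded_linear_minus[OF bounded_linear_ident], of m v]
  by simp

lemma moderate_upto_componentwise:
  "moderate_upto m u \<longleftrightarrow> (\<forall>b\<in>Basis. moderate_upto m (\<lambda>e k x. u e k x \<bullet> b))"
proof
  assume "moderate_upto m u"
  then show "\<forall>b\<in>Basis. moderate_upto m (\<lambda>e k x. u e k x \<bullet> b)"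
    by (auto intro!: moderate_upto_linear_comp[of "\<lambda>x. x \<bullet> _"] bounded_linear_inner_left)
next
  assume *: "\<forall>b\<in>Basis. moderate_upto m (\<lambda>e k x. u e k x \<bullet> b)"
  have "moderate_upto m (\<lambda>e k x. \<Sum>b\<in>Basis. (u e k x \<bullet> b) *\<^sub>R b)"
    using * by (intro moderate_upto_sum moderate_upto_linear_comp[of "\<lambda>r. r *\<^sub>R _"]
        bounded_linear_scaleR_left) auto
  then show "moderate_upto m u" by (simp add: euclidean_representation)
qed

text \<open>Uniformity in the index pays off here: the new index may depend on e. With an iteration
  number of order 1 / e this passes from the Picard iterates to the approximate flow.\<close>

lemma locally_moderate_reindex:
  fixes u :: "real \<Rightarrow> 'k \<Rightarrow> 'b::euclidean_space \<Rightarrow> 'c::euclidean_space"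
  assumes "locally_moderate u"
  shows "locally_moderate (\<lambda>e k. u e (h e k))"
proof (rule locally_moderateI)
  fix K :: "'b set" assume K: "compact K"
  obtain N where N: "\<forall>\<^sub>F e in at_right 0. \<forall>k. \<forall>x\<in>K. norm (u e k x) \<le> (1 / e) ^ N"
    by (rule locally_moderateD[OF assms(1) K])
  then have "\<forall>\<^sub>F e in at_right 0. \<forall>k. \<forall>x\<in>K. norm (u e (h e k) x) \<le> 1 * (1 / e) ^ N"
    by (rule eventually_mono) simp
  then show "\<exists>N c. \<forall>\<^sub>F e in at_right 0. \<forall>k. \<forall>x\<in>K. norm (u e (h e k) x) \<le> c * (1 / e) ^ N"
    by blast
qed

lemma moderate_upto_reindex:
  "moderate_upto m u \<Longrightarrow> moderate_upto m (\<lambda>e k. u e (h e k))"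
proof (induction m arbitrary: u)
  case 0
  then show ?case by (auto intro: locally_moderate_reindex)
next
  case (Suc m)
  have "locally_moderate (\<lambda>e k. u e (h e k))" 
    using Suc.prems by (auto intro: locally_moderate_reindex)
  moreover have "moderate_upto m (\<lambda>e k x. frechet_derivative (u e (h e k)) (at x) b)"
    if "b \<in> Basis" for b
    using Suc.IH[of "\<lambda>e k x. frechet_derivative (u e k) (at x) b"] Suc.prems that by auto
  ultimately show ?case using Suc.prems by auto
qed

lemma locally_moderate_nat_cases:
  fixes u :: "real \<Rightarrow> nat \<Rightarrow> 'a::euclidean_space \<Rightarrow> 'b::euclidean_space"
  assumes "locally_moderate (\<lambda>e (k::nat). u e 0)" "locally_moderate (\<lambda>e k. u e (Suc k))"
  shows "locally_moderate u"
proof (rule locally_moderateI)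
  fix K :: "'a set" assume K: "compact K"
  obtain N where N: "\<forall>\<^sub>F e in at_right 0. \<forall>k::nat. \<forall>x\<in>K. norm (u e 0 x) \<le> (1 / e) ^ N"
    by (rule locally_moderateD[OF assms(1) K])
  obtain M where M: "\<forall>\<^sub>F e in at_right 0. \<forall>k. \<forall>x\<in>K. norm (u e (Suc k) x) \<le> (1 / e) ^ M"
    by (rule locally_moderateD[OF assms(2) K])
  have "\<forall>\<^sub>F e in at_right 0. \<forall>k. \<forall>x\<in>K. norm (u e k x) \<le> 1 * (1 / e) ^ (N + M)"
    using N M eventually_unit
  proof eventually_elim
    case (elim e)
    have "(1 / e) ^ N \<le> (1 / e) ^ (N + M)" "(1 / e) ^ M \<le> (1 / e) ^ (N + M)"
      using elim by (intro power_increasing; simp)+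
    moreover have "norm (u e k x) \<le> (1 / e) ^ N \<or> norm (u e k x) \<le> (1 / e) ^ M"
      if "x \<in> K" for k x
      using elim that by (cases k) auto
    ultimately show ?case by (auto intro: order_trans)
  qed
  then show "\<exists>N c. \<forall>\<^sub>F e in at_right 0. \<forall>k. \<forall>x\<in>K. norm (u e k x) \<le> c * (1 / e) ^ N"
    by blast
qed

text \<open>In a recursion the time derivative is given explicitly at every successor index by the
  integrand of the previous stage, whereas index 0 has its own formula; the two cases are treated
  apart and joined by this lemma.\<close>

lemma moderate_upto_nat_cases:
  fixes u :: "real \<Rightarrow> nat \<Rightarrow> 'a::euclidean_space \<Rightarrow> 'b::euclidean_space"
  shows "moderate_upto m (\<lambda>e (k::nat). u e 0) \<Longrightarrow> moderate_upto m (\<lambda>e k. u e (Suc k)) \<Longrightarrow>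
    moderate_upto m u"
proof (induction m arbitrary: u)
  case 0
  have "continuous_on UNIV (u e k)" if "e \<in> {0<..1}" for e k
    using 0 that by (cases k) auto
  then show ?case using 0 locally_moderate_nat_cases[of u] by auto
next
  case (Suc m)
  have "locally_moderate u" using Suc.prems by (simp add: locally_moderate_nat_cases[of u])
  moreover have "u e k differentiable at x" if "e \<in> {0<..1}" for e k x
    using Suc.prems that by (cases k) simp_all
  moreover have "moderate_upto m (\<lambda>e k x. frechet_derivative (u e k) (at x) b)" if "b \<in> Basis" for b
    by (rule Suc.IH) (use Suc.prems that in simp_all)
  ultimately show ?case by simp
qed

text \<open>The outer family is controlled on compact sets only, so the inner one must stay in a
  single ball for all k and all small e.\<close>

lemma locally_moderate_comp:
  fixes u :: "real \<Rightarrow> 'k \<Rightarrow> 'b::euclidean_space \<Rightarrow> 'c::euclidean_space" and v :: "real \<Rightarrow> 'k \<Rightarrow> 'a::euclidean_space \<Rightarrow> 'b::euclidean_space"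
  assumes "locally_moderate u" "locally_bounded v"
  shows "locally_moderate (\<lambda>e k x. u e k (v e k x))"
  unfolding locally_moderate_def
proof (intro allI impI)
  fix K :: "'a set" assume K: "compact K"
  then obtain R where R: "\<forall>\<^sub>F e in at_right 0. \<forall>k. \<forall>x\<in>K. norm (v e k x) \<le> R"
    using assms(2) unfolding locally_bounded_def by blast
  obtain N where N: "\<forall>\<^sub>F e in at_right 0. \<forall>k. \<forall>x\<in>cball 0 R. norm (u e k x) \<le> (1 / e) ^ N"
    by (rule locally_moderateD[OF assms(1) compact_cball[of 0 R]])
  have "\<forall>\<^sub>F e in at_right 0. \<forall>k. \<forall>x\<in>K. norm (u e k (v e k x)) \<le> (1 / e) ^ N"
    using N R by eventually_elim auto
  then show "\<exists>N. \<forall>\<^sub>F e in at_right 0. \<forall>k. \<forall>x\<in>K. norm (u e k (v e k x)) \<le> (1 / e) ^ N" by blast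
qed

lemma has_derivative_expand:
  assumes "(f has_derivative f') F"
  shows "f' (h::'a::euclidean_space) = (\<Sum>i\<in>Basis. (h \<bullet> i) *\<^sub>R f' i)"
proof -
  have "linear f'" using assms by (rule has_derivative_linear)
  then have "f' (\<Sum>i\<in>Basis. (h \<bullet> i) *\<^sub>R i) = (\<Sum>i\<in>Basis. (h \<bullet> i) *\<^sub>R f' i)"
    by (simp add: linear_sum linear_scale)
  then show ?thesis by (simp add: euclidean_representation)
qed

text \<open>By the chain rule, expanded along the basis, a derivative is a sum of components of the
  derivative of v times partial derivatives of u along the same inner family v. The induction
  therefore varies u and keeps v, and boundedness is asked of v alone, never of its
  derivatives.\<close>

lemma moderate_upto_comp:
  fixes u :: "real \<Rightarrow> 'k \<Rightarrow> 'b::euclidean_space \<Rightarrow> 'c::euclidean_space" and v :: "real \<Rightarrow> 'k \<Rightarrow> 'a::euclidean_space \<Rightarrow> 'b::euclidean_space"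
  assumes "locally_bounded v"
  shows "moderate_upto m u \<Longrightarrow> moderate_upto m v \<Longrightarrow> moderate_upto m (\<lambda>e k x. u e k (v e k x))"
proof (induction m arbitrary: u)
  case 0
  have "continuous_on UNIV (\<lambda>x. u e k (v e k x))" if "e \<in> {0<..1}" for e k
    using 0 that continuous_on_compose2[of UNIV "u e k" UNIV "v e k"] by simp
  then show ?case using 0 locally_moderate_comp[OF _ assms, of u] by simp
next
  case (Suc m)
  let ?D = "\<lambda>e k x b. \<Sum>i\<in>Basis. (frechet_derivative (v e k) (at x) b \<bullet> i) *\<^sub>R
     frechet_derivative (u e k) (at (v e k x)) i"
  show ?case
  proof (rule moderate_upto_SucI)
    show "locally_moderate (\<lambda>e k x. u e k (v e k x))"
      using Suc.prems by (intro locally_moderate_comp[OF _ assms]) simp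
    show "((\<lambda>x. u e k (v e k x)) has_derivative ?D e k x) (at x)"
      if "e \<in> {0<..1}" for e k x
    proof -
      have u: "(u e k has_derivative frechet_derivative (u e k) (at (v e k x))) (at (v e k x))"
        by (rule moderate_upto_has_derivative[OF Suc.prems(1) that])
      show ?thesis
        using has_derivative_compose[OF moderate_upto_has_derivative[OF Suc.prems(2) that] u]
        by (simp add: has_derivative_expand[OF u, symmetric])
    qed
    show "moderate_upto m (\<lambda>e k x. ?D e k x b)" if "b \<in> Basis" for b
    proof (intro moderate_upto_sum moderate_upto_bilinear[OF bounded_bilinear_scaleR])
      fix i :: 'b assume i: "i \<in> Basis"
      show "moderate_upto m (\<lambda>e k x. frechet_derivative (v e k) (at x) b \<bullet> i)"
        by (intro moderate_upto_linear_comp[OF bounded_linear_inner_left]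
            moderate_upto_derivative[OF Suc.prems(2) that])
      show "moderate_upto m (\<lambda>e k x. frechet_derivative (u e k) (at (v e k x)) i)"
        using Suc.IH[OF moderate_upto_derivative[OF Suc.prems(1) i]] moderate_upto_Suc_imp[OF Suc.prems(2)]
        by simp
    qed
  qed
qed

section \<open>Integration in time\<close>

text \<open>\<open>\<integral>\<^sub>0\<^sup>t g(s, x) ds\<close>, rescaled to the unit interval so that both signs of \<open>t\<close> are covered.\<close>

definition time_integral ::
    "(real \<times> 'a::euclidean_space \<Rightarrow> 'b::euclidean_space) \<Rightarrow> real \<times> 'a \<Rightarrow> 'b" where
  "time_integral g z = fst z *\<^sub>R integral {0..1} (\<lambda>r. g (r * fst z, snd z))"

lemma continuous_on_scaled_time:
  fixes g :: "real \<times> 'a::euclidean_space \<Rightarrow> 'b::euclidean_space"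
  assumes "continuous_on UNIV g"
  shows "continuous_on S (\<lambda>r. g (r * fst z, snd z))"
  by (rule continuous_on_compose2[OF assms]) (auto intro!: continuous_intros)

lemma time_integral_continuous_on:
  assumes "continuous_on UNIV g"
  shows "continuous_on UNIV (time_integral g)"
proof -
  have "continuous_on (UNIV \<times> cbox 0 (1::real)) (\<lambda>(z, r). g (r * fst z, snd z))"
    unfolding case_prod_beta
    by (rule continuous_on_compose2[OF assms]) (auto intro!: continuous_intros)
  then have "continuous_on UNIV (\<lambda>z. integral (cbox 0 1) (\<lambda>r. g (r * fst z, snd z)))"
    by (rule integral_continuous_on_param)
  then show ?thesis
    unfolding time_integral_def[abs_def] by (auto intro!: continuous_intros simp: cbox_interval)
qed

lemma time_integral_diff:
  assumes "continuous_on UNIV g" "continuous_on UNIV h"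
  shows "time_integral (\<lambda>z. g z - h z) z = time_integral g z - time_integral h z"
  unfolding time_integral_def
  by (simp add: integral_diff integrable_continuous_interval continuous_on_scaled_time assms
      scaleR_diff_right)

lemma norm_time_integral_le:
  assumes "continuous_on UNIV g" "\<And>r. r \<in> {0..1} \<Longrightarrow> norm (g (r * t, x)) \<le> M"
  shows "norm (time_integral g (t, x)) \<le> \<bar>t\<bar> * M"
proof -
  have "norm (integral {0..1} (\<lambda>r. g (r * t, x))) \<le> M * (1 - 0)"
    using continuous_on_scaled_time[OF assms(1), of _ "(t, x)"] assms(2)
    by (intro integral_bound) auto
  then show ?thesis by (simp add: time_integral_def mult_left_mono)
qed

text \<open>The right-hand side is the exact integral of the bounding exponential. The subtracted P
  leaves room for an initial value of norm at most P, so a bound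
  \<open>P * exp (Q * \<bar>t\<bar>)\<close> reproduces itself under the integral recursion. This is
  the inductive step of every estimate that is uniform in k: growth, moderateness, contraction and
  the gradient bound.\<close>

lemma norm_time_integral_exp_le:
  assumes cont: "continuous_on UNIV g"
    and le: "\<And>s. \<bar>s\<bar> \<le> \<bar>t\<bar> \<Longrightarrow> norm (g (s, x)) \<le> P * Q * exp (Q * \<bar>s\<bar>)"
  shows "norm (time_integral g (t, x)) \<le> P * exp (Q * \<bar>t\<bar>) - P"
proof -
  let ?p = "\<lambda>r. P * exp (Q * (r * \<bar>t\<bar>))"
  let ?q = "\<lambda>r. \<bar>t\<bar> * (P * Q * exp (Q * (r * \<bar>t\<bar>)))"
  have int: "(?q has_integral ?p 1 - ?p 0) {0..1}"
    by (rule fundamental_theorem_of_calculus)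
      (auto intro!: derivative_eq_intros simp: has_real_derivative_iff_has_vector_derivative[symmetric])
  have "norm (time_integral g (t, x)) = norm (integral {0..1} (\<lambda>r. t *\<^sub>R g (r * t, x)))"
    by (simp add: time_integral_def)
  also have "\<dots> \<le> integral {0..1} ?q"
  proof (rule integral_norm_bound_integral)
    show "(\<lambda>r. t *\<^sub>R g (r * t, x)) integrable_on {0..1}"
      using continuous_on_scaled_time[OF cont, of _ "(t, x)"]
      by (intro integrable_continuous_interval continuous_intros) auto
    show "?q integrable_on {0..1}" using int by blast
    fix r :: real assume r: "r \<in> {0..1}"
    then have "\<bar>r * t\<bar> \<le> \<bar>t\<bar>" "\<bar>r * t\<bar> = r * \<bar>t\<bar>" by (auto simp: abs_mult mult_left_le_one_le)
    then show "norm (t *\<^sub>R g (r * t, x)) \<le> ?q r"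
      using le[of "r * t"] by (simp add: mult_left_mono)
  qed
  also have "\<dots> = ?p 1 - ?p 0" using int by blast
  finally show ?thesis by simp
qed

text \<open>Differentiating under the rescaled integral gives a contribution of the time direction
  that still contains the time derivative of g. Together with the derivative of the prefactor
  \<open>fst z\<close> it collapses to g at the end point, so that g is differentiated in space
  only.\<close>

lemma time_integral_has_derivative:
  fixes g :: "real \<times> 'a::euclidean_space \<Rightarrow> 'b::euclidean_space"
  assumes g: "\<And>z. (g has_derivative g' z) (at z)"
    and cont: "\<And>b. b \<in> Basis \<Longrightarrow> continuous_on UNIV (\<lambda>z. g' z b)"
  shows "(time_integral g has_derivative
    (\<lambda>w. fst w *\<^sub>R g z + time_integral (\<lambda>z. g' z (0, snd w)) z)) (at z)"
proof -
  have lin: "bounded_linear (g' z)" for z using g by (rule has_derivative_bounded_linear)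
  have contg: "continuous_on UNIV g"
    using g by (meson continuous_at_imp_continuous_on has_derivative_continuous)
  \<comment> \<open>Continuity along each basis vector becomes joint continuity in the base point
    and the direction, because the derivative is the finite sum of its basis values weighted by
    coordinates.\<close>
  have contg': "continuous_on S (\<lambda>y. g' (p y) (q y))"
    if "continuous_on S p" "continuous_on S q" for S :: "'c::topological_space set" and p q
  proof -
    have "continuous_on S (\<lambda>y. \<Sum>b\<in>Basis. (q y \<bullet> b) *\<^sub>R g' (p y) b)"
      using that by (intro continuous_intros continuous_on_compose2[OF cont]) auto
    then show ?thesis by (simp add: has_derivative_expand[OF g, symmetric])
  qed
  \<comment> \<open>The derivative of the integrand in z, packed as a bounded linear function so
    that it can itself be integrated in r, which the Leibniz rule requires.\<close>
  define fx where "fx z r = Blinfun (\<lambda>w. g' (r * fst z, snd z) (r * fst w, snd w))" for z r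
  have bl: "bounded_linear (\<lambda>w. (r * fst w, snd w) :: real \<times> 'a)" for r
    by (intro bounded_linear_Pair bounded_linear_const_mult bounded_linear_fst bounded_linear_snd)
  have fx: "blinfun_apply (fx z r) = (\<lambda>w. g' (r * fst z, snd z) (r * fst w, snd w))" for z r
    unfolding fx_def by (rule bounded_linear_Blinfun_apply, rule bounded_linear_compose[OF lin bl])
  have contfx: "continuous_on (UNIV \<times> cbox 0 (1::real)) (\<lambda>(z, r). fx z r)"
    unfolding case_prod_beta
    by (rule continuous_on_blinfun_componentwise)
      (auto simp: fx intro!: contg' continuous_intros)
  have contfx': "continuous_on (cbox 0 1) (fx z)"
    by (rule continuous_on_blinfun_componentwise) (auto simp: fx intro!: contg' continuous_intros)
  have "((\<lambda>z. integral (cbox 0 1) (\<lambda>r. g (r * fst z, snd z))) has_derivative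
      integral (cbox 0 1) (fx z)) (at z within UNIV)"
  proof (rule leibniz_rule[OF _ _ contfx])
    fix z :: "real \<times> 'a" and r :: real
    show "((\<lambda>z. g (r * fst z, snd z)) has_derivative fx z r) (at z within UNIV)"
      unfolding fx
      using has_derivative_compose[OF bounded_linear_imp_has_derivative[OF bl] g] by simp
    show "(\<lambda>r. g (r * fst z, snd z)) integrable_on cbox 0 1"
      using integrable_continuous continuous_on_scaled_time[OF contg] by blast
  qed auto
  then have "(time_integral g has_derivative (\<lambda>w. fst z *\<^sub>R integral (cbox 0 1) (fx z) w +
      fst w *\<^sub>R integral {0..1} (\<lambda>r. g (r * fst z, snd z)))) (at z)"
    unfolding time_integral_def[abs_def]
    by (auto intro!: derivative_eq_intros simp: cbox_interval)
  moreover have "fst z *\<^sub>R integral (cbox 0 1) (fx z) w +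
      fst w *\<^sub>R integral {0..1} (\<lambda>r. g (r * fst z, snd z)) =
      fst w *\<^sub>R g z + time_integral (\<lambda>z. g' z (0, snd w)) z" for w
  proof -
    let ?D = "\<lambda>r. g' (r * fst z, snd z)"
    have int1: "(\<lambda>r. r *\<^sub>R ?D r (1, 0)) integrable_on {0..1}"
      by (intro integrable_continuous_interval continuous_intros contg')
    have int2: "(\<lambda>r. ?D r (0, snd w)) integrable_on {0..1}"
      by (intro integrable_continuous_interval contg' continuous_intros)
    have int3: "(\<lambda>r. g (r * fst z, snd z)) integrable_on {0..1}"
      by (intro integrable_continuous_interval continuous_on_scaled_time contg)
    have split: "?D r (r * fst w, snd w) = fst w *\<^sub>R (r *\<^sub>R ?D r (1, 0)) + ?D r (0, snd w)" for r
    proof -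
      have "(r * fst w, snd w) = (fst w * r) *\<^sub>R (1, 0) + (0, snd w)" by (simp add: mult.commute)
      then have "?D r (r * fst w, snd w) = ?D r ((fst w * r) *\<^sub>R (1, 0) + (0, snd w))" by (rule arg_cong)
      also have "\<dots> = (fst w * r) *\<^sub>R ?D r (1, 0) + ?D r (0, snd w)"
        using lin[of "(r * fst z, snd z)"]
        by (simp only: linear_add[OF bounded_linear.linear] linear_scale[OF bounded_linear.linear])
      finally show ?thesis by simp
    qed
    have "integral (cbox 0 1) (fx z) w = integral {0..1} (\<lambda>r. ?D r (r * fst w, snd w))"
      using blinfun_apply_integral[OF integrable_continuous[OF contfx'], of w]
      by (simp add: fx cbox_interval)
    also have "\<dots> = fst w *\<^sub>R integral {0..1} (\<lambda>r. r *\<^sub>R ?D r (1, 0)) + integral {0..1} (\<lambda>r. ?D r (0, snd w))"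
      unfolding split using integral_add[OF integrable_cmul[OF int1, of "fst w"] int2]
      by (simp only: integral_cmul)
    finally have 1: "integral (cbox 0 1) (fx z) w = \<dots>" .
    \<comment> \<open>The integrand is the derivative of
      \<open>r *\<^sub>R g (r * fst z, snd z)\<close>, which vanishes at r = 0 and equals
      \<open>g z\<close> at r = 1. This evaluates the sum of the two time contributions.\<close>
    have "((\<lambda>r. g (r * fst z, snd z) + fst z *\<^sub>R (r *\<^sub>R ?D r (1, 0))) has_integral
        1 *\<^sub>R g (1 * fst z, snd z) - 0 *\<^sub>R g (0 * fst z, snd z)) {0..1}"
    proof (rule fundamental_theorem_of_calculus)
      fix r :: real
      have "((\<lambda>r. g (r * fst z, snd z)) has_derivative (\<lambda>h. ?D r (h * fst z, 0))) (at r)"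
        by (rule has_derivative_compose[OF _ g, of "\<lambda>r. (r * fst z, snd z)"])
          (auto intro!: derivative_eq_intros)
      moreover have "?D r (h * fst z, 0) = h *\<^sub>R (fst z *\<^sub>R ?D r (1, 0))" for h
        using linear_scale[OF bounded_linear.linear[OF lin[of "(r * fst z, snd z)"]], of "h * fst z" "(1, 0)"]
        by simp
      ultimately have "((\<lambda>r. g (r * fst z, snd z)) has_vector_derivative fst z *\<^sub>R ?D r (1, 0)) (at r)"
        by (simp add: has_vector_derivative_def)
      then have "((\<lambda>r. r *\<^sub>R g (r * fst z, snd z)) has_vector_derivative
          r *\<^sub>R (fst z *\<^sub>R ?D r (1, 0)) + 1 *\<^sub>R g (r * fst z, snd z)) (at r)"
        by (intro has_vector_derivative_scaleR) (auto intro!: derivative_eq_intros)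
      then show "((\<lambda>r. r *\<^sub>R g (r * fst z, snd z)) has_vector_derivative
          g (r * fst z, snd z) + fst z *\<^sub>R (r *\<^sub>R ?D r (1, 0))) (at r within {0..1})"
        by (auto simp: algebra_simps intro: has_vector_derivative_at_within)
    qed simp
    then have "integral {0..1} (\<lambda>r. g (r * fst z, snd z) + fst z *\<^sub>R (r *\<^sub>R ?D r (1, 0))) = g z"
      by (simp add: integral_unique)
    then have 2: "integral {0..1} (\<lambda>r. g (r * fst z, snd z)) +
        fst z *\<^sub>R integral {0..1} (\<lambda>r. r *\<^sub>R ?D r (1, 0)) = g z"
      unfolding integral_add[OF int3 integrable_cmul[OF int1, of "fst z"]] by (simp only: integral_cmul)
    show ?thesis unfolding 1 2[symmetric] by (simp add: time_integral_def algebra_simps)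
  qed
  ultimately show ?thesis by simp
qed

lemma Basis_space: "\<xi> \<in> Basis \<Longrightarrow> (0, \<xi>) \<in> (Basis :: (real \<times> 'a::euclidean_space) set)"
  by (simp add: Basis_prod_def)

lemma Basis_time_cases:
  fixes b :: "real \<times> 'a::euclidean_space"
  assumes "b \<in> Basis"
  obtains "b = (1, 0)" | \<xi> where "b = (0, \<xi>)" "\<xi> \<in> Basis"
  using assms by (auto simp: Basis_prod_def)

lemma locally_moderate_time_integral:
  fixes g :: "real \<Rightarrow> 'k \<Rightarrow> real \<times> 'a::euclidean_space \<Rightarrow> 'b::euclidean_space"
  assumes "locally_moderate g" "\<And>e k. e \<in> {0<..1} \<Longrightarrow> continuous_on UNIV (g e k)"
  shows "locally_moderate (\<lambda>e k. time_integral (g e k))"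
proof (rule locally_moderateI)
  fix K :: "(real \<times> 'a) set" assume K: "compact K"
  \<comment> \<open>The integral samples points of K with time scaled by a factor in [0, 1]; these
    sweep out a compact set.\<close>
  define K' where "K' = (\<lambda>(r, z). (r * fst z, snd z)) ` ({0..1} \<times> K)"
  have "compact K'"
    unfolding K'_def case_prod_beta
    by (intro compact_continuous_image compact_Times K continuous_intros) auto
  then obtain N where N: "\<forall>\<^sub>F e in at_right 0. \<forall>k. \<forall>z\<in>K'. norm (g e k z) \<le> (1 / e) ^ N"
    using locally_moderateD[OF assms(1)] by blast
  have "bounded (fst ` K)"
    by (intro compact_imp_bounded compact_continuous_image K continuous_intros)
  then obtain T where T: "\<And>z. z \<in> K \<Longrightarrow> \<bar>fst z\<bar> \<le> T" unfolding bounded_iff by auto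
  have "\<forall>\<^sub>F e in at_right 0. \<forall>k. \<forall>z\<in>K. norm (time_integral (g e k) z) \<le> T * (1 / e) ^ N"
    using N eventually_unit
  proof eventually_elim
    case (elim e)
    have "norm (time_integral (g e k) z) \<le> T * (1 / e) ^ N" if "z \<in> K" for k z
    proof -
      have "(r * fst z, snd z) \<in> K'" if "r \<in> {0..1}" for r
        using that \<open>z \<in> K\<close> unfolding K'_def by force
      then have "norm (time_integral (g e k) (fst z, snd z)) \<le> \<bar>fst z\<bar> * (1 / e) ^ N"
        using elim by (intro norm_time_integral_le assms(2)) auto
      also have "\<dots> \<le> T * (1 / e) ^ N" using T[OF that] elim by (intro mult_right_mono) auto
      finally show ?thesis by simp
    qed
    then show ?case by blast
  qed
  then show "\<exists>N c. \<forall>\<^sub>F e in at_right 0. \<forall>k. \<forall>x\<in>K. norm (time_integral (g e k) x) \<le> c * (1 / e) ^ N"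
    by blast
qed

lemma moderate_upto_time_integral:
  "moderate_upto m g \<Longrightarrow> moderate_upto m (\<lambda>e k. time_integral (g e k))"
proof (induction m arbitrary: g)
  case 0
  then show ?case
    using locally_moderate_time_integral[of g] by (simp add: time_integral_continuous_on)
next
  case (Suc m)
  note cont = moderate_upto_continuous_on[OF Suc.prems]
  show ?case
  proof (rule moderate_upto_SucI)
    show "locally_moderate (\<lambda>e k. time_integral (g e k))"
      using Suc.prems cont by (intro locally_moderate_time_integral) simp_all
    show "(time_integral (g e k) has_derivative (\<lambda>w. fst w *\<^sub>R g e k z +
        time_integral (\<lambda>z. frechet_derivative (g e k) (at z) (0, snd w)) z)) (at z)"
      if "e \<in> {0<..1}" for e k z
      using moderate_upto_has_derivative[OF Suc.prems that]
        moderate_upto_continuous_on[OF moderate_upto_derivative[OF Suc.prems] that]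
      by (rule time_integral_has_derivative)
    fix b :: "real \<times> 'b" assume "b \<in> Basis"
    then have "moderate_upto m (\<lambda>e k. time_integral (\<lambda>z. frechet_derivative (g e k) (at z) (0, snd b)))"
    proof (cases rule: Basis_time_cases)
      case 1
      \<comment> \<open>In the time direction the spatial part of b is 0, so the integrand is a
        derivative applied to the zero vector; the term reduces to the integral of the zero
        net.\<close>
      have "moderate_upto m (\<lambda>e (k::'a). time_integral (\<lambda>z::real \<times> 'b. 0 :: 'c))"
        by (rule Suc.IH) (rule moderate_upto_const)
      moreover have "frechet_derivative (g e k) (at z) (0, 0) = 0" if "e \<in> {0<..1}" for e k z
        using linear_0[OF has_derivative_linear[OF moderate_upto_has_derivative[OF Suc.prems that, of k z]]]
        by (simp add: zero_prod_def)
      ultimately show ?thesis by (elim moderate_upto_cong) (simp add: 1)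
    next
      case (2 \<xi>)
      then show ?thesis using \<open>b \<in> Basis\<close> Suc.IH[OF moderate_upto_derivative[OF Suc.prems]] by simp
    qed
    then show "moderate_upto m (\<lambda>e k z. fst b *\<^sub>R g e k z +
        time_integral (\<lambda>z. frechet_derivative (g e k) (at z) (0, snd b)) z)"
      by (intro moderate_upto_add moderate_upto_linear_comp[OF bounded_linear_scaleR_right]
          moderate_upto_Suc_imp[OF Suc.prems])
  qed
qed

section \<open>Linear recursions with logarithmic coefficients\<close>

definition log_bounded :: "(real \<Rightarrow> 'k \<Rightarrow> 'a::euclidean_space \<Rightarrow> 'b::euclidean_space) \<Rightarrow> bool" where
  "log_bounded u \<longleftrightarrow> (\<forall>K. compact K \<longrightarrow>
     (\<exists>L. \<forall>\<^sub>F e in at_right 0. \<forall>k. \<forall>x\<in>K. norm (u e k x) \<le> L * \<bar>ln e\<bar>))"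

text \<open>For such e, \<open>\<bar>ln e\<bar>\<close> is \<open>ln (1 / e)\<close>, so
  exponentiating a multiple of it gives a power of 1 / e. Here logarithmic bounds turn into moderate
  ones.\<close>

lemma exp_mult_abs_ln_le:
  assumes "0 < e" "e \<le> 1" "y \<le> real n"
  shows "exp (y * \<bar>ln e\<bar>) \<le> (1 / e) ^ n"
proof -
  have "\<bar>ln e\<bar> = ln (1 / e)" using assms by (simp add: ln_div)
  then have "exp (y * \<bar>ln e\<bar>) \<le> exp (real n * ln (1 / e))"
    using assms by (simp add: mult_right_mono)
  also have "\<dots> = (1 / e) ^ n" using assms by (simp add: exp_of_nat_mult)
  finally show ?thesis .
qed

lemma compact_subset_time_box:
  fixes K :: "(real \<times> 'a::euclidean_space) set"
  assumes "compact K"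
  obtains T r where "T > 0" "r > 0" "K \<subseteq> {-T..T} \<times> cball 0 r"
proof -
  have "bounded (fst ` K)" "bounded (snd ` K)"
    by (intro compact_imp_bounded compact_continuous_image assms continuous_intros)+
  then obtain T r where "T > 0" "r > 0" "\<forall>x\<in>fst ` K. norm x \<le> T" "\<forall>x\<in>snd ` K. norm x \<le> r"
    unfolding bounded_pos by blast
  then have "K \<subseteq> {-T..T} \<times> cball 0 r" by (force simp: abs_le_iff)
  then show ?thesis using that \<open>T > 0\<close> \<open>r > 0\<close> by blast
qed

lemma log_bounded_finite:
  assumes "finite S" "\<And>b. b \<in> S \<Longrightarrow> log_bounded (a b)" "compact K"
  obtains L where "L \<ge> 0"
    "\<forall>\<^sub>F e in at_right 0. \<forall>b\<in>S. \<forall>k. \<forall>x\<in>K. norm (a b e k x) \<le> L * \<bar>ln e\<bar>"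
proof -
  have "\<forall>b\<in>S. \<exists>L. \<forall>\<^sub>F e in at_right 0. \<forall>k. \<forall>x\<in>K. norm (a b e k x) \<le> L * \<bar>ln e\<bar>"
    using assms(2,3) unfolding log_bounded_def by simp
  from bchoice[OF this] obtain L where L: "\<forall>b\<in>S. \<forall>\<^sub>F e in at_right 0. \<forall>k. \<forall>x\<in>K. norm (a b e k x) \<le> L b * \<bar>ln e\<bar>"
    by blast
  define L' where "L' = (\<Sum>b\<in>S. \<bar>L b\<bar>)"
  have L': "L b \<le> L'" if "b \<in> S" for b
    unfolding L'_def using member_le_sum[OF that, of "\<lambda>b. \<bar>L b\<bar>"] assms(1) by fastforce
  have "\<forall>\<^sub>F e in at_right 0. \<forall>b\<in>S. \<forall>k. \<forall>x\<in>K. norm (a b e k x) \<le> L b * \<bar>ln e\<bar>"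
    using L assms(1) by (simp add: eventually_ball_finite_distrib)
  then have "\<forall>\<^sub>F e in at_right 0. \<forall>b\<in>S. \<forall>k. \<forall>x\<in>K. norm (a b e k x) \<le> L' * \<bar>ln e\<bar>"
  proof (rule eventually_mono, intro ballI allI)
    fix e b k x
    assume *: "\<forall>b\<in>S. \<forall>k. \<forall>x\<in>K. norm (a b e k x) \<le> L b * \<bar>ln e\<bar>" "b \<in> S" "x \<in> K"
    then have "norm (a b e k x) \<le> L b * \<bar>ln e\<bar>" by blast
    also have "\<dots> \<le> L' * \<bar>ln e\<bar>" using L'[OF *(2)] by (rule mult_right_mono) simp
    finally show "norm (a b e k x) \<le> L' * \<bar>ln e\<bar>" .
  qed
  moreover have "L' \<ge> 0" unfolding L'_def by (intro sum_nonneg) simp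
  ultimately show ?thesis using that by blast
qed

lemma norm_combination_le:
  fixes v :: "'a::euclidean_space" and a :: "'a \<Rightarrow> 'b::real_normed_vector"
  assumes "\<And>b. b \<in> Basis \<Longrightarrow> norm (a b) \<le> M"
  shows "norm (\<Sum>b\<in>Basis. (v \<bullet> b) *\<^sub>R a b) \<le> real DIM('a) * M * norm v"
proof -
  have "norm (\<Sum>b\<in>Basis. (v \<bullet> b) *\<^sub>R a b) \<le> (\<Sum>b\<in>(Basis :: 'a set). M * norm v)"
  proof (rule sum_norm_le)
    fix b :: 'a assume b: "b \<in> Basis"
    have "\<bar>v \<bullet> b\<bar> * norm (a b) \<le> norm v * M"
      using assms[OF b] b by (intro mult_mono) (auto simp: Basis_le_norm)
    then show "norm ((v \<bullet> b) *\<^sub>R a b) \<le> M * norm v" by (simp add: mult.commute)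
  qed
  then show ?thesis by simp
qed

text \<open>A discrete Gronwall argument: by induction on k, J is bounded by
  \<open>P * exp (Q * \<bar>t\<bar>)\<close> with P and Q independent of k, where P dominates both
  the initial term c and the inhomogeneity g.\<close>

lemma locally_moderate_linear_recursion:
  fixes J :: "real \<Rightarrow> nat \<Rightarrow> real \<times> 'a::euclidean_space \<Rightarrow> 'b::euclidean_space"
  assumes log: "\<And>b. b \<in> Basis \<Longrightarrow> log_bounded (a b)"
    and g: "locally_moderate g" and c: "locally_moderate c"
    and cont: "\<And>e k. e \<in> {0<..1} \<Longrightarrow>
      continuous_on UNIV (\<lambda>z. (\<Sum>b\<in>Basis. (J e k z \<bullet> b) *\<^sub>R a b e k z) + g e k z)"
    and J_0: "\<And>e. e \<in> {0<..1} \<Longrightarrow> J e 0 = c e 0"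
    and J_Suc: "\<And>e k. e \<in> {0<..1} \<Longrightarrow> J e (Suc k) = (\<lambda>z. c e (Suc k) z +
      time_integral (\<lambda>z. (\<Sum>b\<in>Basis. (J e k z \<bullet> b) *\<^sub>R a b e k z) + g e k z) z)"
  shows "locally_moderate J"
proof (rule locally_moderateI)
  fix K :: "(real \<times> 'a) set" assume "compact K"
  then obtain T r where T: "T > 0" and K: "K \<subseteq> {-T..T} \<times> cball 0 r"
    by (rule compact_subset_time_box)
  have box: "compact ({-T..T} \<times> cball (0::'a) r)" by (intro compact_Times) auto
  obtain L where L: "L \<ge> 0" "\<forall>\<^sub>F e in at_right 0. \<forall>b\<in>Basis. \<forall>k. \<forall>x\<in>{-T..T} \<times> cball 0 r.
      norm (a b e k x) \<le> L * \<bar>ln e\<bar>"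
    using log_bounded_finite[OF finite_Basis log box] .
  obtain N where N: "\<forall>\<^sub>F e in at_right 0. \<forall>k. \<forall>x\<in>{-T..T} \<times> cball 0 r. norm (g e k x) \<le> (1 / e) ^ N"
    using locally_moderateD[OF g box] .
  obtain M where M: "\<forall>\<^sub>F e in at_right 0. \<forall>k. \<forall>x\<in>{-T..T} \<times> cball 0 r. norm (c e k x) \<le> (1 / e) ^ M"
    using locally_moderateD[OF c box] .
  \<comment> \<open>The exponent of 1 / e produced by the weight at time T; the remaining factor
    \<open>exp T\<close> stems from the summand 1 in the rate Q below.\<close>
  define n where "n = nat \<lceil>DIM('b) * L * T\<rceil>"
  have n: "DIM('b) * L * T \<le> real n" unfolding n_def by linarith
  have "\<forall>\<^sub>F e in at_right 0. \<forall>k. \<forall>z\<in>K. norm (J e k z) \<le> exp T * (1 / e) ^ (N + M + n)"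
    using L(2) N M eventually_unit
  proof eventually_elim
    case (elim e)
    from elim(4) have e: "e \<in> {0<..1}" by simp
    define P where "P = (1 / e) ^ (N + M)"
    \<comment> \<open>The first summand is the size of the logarithmic coefficients. The summand 1
      absorbs g, since P is at most P times the weight.\<close>
    define Q where "Q = DIM('b) * (L * \<bar>ln e\<bar>) + 1"
    have Q: "Q \<ge> 0" unfolding Q_def using L(1) by simp
    have le: "(1 / e) ^ N \<le> P" "(1 / e) ^ M \<le> P"
      unfolding P_def using elim(4) by (intro power_increasing; simp)+
    have P: "P \<ge> 0" unfolding P_def using elim(4) by simp
    have gP: "norm (g e k z) \<le> P" if "z \<in> {-T..T} \<times> cball 0 r" for k z
      using elim(2) that le(1) order_trans by blast
    have cP: "norm (c e k z) \<le> P" if "z \<in> {-T..T} \<times> cball 0 r" for k z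
      using elim(3) that le(2) order_trans by blast
    have box: "(t, x) \<in> {-T..T} \<times> cball 0 r" if "\<bar>t\<bar> \<le> T" "norm x \<le> r" for t and x :: 'a
      using that by (simp add: abs_le_iff)
    have bound: "norm (J e k (t, x)) \<le> P * exp (Q * \<bar>t\<bar>)" if "\<bar>t\<bar> \<le> T" "norm x \<le> r" for k t x
      using that
    proof (induction k arbitrary: t)
      case 0
      then have "norm (J e 0 (t, x)) \<le> P * 1"
        using cP[OF box] by (simp add: J_0[OF e])
      also have "\<dots> \<le> P * exp (Q * \<bar>t\<bar>)" using P Q by (intro mult_left_mono) auto
      finally show ?case .
    next
      case (Suc k)
      define G where "G z = (\<Sum>b\<in>Basis. (J e k z \<bullet> b) *\<^sub>R a b e k z) + g e k z" for z
      have "norm (time_integral G (t, x)) \<le> P * exp (Q * \<bar>t\<bar>) - P"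
      proof (rule norm_time_integral_exp_le)
        show "continuous_on UNIV G" unfolding G_def using cont[OF e] .
        fix s assume "\<bar>s\<bar> \<le> \<bar>t\<bar>"
        then have s: "\<bar>s\<bar> \<le> T" using Suc.prems by simp
        have "norm (G (s, x)) \<le> DIM('b) * (L * \<bar>ln e\<bar>) * norm (J e k (s, x)) + P"
          unfolding G_def
        proof (rule norm_triangle_le[OF add_mono])
          show "norm (g e k (s, x)) \<le> P" by (rule gP[OF box[OF s Suc.prems(2)]])
          have "norm (a b e k (s, x)) \<le> L * \<bar>ln e\<bar>" if "b \<in> Basis" for b
            using elim(1) box[OF s Suc.prems(2)] that by blast
          then show "norm (\<Sum>b\<in>Basis. (J e k (s, x) \<bullet> b) *\<^sub>R a b e k (s, x)) \<le>
              DIM('b) * (L * \<bar>ln e\<bar>) * norm (J e k (s, x))"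
            by (rule norm_combination_le)
        qed
        also have "\<dots> \<le> DIM('b) * (L * \<bar>ln e\<bar>) * (P * exp (Q * \<bar>s\<bar>)) + P * exp (Q * \<bar>s\<bar>)"
        proof (intro add_mono mult_left_mono)
          show "P \<le> P * exp (Q * \<bar>s\<bar>)" using mult_left_mono[of 1 "exp (Q * \<bar>s\<bar>)" P] P Q by simp
        qed (use L(1) Suc.IH[OF s Suc.prems(2)] in auto)
        also have "\<dots> = P * Q * exp (Q * \<bar>s\<bar>)" unfolding Q_def by (simp add: algebra_simps)
        finally show "norm (G (s, x)) \<le> P * Q * exp (Q * \<bar>s\<bar>)" .
      qed
      moreover have "norm (c e (Suc k) (t, x)) \<le> P"
        using Suc.prems by (intro cP box)
      moreover have "J e (Suc k) (t, x) = c e (Suc k) (t, x) + time_integral G (t, x)"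
        unfolding G_def by (simp add: J_Suc[OF e])
      ultimately show ?case by (simp add: norm_triangle_le)
    qed
    have "norm (J e k (t, x)) \<le> exp T * (1 / e) ^ (N + M + n)" if "(t, x) \<in> K" for k t x
    proof -
      have tx: "\<bar>t\<bar> \<le> T" "norm x \<le> r" using that K by (auto simp: abs_le_iff)
      then have "norm (J e k (t, x)) \<le> P * exp (Q * \<bar>t\<bar>)" by (rule bound)
      also have "\<dots> \<le> P * exp (Q * T)" using P Q tx by (intro mult_left_mono) (auto intro: mult_left_mono)
      also have "exp (Q * T) = exp T * exp (DIM('b) * L * T * \<bar>ln e\<bar>)"
        unfolding Q_def by (simp add: algebra_simps exp_add)
      also have "P * \<dots> \<le> P * (exp T * (1 / e) ^ n)"
        using P n elim(4) by (intro mult_left_mono exp_mult_abs_ln_le) auto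
      finally show ?thesis unfolding P_def by (simp add: power_add mult_ac)
    qed
    then show ?case by auto
  qed
  then show "\<exists>N c. \<forall>\<^sub>F e in at_right 0. \<forall>k. \<forall>x\<in>K. norm (J e k x) \<le> c * (1 / e) ^ N"
    by blast
qed

text \<open>Smoothness of each single stage, obtained by building it up from finitely many
  integrals. The exponents may depend on k here; the result justifies differentiating the recursion,
  after which the uniform bounds can be proved. The index l is a dummy that keeps the families typed
  alike.\<close>

lemma moderate_upto_linear_recursion_fixed:
  fixes J :: "real \<Rightarrow> nat \<Rightarrow> real \<times> 'a::euclidean_space \<Rightarrow> 'b::euclidean_space"
  assumes a: "\<And>b. b \<in> Basis \<Longrightarrow> moderate_upto m (a b)"
    and g: "moderate_upto m g" and c: "moderate_upto m c"
    and J_0: "\<And>e. e \<in> {0<..1} \<Longrightarrow> J e 0 = c e 0"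
    and J_Suc: "\<And>e k. e \<in> {0<..1} \<Longrightarrow> J e (Suc k) = (\<lambda>z. c e (Suc k) z +
      time_integral (\<lambda>z. (\<Sum>b\<in>Basis. (J e k z \<bullet> b) *\<^sub>R a b e k z) + g e k z) z)"
  shows "moderate_upto m (\<lambda>e (l::nat). J e k)"
proof (induction k)
  case 0
  show ?case
    by (rule moderate_upto_cong[OF moderate_upto_reindex[OF c, of "\<lambda>e l. 0"]]) (simp add: J_0)
next
  case (Suc k)
  have "moderate_upto m (\<lambda>e (l::nat) z. c e (Suc k) z +
      time_integral (\<lambda>z. (\<Sum>b\<in>Basis. (J e k z \<bullet> b) *\<^sub>R a b e k z) + g e k z) z)"
    using moderate_upto_reindex[OF c, of "\<lambda>e l. Suc k"] moderate_upto_reindex[OF g, of "\<lambda>e l. k"]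
      moderate_upto_reindex[OF a, of _ "\<lambda>e l. k"] Suc
    by (intro moderate_upto_add moderate_upto_time_integral moderate_upto_sum
        moderate_upto_bilinear[OF bounded_bilinear_scaleR]
        moderate_upto_linear_comp[OF bounded_linear_inner_left])
  then show ?case by (rule moderate_upto_cong) (simp add: J_Suc)
qed

text \<open>
  The \<open>x\<close>-derivatives satisfy a recursion of the same form with the same coefficients \<open>a b\<close>,
  and the \<open>t\<close>-derivative is given explicitly by the integrand.
\<close>

lemma moderate_upto_linear_recursion:
  fixes J :: "real \<Rightarrow> nat \<Rightarrow> real \<times> 'a::euclidean_space \<Rightarrow> 'b::euclidean_space"
  assumes log: "\<And>b. b \<in> Basis \<Longrightarrow> log_bounded (a b)"
  shows "(\<And>b. b \<in> Basis \<Longrightarrow> moderate_upto m (a b)) \<Longrightarrow> moderate_upto m g \<Longrightarrow> moderate_upto m c \<Longrightarrow>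
    (\<And>e. e \<in> {0<..1} \<Longrightarrow> J e 0 = c e 0) \<Longrightarrow>
    (\<And>e k. e \<in> {0<..1} \<Longrightarrow> J e (Suc k) = (\<lambda>z. c e (Suc k) z +
      time_integral (\<lambda>z. (\<Sum>b\<in>Basis. (J e k z \<bullet> b) *\<^sub>R a b e k z) + g e k z) z)) \<Longrightarrow>
    moderate_upto m J"
proof (induction m arbitrary: g c J)
  case (0 g c J)
  have Jk: "moderate_upto 0 (\<lambda>e (l::nat). J e k)" for k
    using 0 by (rule moderate_upto_linear_recursion_fixed)
  have "locally_moderate J"
  proof (rule locally_moderate_linear_recursion[OF log])
    fix e :: real and k assume e: "e \<in> {0<..1}"
    show "continuous_on UNIV (\<lambda>z. (\<Sum>b\<in>Basis. (J e k z \<bullet> b) *\<^sub>R a b e k z) + g e k z)"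
      by (intro continuous_intros moderate_upto_continuous_on[OF 0(1) e]
          moderate_upto_continuous_on[OF 0(2) e] moderate_upto_continuous_on[OF Jk e])
  qed (use 0 in simp_all)
  then show ?case using Jk by simp
next
  case (Suc m g c J)
  note a = Suc.prems(1) and g = Suc.prems(2) and c = Suc.prems(3)
    and J_0 = Suc.prems(4) and J_Suc = Suc.prems(5)
  have Jk: "moderate_upto (Suc m) (\<lambda>e (l::nat). J e k)" for k
    using Suc.prems by (rule moderate_upto_linear_recursion_fixed)
  \<comment> \<open>Uniform control of J itself up to order m comes before its derivatives, since J
    enters the inhomogeneity of the differentiated recursion.\<close>
  have J: "moderate_upto m J"
    by (rule Suc.IH[of g c]) (use Suc.prems moderate_upto_Suc_imp in blast)+
  define D where "D e k z = frechet_derivative (J e k) (at z)" for e k z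
  define G where "G e k z = (\<Sum>b\<in>Basis. (J e k z \<bullet> b) *\<^sub>R a b e k z) + g e k z" for e k z
  \<comment> \<open>The terms of the Leibniz rule in which the derivative falls on the coefficients
    or on g. They form the new inhomogeneity and only have to be moderate, so no logarithmic bound
    on derivatives of \<open>a b\<close> is ever required.\<close>
  define h where "h e k z w = (\<Sum>b\<in>Basis. (J e k z \<bullet> b) *\<^sub>R frechet_derivative (a b e k) (at z) w) +
    frechet_derivative (g e k) (at z) w" for e k z w
  define G' where "G' e k z w = (\<Sum>b\<in>Basis. (D e k z w \<bullet> b) *\<^sub>R a b e k z) + h e k z w" for e k z w
  have DJ: "(J e k has_derivative D e k z) (at z)" if "e \<in> {0<..1}" for e k z
    unfolding D_def using moderate_upto_has_derivative[OF Jk that] .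
  have DG: "(G e k has_derivative G' e k z) (at z)" if "e \<in> {0<..1}" for e k z
  proof -
    have "(G e k has_derivative (\<lambda>w. (\<Sum>b\<in>Basis. (J e k z \<bullet> b) *\<^sub>R frechet_derivative (a b e k) (at z) w +
        (D e k z w \<bullet> b) *\<^sub>R a b e k z) + frechet_derivative (g e k) (at z) w)) (at z)"
      unfolding G_def[abs_def]
      by (intro has_derivative_add has_derivative_sum has_derivative_scaleR has_derivative_inner_left
          DJ[OF that] moderate_upto_has_derivative[OF a that] moderate_upto_has_derivative[OF g that])
    then show ?thesis unfolding G'_def[abs_def] h_def by (simp add: sum.distrib add_ac)
  qed
  have contG': "continuous_on UNIV (\<lambda>z. G' e k z b)" if e: "e \<in> {0<..1}" and b: "b \<in> Basis" for e k b
    unfolding G'_def h_def D_def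
    by (intro continuous_intros moderate_upto_continuous_on[OF moderate_upto_derivative[OF Jk b] e]
        moderate_upto_continuous_on[OF moderate_upto_derivative[OF a b] e]
        moderate_upto_continuous_on[OF moderate_upto_derivative[OF g b] e]
        moderate_upto_continuous_on[OF a e] moderate_upto_continuous_on[OF Jk e])
  have D_0: "D e 0 z = frechet_derivative (c e 0) (at z)" if "e \<in> {0<..1}" for e z
    unfolding D_def using J_0[OF that] by simp
  have D_Suc: "D e (Suc k) z w = frechet_derivative (c e (Suc k)) (at z) w +
      (fst w *\<^sub>R G e k z + time_integral (\<lambda>z. G' e k z (0, snd w)) z)" if "e \<in> {0<..1}" for e k z w
  proof -
    have "(J e (Suc k) has_derivative (\<lambda>w. frechet_derivative (c e (Suc k)) (at z) w +
      (fst w *\<^sub>R G e k z + time_integral (\<lambda>z. G' e k z (0, snd w)) z))) (at z)"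
      unfolding J_Suc[OF that] G_def[symmetric]
      using has_derivative_add[OF moderate_upto_has_derivative[OF c that]
          time_integral_has_derivative[OF DG[OF that] contG'[OF that]]] .
    from fun_cong[OF frechet_derivative_at[OF this], of w] show ?thesis unfolding D_def by simp
  qed
  have h: "moderate_upto m (\<lambda>e k z. h e k z b)" if "b \<in> Basis" for b
    unfolding h_def
    by (intro moderate_upto_add moderate_upto_sum moderate_upto_bilinear[OF bounded_bilinear_scaleR]
        moderate_upto_linear_comp[OF bounded_linear_inner_left] J
        moderate_upto_derivative[OF a that] moderate_upto_derivative[OF g that])
  have G: "moderate_upto m G"
    unfolding G_def[abs_def]
    by (intro moderate_upto_add moderate_upto_sum moderate_upto_bilinear[OF bounded_bilinear_scaleR]
        moderate_upto_linear_comp[OF bounded_linear_inner_left] J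
        moderate_upto_Suc_imp[OF a] moderate_upto_Suc_imp[OF g])
  have "moderate_upto m (\<lambda>e k z. D e k z b)" if b: "b \<in> Basis" for b
    using b
  proof (cases rule: Basis_time_cases)
    case 1
    note dc = moderate_upto_derivative[OF c b]
    show ?thesis
    proof (rule moderate_upto_nat_cases)
      show "moderate_upto m (\<lambda>e (k::nat) z. D e 0 z b)"
        by (rule moderate_upto_cong[OF moderate_upto_reindex[OF dc, of "\<lambda>e k. 0"]]) (simp add: D_0)
      have "moderate_upto m (\<lambda>e k z. frechet_derivative (c e (Suc k)) (at z) b + G e k z)"
        using moderate_upto_reindex[OF dc, of "\<lambda>e k. Suc k"] G by (rule moderate_upto_add)
      moreover have "time_integral (\<lambda>z. G' e k z (0, 0)) z = 0" if "e \<in> {0<..1}" for e k z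
        using linear_0[OF has_derivative_linear[OF DG[OF that]]]
        by (simp add: zero_prod_def time_integral_def)
      ultimately show "moderate_upto m (\<lambda>e k z. D e (Suc k) z b)"
        by (elim moderate_upto_cong) (simp add: D_Suc 1)
    qed
  next
    case (2 \<xi>)
    \<comment> \<open>A spatial derivative of J satisfies the same kind of recursion, with the same
      coefficients, the inhomogeneity h in direction b and the corresponding derivative of c as
      initial term. The induction hypothesis applies at order m.\<close>
    show ?thesis
    proof (rule Suc.IH)
      show "moderate_upto m (\<lambda>e k z. h e k z b)" using b by (rule h)
      show "moderate_upto m (\<lambda>e k z. frechet_derivative (c e k) (at z) b)"
        using c b by (rule moderate_upto_derivative)
    qed (use 2 in \<open>simp_all add: moderate_upto_Suc_imp[OF a] D_0 D_Suc G'_def\<close>)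
  qed
  moreover have "J e k differentiable at z" if "e \<in> {0<..1}" for e k z
    using DJ[OF that] by (rule differentiableI)
  ultimately show ?case
    using moderate_upto_imp_locally_moderate[OF J] unfolding D_def by simp
qed

section \<open>Picard iteration\<close>

text \<open>Only the zeroth-order estimate is recorded and moderateness is kept apart, so the
  predicate can be established for residuals as a bare estimate. Constants are absorbed by one more
  power of e.\<close>

definition negligible_net :: "(real \<Rightarrow> 'a::euclidean_space \<Rightarrow> 'b::euclidean_space) \<Rightarrow> bool" where
  "negligible_net u \<longleftrightarrow> (\<forall>K q. compact K \<longrightarrow>
     (\<forall>\<^sub>F e in at_right 0. \<forall>x\<in>K. norm (u e x) \<le> e ^ q))"

section \<open>Gronwall's inequality and logarithmic Lipschitz constants\<close>

lemma gronwall_forward: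
  fixes w :: "real \<Rightarrow> 'a::euclidean_space"
  assumes A: "A \<ge> 0" and t: "0 \<le> t"
    and deriv: "\<And>s. 0 \<le> s \<Longrightarrow> s \<le> t \<Longrightarrow> (w has_vector_derivative w' s) (at s)"
    and le: "\<And>s. 0 \<le> s \<Longrightarrow> s \<le> t \<Longrightarrow> norm (w' s) \<le> A * norm (w s) + \<eta>"
  shows "norm (w t) ^ 2 \<le> (norm (w 0) ^ 2 + \<eta> ^ 2) * exp ((2 * A + 1) * t)"
proof -
  \<comment> \<open>The squared norm is used because the norm is not differentiable at 0. Adding
    \<open>\<eta> ^ 2\<close> makes the differential inequality homogeneous, and h is nonincreasing
    because the exponential factor compensates its growth rate.\<close>
  define h where "h s = (w s \<bullet> w s + \<eta> ^ 2) * exp (- (2 * A + 1) * s)" for s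
  define h' where "h' s = (2 * (w s \<bullet> w' s) - (2 * A + 1) * (w s \<bullet> w s + \<eta> ^ 2)) * exp (- (2 * A + 1) * s)" for s
  have "h t \<le> h 0"
  proof (rule DERIV_nonpos_imp_nonincreasing[OF t])
    fix s assume s: "0 \<le> s" "s \<le> t"
    have "((\<lambda>s. w s \<bullet> w s) has_vector_derivative w s \<bullet> w' s + w' s \<bullet> w s) (at s)"
      using bounded_bilinear.has_vector_derivative[OF bounded_bilinear_inner deriv[OF s] deriv[OF s]] .
    then have 1: "((\<lambda>s. w s \<bullet> w s) has_real_derivative w s \<bullet> w' s + w' s \<bullet> w s) (at s)"
      by (simp add: has_real_derivative_iff_has_vector_derivative)
    have "(h has_real_derivative h' s) (at s)"
      unfolding h_def[abs_def] h'_def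
      by (rule derivative_eq_intros 1 refl)+ (simp add: algebra_simps inner_commute)
    moreover have "h' s \<le> 0"
    proof -
      have "w s \<bullet> w' s \<le> norm (w s) * norm (w' s)" by (rule norm_cauchy_schwarz)
      also have "\<dots> \<le> norm (w s) * (A * norm (w s) + \<eta>)"
        using le[OF s] by (intro mult_left_mono) auto
      \<comment> \<open>Expanding the square of \<open>norm (w s) - \<eta>\<close> bounds the mixed
        term by the two squares; this is the origin of the 1 in \<open>2 * A + 1\<close>.\<close>
      also have "2 * \<dots> \<le> (2 * A + 1) * norm (w s) ^ 2 + \<eta> ^ 2"
        using sum_squares_ge_zero[of "norm (w s) - \<eta>" 0] by (simp add: power2_eq_square algebra_simps)
      also have "\<dots> \<le> (2 * A + 1) * (w s \<bullet> w s + \<eta> ^ 2)"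
        using A by (simp add: power2_norm_eq_inner algebra_simps)
      finally show ?thesis unfolding h'_def by (intro mult_nonpos_nonneg) auto
    qed
    ultimately show "\<exists>y. (h has_real_derivative y) (at s) \<and> y \<le> 0" by blast
  qed
  then have "(w t \<bullet> w t + \<eta> ^ 2) * exp (- (2 * A + 1) * t) \<le> norm (w 0) ^ 2 + \<eta> ^ 2"
    by (simp add: h_def power2_norm_eq_inner)
  then have "(w t \<bullet> w t + \<eta> ^ 2) * exp (- (2 * A + 1) * t) * exp ((2 * A + 1) * t) \<le>
      (norm (w 0) ^ 2 + \<eta> ^ 2) * exp ((2 * A + 1) * t)"
    by (intro mult_right_mono) auto
  also have "(w t \<bullet> w t + \<eta> ^ 2) * exp (- (2 * A + 1) * t) * exp ((2 * A + 1) * t) = w t \<bullet> w t + \<eta> ^ 2"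
  proof -
    have "exp (- (2 * A + 1) * t) * exp ((2 * A + 1) * t) = 1"
      by (subst exp_add[symmetric]) (simp add: algebra_simps)
    then show ?thesis by (simp only: mult.assoc mult_1_right)
  qed
  finally have "w t \<bullet> w t + \<eta> ^ 2 \<le> (norm (w 0) ^ 2 + \<eta> ^ 2) * exp ((2 * A + 1) * t)" .
  then show ?thesis using zero_le_power2[of \<eta>] unfolding power2_norm_eq_inner[of "w t"] by linarith
qed

lemma gronwall:
  fixes w :: "real \<Rightarrow> 'a::euclidean_space"
  assumes A: "A \<ge> 0" and deriv: "\<And>s. (w has_vector_derivative w' s) (at s)"
    and le: "\<And>s. \<bar>s\<bar> \<le> \<bar>t\<bar> \<Longrightarrow> norm (w' s) \<le> A * norm (w s) + \<eta>"
  shows "norm (w t) ^ 2 \<le> (norm (w 0) ^ 2 + \<eta> ^ 2) * exp ((2 * A + 1) * \<bar>t\<bar>)"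
proof (cases "t \<ge> 0")
  case True
  then show ?thesis using gronwall_forward[OF A True deriv, of \<eta>] le by simp
next
  case False
  have "norm (w (- (- t))) ^ 2 \<le> (norm (w (- 0)) ^ 2 + \<eta> ^ 2) * exp ((2 * A + 1) * (- t))"
  proof (rule gronwall_forward[OF A, of "- t" "\<lambda>s. w (- s)" "\<lambda>s. - w' (- s)"])
    fix s
    have "(uminus has_vector_derivative (- 1 :: real)) (at s)"
      by (auto intro!: derivative_eq_intros)
    from vector_diff_chain_at[OF this deriv[of "- s"]]
    show "((\<lambda>s. w (- s)) has_vector_derivative - w' (- s)) (at s)" by (simp add: o_def)
    show "norm (- w' (- s)) \<le> A * norm (w (- s)) + \<eta>" if "0 \<le> s" "s \<le> - t"
      using le[of "- s"] that by simp
  qed (use False in auto)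
  then show ?thesis using False by simp
qed

text \<open>The mean value inequality on the convex ball; the factor \<open>DIM('a)\<close> is the
  cost of estimating the operator norm by the values on basis vectors.\<close>

lemma lipschitz_on_cball_if_partials_le:
  fixes f :: "'a::euclidean_space \<Rightarrow> 'b::euclidean_space"
  assumes diff: "\<And>x. f differentiable at x"
    and le: "\<And>x b. x \<in> cball 0 R \<Longrightarrow> b \<in> Basis \<Longrightarrow> norm (frechet_derivative f (at x) b) \<le> M"
    and M: "M \<ge> 0" and xy: "x \<in> cball 0 R" "y \<in> cball 0 R"
  shows "norm (f x - f y) \<le> real DIM('a) * M * norm (x - y)"
proof -
  have D: "(f has_derivative frechet_derivative f (at x)) (at x)" for x
    using diff by (simp add: frechet_derivative_works[symmetric])
  have "onorm (frechet_derivative f (at x)) \<le> real DIM('a) * M" if "x \<in> cball 0 R" for x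
  proof (rule onorm_bound)
    fix v
    have "norm (\<Sum>b\<in>Basis. (v \<bullet> b) *\<^sub>R frechet_derivative f (at x) b) \<le> real DIM('a) * M * norm v"
      using le[OF that] by (rule norm_combination_le)
    then show "norm (frechet_derivative f (at x) v) \<le> real DIM('a) * M * norm v"
      by (simp add: has_derivative_expand[OF D, symmetric])
  qed (use M in simp)
  then show ?thesis
    using differentiable_bound[OF convex_cball has_derivative_at_withinI[OF D] _ xy] by blast
qed

lemma log_lipschitz:
  fixes f :: "real \<Rightarrow> 'a::euclidean_space \<Rightarrow> 'b::euclidean_space"
  assumes diff: "\<And>e x. e \<in> {0<..1} \<Longrightarrow> f e differentiable at x"
    and log: "\<And>b. b \<in> Basis \<Longrightarrow> log_bounded (\<lambda>e (_::unit) x. frechet_derivative (f e) (at x) b)"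
  obtains L where "L \<ge> 0" "\<forall>\<^sub>F e in at_right 0. \<forall>x\<in>cball 0 R. \<forall>y\<in>cball 0 R.
    norm (f e x - f e y) \<le> L * \<bar>ln e\<bar> * norm (x - y)"
proof -
  obtain L where L: "L \<ge> 0" "\<forall>\<^sub>F e in at_right 0. \<forall>b\<in>Basis. \<forall>k::unit. \<forall>x\<in>cball 0 R.
      norm (frechet_derivative (f e) (at x) b) \<le> L * \<bar>ln e\<bar>"
    using log_bounded_finite[OF finite_Basis log compact_cball] .
  let ?L = "real DIM('a) * L"
  from L(2) eventually_unit have "\<forall>\<^sub>F e in at_right 0. \<forall>x\<in>cball 0 R. \<forall>y\<in>cball 0 R.
    norm (f e x - f e y) \<le> ?L * \<bar>ln e\<bar> * norm (x - y)"
  proof eventually_elim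
    case (elim e)
    have "norm (f e x - f e y) \<le> real DIM('a) * (L * \<bar>ln e\<bar>) * norm (x - y)"
      if "x \<in> cball 0 R" "y \<in> cball 0 R" for x y
    proof (rule lipschitz_on_cball_if_partials_le[OF _ _ _ that])
      show "f e differentiable at x" for x using diff elim(2) by simp
      show "norm (frechet_derivative (f e) (at x) b) \<le> L * \<bar>ln e\<bar>"
        if "x \<in> cball 0 R" "b \<in> Basis" for x b
        using elim(1) that by blast
    qed (use L(1) in simp)
    then show ?case by (simp add: mult.assoc)
  qed
  then show ?thesis using that[of ?L] L(1) by simp
qed

text \<open>In terms of x = 1 / e this says that \<open>x ^ M / exp x\<close> tends to 0. It is the
  gain bought by taking about 1 / e iterations.\<close>

lemma exp_minus_inverse_le_power:
  "\<forall>\<^sub>F e in at_right 0. exp (- (1 / e)) \<le> (e::real) ^ M"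
proof -
  have "((\<lambda>e::real. inverse e ^ M / exp (inverse e)) \<longlongrightarrow> 0) (at_right 0)"
    using filterlim_compose[OF tendsto_power_div_exp_0 filterlim_inverse_at_top_right] .
  then have "\<forall>\<^sub>F e::real in at_right 0. inverse e ^ M / exp (inverse e) < 1"
    by (rule order_tendstoD) simp
  then show ?thesis using eventually_unit
  proof eventually_elim
    case (elim e)
    then have "inverse e ^ M < exp (inverse e)" by simp
    then have "inverse (exp (inverse e)) \<le> inverse (inverse e ^ M)"
      using elim by (intro le_imp_inverse_le) auto
    then show ?case by (simp add: exp_minus inverse_eq_divide power_divide)
  qed
qed

text \<open>The growth bound is required for every e in (0, 1], not only for small e, so that all
  bounds on iterates hold for each such e individually; the logarithmic bound is asymptotic. A
  suitable representative of a given class is produced in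
  \<open>picard_of_linear_growth\<close>.\<close>

locale picard =
  fixes f :: "real \<Rightarrow> 'a::euclidean_space \<Rightarrow> 'a" and C :: real
  assumes f: "\<And>m. moderate_upto m (\<lambda>e (_::unit). f e)"
    and C_pos: "C > 0"
    and growth: "\<And>e x. e \<in> {0<..1} \<Longrightarrow> norm (f e x) \<le> C * (1 + norm x)"
    and log: "\<And>b. b \<in> Basis \<Longrightarrow>
      log_bounded (\<lambda>e (_::unit) x. frechet_derivative (f e) (at x) b)"
begin

section \<open>Picard iterates: growth, derivatives and uniform moderateness\<close>

primrec iterate :: "real \<Rightarrow> nat \<Rightarrow> real \<times> 'a \<Rightarrow> 'a" where
  "iterate e 0 = snd"
| "iterate e (Suc k) = (\<lambda>z. snd z + time_integral (\<lambda>z. f e (iterate e k z)) z)"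

lemma f_continuous: "e \<in> {0<..1} \<Longrightarrow> continuous_on UNIV (f e)"
  using moderate_upto_continuous_on[OF f] by blast

lemma f_differentiable: "e \<in> {0<..1} \<Longrightarrow> f e differentiable at x"
  using f[of "Suc 0"] by simp

lemma f_has_derivative:
  "e \<in> {0<..1} \<Longrightarrow> (f e has_derivative frechet_derivative (f e) (at x)) (at x)"
  using f_differentiable frechet_derivative_works by blast

lemma iterate_continuous: "e \<in> {0<..1} \<Longrightarrow> continuous_on UNIV (iterate e k)"
proof (induction k)
  case (Suc k)
  then show ?case
    by (auto intro!: continuous_intros time_integral_continuous_on
        continuous_on_compose2[OF f_continuous])
qed (auto intro!: continuous_intros)

lemma f_iterate_continuous: "e \<in> {0<..1} \<Longrightarrow> continuous_on UNIV (\<lambda>z. f e (iterate e k z))"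
  by (rule continuous_on_compose2[OF f_continuous iterate_continuous]) auto

text \<open>In terms of \<open>1 + norm\<close> the growth condition is homogeneous, so the weight
  \<open>exp (C * \<bar>t\<bar>)\<close> reproduces itself under the Picard step, independently of k
  and e.\<close>

lemma iterate_growth:
  assumes e: "e \<in> {0<..1}"
  shows "1 + norm (iterate e k (t, x)) \<le> (1 + norm x) * exp (C * \<bar>t\<bar>)"
proof (induction k arbitrary: t)
  case 0
  have "(1 + norm x) * 1 \<le> (1 + norm x) * exp (C * \<bar>t\<bar>)"
    using C_pos by (intro mult_left_mono) auto
  then show ?case by simp
next
  case (Suc k)
  have "norm (time_integral (\<lambda>z. f e (iterate e k z)) (t, x)) \<le>
      (1 + norm x) * exp (C * \<bar>t\<bar>) - (1 + norm x)"
  proof (rule norm_time_integral_exp_le[OF f_iterate_continuous[OF e]])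
    fix s
    have "norm (f e (iterate e k (s, x))) \<le> C * (1 + norm (iterate e k (s, x)))"
      using growth[OF e] .
    also have "\<dots> \<le> C * ((1 + norm x) * exp (C * \<bar>s\<bar>))"
      using Suc.IH C_pos by (intro mult_left_mono) auto
    finally show "norm (f e (iterate e k (s, x))) \<le> (1 + norm x) * C * exp (C * \<bar>s\<bar>)"
      by (simp add: mult_ac)
  qed
  then show ?case
    using norm_triangle_ineq[of x "time_integral (\<lambda>z. f e (iterate e k z)) (t, x)"] by simp
qed

lemma iterate_bound:
  assumes "e \<in> {0<..1}" "\<bar>t\<bar> \<le> T" "norm x \<le> r"
  shows "norm (iterate e k (t, x)) \<le> (1 + r) * exp (C * T)"
proof -
  have "1 + norm (iterate e k (t, x)) \<le> (1 + norm x) * exp (C * \<bar>t\<bar>)"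
    using assms(1) by (rule iterate_growth)
  also have "\<dots> \<le> (1 + r) * exp (C * T)"
    using assms(2,3) C_pos order_trans[OF norm_ge_zero assms(3)] by (intro mult_mono) auto
  finally show ?thesis by simp
qed

lemma iterate_locally_bounded: "locally_bounded iterate"
  unfolding locally_bounded_def
proof (intro allI impI)
  fix K :: "(real \<times> 'a) set" assume "compact K"
  then obtain T r where "T > 0" "r > 0" "K \<subseteq> {-T..T} \<times> cball 0 r" by (rule compact_subset_time_box)
  then have "norm (iterate e k z) \<le> (1 + r) * exp (C * T)" if "e \<in> {0<..1}" "z \<in> K" for e k z
    using that iterate_bound[OF that(1), of "fst z" T "snd z" r] by (auto simp: abs_le_iff)
  then show "\<exists>R. \<forall>\<^sub>F e in at_right 0. \<forall>k. \<forall>x\<in>K. norm (iterate e k x) \<le> R"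
    by (intro exI[of _ "(1 + r) * exp (C * T)"] eventually_mono[OF eventually_unit]) simp
qed

lemma moderate_upto_f_comp:
  assumes "locally_bounded v" "moderate_upto m v"
  shows "moderate_upto m (\<lambda>e k z. f e (v e k z))"
  by (rule moderate_upto_comp[OF assms(1) moderate_upto_reindex[OF f] assms(2)])

lemma iterate_fixed_locally_bounded: "locally_bounded (\<lambda>e (l::nat). iterate e k)"
  using iterate_locally_bounded unfolding locally_bounded_def
  by (fast elim: eventually_mono)

lemma moderate_upto_iterate_fixed: "moderate_upto m (\<lambda>e (l::nat). iterate e k)"
proof (induction k)
  case 0
  then show ?case using moderate_upto_linear[OF bounded_linear_snd] by simp
next
  case (Suc k)
  have "moderate_upto m (\<lambda>e (l::nat) z. snd z + time_integral (\<lambda>z. f e (iterate e k z)) z)"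
    by (intro moderate_upto_add moderate_upto_time_integral moderate_upto_linear bounded_linear_snd
        moderate_upto_f_comp[OF iterate_fixed_locally_bounded Suc])
  then show ?case by simp
qed

lemma f_iterate_has_derivative:
  assumes "e \<in> {0<..1}"
  shows "((\<lambda>z. f e (iterate e k z)) has_derivative (\<lambda>w. frechet_derivative (f e) (at (iterate e k z))
    (frechet_derivative (iterate e k) (at z) w))) (at z)"
  using has_derivative_compose[OF moderate_upto_has_derivative[OF moderate_upto_iterate_fixed assms]
      f_has_derivative[OF assms]] .

lemma f_iterate_derivative_continuous:
  assumes e: "e \<in> {0<..1}" and b: "b \<in> Basis"
  shows "continuous_on UNIV (\<lambda>z. frechet_derivative (f e) (at (iterate e k z))
    (frechet_derivative (iterate e k) (at z) b))"
proof -
  have "moderate_upto (Suc 0) (\<lambda>e (l::nat) z. f e (iterate e k z))"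
    by (intro moderate_upto_f_comp iterate_fixed_locally_bounded moderate_upto_iterate_fixed)
  from moderate_upto_continuous_on[OF moderate_upto_derivative[OF this b] e]
  show ?thesis by (simp add: frechet_derivative_at[OF f_iterate_has_derivative[OF e], symmetric])
qed

lemma iterate_has_derivative:
  assumes e: "e \<in> {0<..1}"
  shows "(iterate e (Suc k) has_derivative (\<lambda>w. snd w + (fst w *\<^sub>R f e (iterate e k z) +
    time_integral (\<lambda>z. frechet_derivative (f e) (at (iterate e k z))
      (frechet_derivative (iterate e k) (at z) (0, snd w))) z))) (at z)"
  using has_derivative_add[OF bounded_linear_imp_has_derivative[OF bounded_linear_snd]
      time_integral_has_derivative[OF f_iterate_has_derivative f_iterate_derivative_continuous]]
    assms by simp

text \<open>In the time direction the integral term of the derivative vanishes by linearity. A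
  Picard step thus solves the equation exactly, except that the right-hand side contains the
  previous iterate.\<close>

lemma iterate_has_vector_derivative:
  assumes "e \<in> {0<..1}"
  shows "((\<lambda>\<tau>. iterate e (Suc k) (\<tau>, x)) has_vector_derivative f e (iterate e k (t, x))) (at t)"
proof -
  have lin: "linear (frechet_derivative (iterate e k) (at z))" "linear (frechet_derivative (f e) (at y))" for z y
    using has_derivative_linear[OF moderate_upto_has_derivative[OF moderate_upto_iterate_fixed assms]]
      has_derivative_linear[OF f_has_derivative[OF assms]] by blast+
  have "((\<lambda>\<tau>. (\<tau>, x)) has_derivative (\<lambda>h. (h, 0))) (at t)"
    by (auto intro!: derivative_eq_intros)
  from has_derivative_compose[OF this iterate_has_derivative[OF assms, of k]]
  show ?thesis using linear_0[OF lin(1)] linear_0[OF lin(2)]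
    by (simp add: has_vector_derivative_def zero_prod_def time_integral_def del: iterate.simps)
qed

text \<open>On a compact set all iterates stay in one ball, so the logarithmic bound for f on that
  ball serves for every k at once.\<close>

lemma log_bounded_f_iterate:
  assumes "b \<in> Basis"
  shows "log_bounded (\<lambda>e k z. frechet_derivative (f e) (at (iterate e k z)) b)"
  unfolding log_bounded_def
proof (intro allI impI)
  fix K :: "(real \<times> 'a) set" assume "compact K"
  then obtain R where R: "\<forall>\<^sub>F e in at_right 0. \<forall>k. \<forall>z\<in>K. norm (iterate e k z) \<le> R"
    using iterate_locally_bounded unfolding locally_bounded_def by blast
  obtain L where L: "\<forall>\<^sub>F e in at_right 0. \<forall>k::unit. \<forall>x\<in>cball 0 R.
      norm (frechet_derivative (f e) (at x) b) \<le> L * \<bar>ln e\<bar>"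
    using log[OF assms] compact_cball unfolding log_bounded_def by blast
  have "\<forall>\<^sub>F e in at_right 0. \<forall>k. \<forall>z\<in>K.
      norm (frechet_derivative (f e) (at (iterate e k z)) b) \<le> L * \<bar>ln e\<bar>"
    using R L by eventually_elim simp
  then show "\<exists>L. \<forall>\<^sub>F e in at_right 0. \<forall>k. \<forall>z\<in>K.
      norm (frechet_derivative (f e) (at (iterate e k z)) b) \<le> L * \<bar>ln e\<bar>" by blast
qed

lemma f_expand: "e \<in> {0<..1} \<Longrightarrow> (\<Sum>b\<in>Basis. (h \<bullet> b) *\<^sub>R frechet_derivative (f e) (at x) b) =
    frechet_derivative (f e) (at x) h"
  using has_derivative_expand[OF f_has_derivative, of e x h] by simp

text \<open>A bootstrap. If the iterates are moderate up to order m, so are the first derivatives of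
  f along them, by the chain rule. These are the coefficients of the variational recursion for
  spatial derivatives of the iterates, which are then moderate up to order m as well.\<close>

lemma moderate_upto_iterate: "moderate_upto m iterate"
proof (induction m)
  case 0
  then show ?case
    using locally_bounded_imp_moderate[OF iterate_locally_bounded] iterate_continuous by simp
next
  case (Suc m)
  have "moderate_upto m (\<lambda>e k z. frechet_derivative (iterate e k) (at z) b)"
    if b: "b \<in> Basis" for b
    using b
  proof (cases rule: Basis_time_cases)
    case 1
    show ?thesis
    proof (rule moderate_upto_nat_cases)
      show "moderate_upto m (\<lambda>e (k::nat) z. frechet_derivative (iterate e 0) (at z) b)"
        using moderate_upto_derivative[OF moderate_upto_iterate_fixed b] .
      have "moderate_upto m (\<lambda>e k z. f e (iterate e k z))"
        by (rule moderate_upto_f_comp[OF iterate_locally_bounded Suc])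
      moreover have "frechet_derivative (iterate e (Suc k)) (at z) b = f e (iterate e k z)"
        if e: "e \<in> {0<..1}" for e k z
      proof -
        obtain t x where z: "z = (t, x)" by (cases z)
        have "((\<lambda>\<tau>. (\<tau>, x)) has_derivative (\<lambda>h. (h, 0))) (at t)"
          by (auto intro!: derivative_eq_intros)
        from has_derivative_compose[OF this moderate_upto_has_derivative[OF moderate_upto_iterate_fixed e]]
        have "((\<lambda>\<tau>. iterate e (Suc k) (\<tau>, x)) has_derivative
            (\<lambda>h. frechet_derivative (iterate e (Suc k)) (at (t, x)) (h, 0))) (at t)" .
        from has_derivative_unique[OF this iterate_has_vector_derivative[OF e, unfolded has_vector_derivative_def]]
        show ?thesis using 1 z by (simp add: fun_eq_iff del: iterate.simps)
      qed
      ultimately show "moderate_upto m (\<lambda>e k z. frechet_derivative (iterate e (Suc k)) (at z) b)"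
        by (elim moderate_upto_cong) simp
    qed
  next
    case (2 \<xi>)
    \<comment> \<open>The variational recursion starts at the constant direction \<xi>, the spatial
      derivative of x, and has inhomogeneity 0.\<close>
    show ?thesis
    proof (rule moderate_upto_linear_recursion[OF log_bounded_f_iterate])
      show "moderate_upto m (\<lambda>e k z. frechet_derivative (f e) (at (iterate e k z)) b)"
        if "b \<in> Basis" for b
        by (rule moderate_upto_comp[OF iterate_locally_bounded
              moderate_upto_reindex[OF moderate_upto_derivative[OF f that]] Suc])
      show "moderate_upto m (\<lambda>e (k::nat) z::real\<times>'a. 0::'a)" by (rule moderate_upto_const)
      show "moderate_upto m (\<lambda>e (k::nat) z::real\<times>'a. \<xi>)" by (rule moderate_upto_const)
      show "(\<lambda>z. frechet_derivative (iterate e 0) (at z) b) = (\<lambda>z. \<xi>)" for e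
        using frechet_derivative_at[OF bounded_linear_imp_has_derivative[OF bounded_linear_snd]] 2
        by (metis iterate.simps(1) snd_conv)
      show "(\<lambda>z. frechet_derivative (iterate e (Suc k)) (at z) b) = (\<lambda>z. \<xi> + time_integral
          (\<lambda>z. (\<Sum>b'\<in>Basis. (frechet_derivative (iterate e k) (at z) b \<bullet> b') *\<^sub>R
            frechet_derivative (f e) (at (iterate e k z)) b') + 0) z)"
        if "e \<in> {0<..1}" for e k
        using 2 by (simp add: frechet_derivative_at[OF iterate_has_derivative[OF that], symmetric]
            f_expand[OF that] del: iterate.simps)
    qed
  qed
  moreover have "iterate e k differentiable at z" if "e \<in> {0<..1}" for e k z
    using moderate_upto_has_derivative[OF moderate_upto_iterate_fixed that] by (rule differentiableI)
  ultimately show ?case using moderate_upto_imp_locally_moderate[OF Suc] by simp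
qed

end

context picard begin

text \<open>The weight \<open>exp (3 * \<Lambda> * \<bar>t\<bar>)\<close> turns the Picard map into a contraction with factor \<open>1 / 3\<close>.\<close>

lemma iterate_diff_le:
  assumes e: "e \<in> {0<..1}" and r: "0 \<le> r"
    and lip: "\<And>x y. x \<in> cball 0 ((1 + r) * exp (C * T)) \<Longrightarrow> y \<in> cball 0 ((1 + r) * exp (C * T)) \<Longrightarrow>
      norm (f e x - f e y) \<le> \<Lambda> * norm (x - y)"
    and \<Lambda>: "\<Lambda> \<ge> 0" and t: "\<bar>t\<bar> \<le> T" and x: "norm x \<le> r"
  shows "norm (iterate e (Suc k) (t, x) - iterate e k (t, x)) \<le>
    2 * ((1 + r) * exp (C * T)) * (1 / 3) ^ k * exp (3 * \<Lambda> * \<bar>t\<bar>)"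
  using t
proof (induction k arbitrary: t)
  case 0
  let ?R = "(1 + r) * exp (C * T)"
  \<comment> \<open>Both iterates lie in the ball of radius R, so the triangle inequality provides
    the constant 2 R.\<close>
  have "norm (iterate e (Suc 0) (t, x) - iterate e 0 (t, x)) \<le> 2 * ?R * 1"
    using iterate_bound[OF e 0 x, of "Suc 0"] iterate_bound[OF e 0 x, of 0]
      norm_triangle_ineq4[of "iterate e (Suc 0) (t, x)" "iterate e 0 (t, x)"] by linarith
  also have "\<dots> \<le> 2 * ?R * exp (3 * \<Lambda> * \<bar>t\<bar>)"
    using r \<Lambda> by (intro mult_left_mono) auto
  finally show ?case by simp
next
  case (Suc k)
  define P where "P = 2 * ((1 + r) * exp (C * T)) * (1 / 3) ^ Suc k"
  have P: "P \<ge> 0" unfolding P_def using r by simp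
  have "norm (time_integral (\<lambda>z. f e (iterate e (Suc k) z) - f e (iterate e k z)) (t, x)) \<le>
      P * exp (3 * \<Lambda> * \<bar>t\<bar>) - P"
  proof (rule norm_time_integral_exp_le)
    show "continuous_on UNIV (\<lambda>z. f e (iterate e (Suc k) z) - f e (iterate e k z))"
      by (intro continuous_on_diff f_iterate_continuous e)
    fix s assume "\<bar>s\<bar> \<le> \<bar>t\<bar>"
    with Suc.prems have s: "\<bar>s\<bar> \<le> T" by simp
    have "norm (f e (iterate e (Suc k) (s, x)) - f e (iterate e k (s, x))) \<le>
        \<Lambda> * norm (iterate e (Suc k) (s, x) - iterate e k (s, x))"
      using iterate_bound[OF e s x] by (intro lip) (simp_all del: iterate.simps)
    also have "\<dots> \<le> \<Lambda> * (2 * ((1 + r) * exp (C * T)) * (1 / 3) ^ k * exp (3 * \<Lambda> * \<bar>s\<bar>))"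
      using Suc.IH[OF s] \<Lambda> by (rule mult_left_mono)
    \<comment> \<open>Passing from power k to power k + 1 of 1 / 3 inside P releases a factor 3, and
      3 \<Lambda> is exactly the rate of the weight.\<close>
    also have "\<dots> = P * (3 * \<Lambda>) * exp (3 * \<Lambda> * \<bar>s\<bar>)" unfolding P_def by simp
    finally show "norm (f e (iterate e (Suc k) (s, x)) - f e (iterate e k (s, x))) \<le>
        P * (3 * \<Lambda>) * exp (3 * \<Lambda> * \<bar>s\<bar>)" .
  qed
  moreover have "iterate e (Suc (Suc k)) (t, x) - iterate e (Suc k) (t, x) =
      time_integral (\<lambda>z. f e (iterate e (Suc k) z) - f e (iterate e k z)) (t, x)"
    using time_integral_diff[OF f_iterate_continuous[OF e] f_iterate_continuous[OF e], of "Suc k" k]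
    by (simp add: iterate.simps(2)[of _ k])
  ultimately show ?case unfolding P_def[symmetric] using P by simp
qed

section \<open>The approximate flow, its residual and the comparison of approximate
  solutions\<close>

definition steps :: "real \<Rightarrow> nat" where "steps e = nat \<lceil>1 / e\<rceil>"

text \<open>One step beyond \<open>steps e\<close>: the time derivative is then f at iterate number
  \<open>steps e\<close>, and the residual of the equation is the difference of f at two successive
  iterates.\<close>

definition flow :: "real \<Rightarrow> real \<times> 'a \<Rightarrow> 'a" where "flow e = iterate e (Suc (steps e))"

text \<open>Since e (the base of exp) is at most 3, the contraction factor 1 / 3 is at most
  \<open>exp (- 1)\<close>, and rounding up gives at least 1 / e factors.\<close>

lemma third_power_steps_le:
  assumes "0 < e"
  shows "(1 / 3) ^ steps e \<le> exp (- (1 / e))"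
proof -
  have "(1 / 3 :: real) \<le> exp (- 1)" using exp_le by (simp add: exp_minus field_simps)
  then have "(1 / 3 :: real) ^ steps e \<le> exp (- 1) ^ steps e" by (intro power_mono) auto
  also have "\<dots> = exp (- real (steps e))" by (simp add: exp_of_nat_mult[symmetric])
  also have "\<dots> \<le> exp (- (1 / e))" unfolding steps_def using assms by simp
  finally show ?thesis .
qed

lemma flow_residual_negligible:
  "negligible_net (\<lambda>e z. f e (iterate e (steps e) z) - f e (flow e z))"
  unfolding negligible_net_def
proof (intro allI impI)
  fix K :: "(real \<times> 'a) set" and q :: nat assume "compact K"
  then obtain T r where T: "T > 0" "r > 0" and K: "K \<subseteq> {-T..T} \<times> cball 0 r"
    by (rule compact_subset_time_box)
  define R where "R = (1 + r) * exp (C * T)"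
  obtain L where L: "L \<ge> 0" "\<forall>\<^sub>F e in at_right 0. \<forall>x\<in>cball 0 R. \<forall>y\<in>cball 0 R.
      norm (f e x - f e y) \<le> L * \<bar>ln e\<bar> * norm (x - y)"
    by (rule log_lipschitz[OF f_differentiable log])
  \<comment> \<open>The Lipschitz factor satisfies \<Lambda> \<le> exp \<Lambda>, so together with
    the weight it is at most \<open>exp ((3 * T + 1) * L * \<bar>ln e\<bar>)\<close>, hence at most
    \<open>(1 / e) ^ n\<close>. The decay is then invoked at power n + 1 + q: n cancels this factor,
    1 absorbs the constant 2 R, and q is left.\<close>
  define n where "n = nat \<lceil>(3 * T + 1) * L\<rceil>"
  have n: "(3 * T + 1) * L \<le> real n" unfolding n_def by linarith
  show "\<forall>\<^sub>F e in at_right 0. \<forall>z\<in>K. norm (f e (iterate e (steps e) z) - f e (flow e z)) \<le> e ^ q"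
    using L(2) exp_minus_inverse_le_power[of "n + 1 + q"] eventually_inverse_ge[of "2 * R"]
  proof eventually_elim
    case (elim e)
    from elim(3) have e: "e \<in> {0<..1}" by simp
    define \<Lambda> where "\<Lambda> = L * \<bar>ln e\<bar>"
    have \<Lambda>: "\<Lambda> \<ge> 0" unfolding \<Lambda>_def using L(1) by simp
    have lip: "norm (f e x - f e y) \<le> \<Lambda> * norm (x - y)" if "x \<in> cball 0 R" "y \<in> cball 0 R" for x y
      using elim(1) that unfolding \<Lambda>_def by blast
    have "norm (f e (iterate e (steps e) (t, x)) - f e (flow e (t, x))) \<le> e ^ q"
      if "(t, x) \<in> K" for t x
    proof -
      have tx: "\<bar>t\<bar> \<le> T" "norm x \<le> r" using that K by (auto simp: abs_le_iff)
      have "norm (f e (iterate e (steps e) (t, x)) - f e (flow e (t, x))) \<le>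
          \<Lambda> * norm (iterate e (steps e) (t, x) - flow e (t, x))"
        using iterate_bound[OF e tx] unfolding flow_def
        by (intro lip) (simp_all add: R_def del: iterate.simps)
      also have "norm (iterate e (steps e) (t, x) - flow e (t, x)) \<le>
          2 * R * (1 / 3) ^ steps e * exp (3 * \<Lambda> * \<bar>t\<bar>)"
        using iterate_diff_le[OF e _ lip[unfolded R_def] \<Lambda> tx, of "steps e"] T
        unfolding flow_def R_def by (simp add: norm_minus_commute)
      also have "\<dots> \<le> 2 * R * exp (- (1 / e)) * exp (3 * \<Lambda> * T)"
        using third_power_steps_le[of e] elim(3) T tx \<Lambda>
        by (intro mult_mono) (auto simp: R_def intro!: mult_left_mono)
      also have "\<Lambda> * (2 * R * exp (- (1 / e)) * exp (3 * \<Lambda> * T)) =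
          2 * R * exp (- (1 / e)) * (\<Lambda> * exp (3 * \<Lambda> * T))" by simp
      also have "\<dots> \<le> 2 * R * exp (- (1 / e)) * (exp \<Lambda> * exp (3 * \<Lambda> * T))"
      proof (intro mult_left_mono mult_right_mono)
        show "\<Lambda> \<le> exp \<Lambda>" using exp_ge_add_one_self[of \<Lambda>] by linarith
      qed (use T in \<open>auto simp: R_def\<close>)
      also have "exp \<Lambda> * exp (3 * \<Lambda> * T) = exp ((3 * T + 1) * L * \<bar>ln e\<bar>)"
        unfolding \<Lambda>_def by (simp add: exp_add[symmetric] algebra_simps)
      also have "2 * R * exp (- (1 / e)) * \<dots> \<le> 1 / e * e ^ (n + 1 + q) * (1 / e) ^ n"
        using n elim T by (intro mult_mono exp_mult_abs_ln_le) (auto simp: R_def)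
      also have "\<dots> = e ^ q" using elim(3) by (simp add: power_add power_divide)
      finally show ?thesis using \<Lambda> by (simp add: mult_left_mono)
    qed
    then show ?case by auto
  qed
qed

lemma flow_has_vector_derivative:
  "e \<in> {0<..1} \<Longrightarrow>
    ((\<lambda>\<tau>. flow e (\<tau>, x)) has_vector_derivative f e (iterate e (steps e) (t, x))) (at t)"
  unfolding flow_def by (rule iterate_has_vector_derivative)

lemma flow_at_time_0: "flow e (0, x) = x"
  by (simp add: flow_def time_integral_def)

lemma moderate_upto_flow: "moderate_upto m (\<lambda>e (_::unit). flow e)"
  unfolding flow_def by (rule moderate_upto_reindex[OF moderate_upto_iterate])

lemma flow_locally_bounded: "locally_bounded (\<lambda>e (_::unit). flow e)"
  using iterate_locally_bounded unfolding locally_bounded_def flow_def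
  by (fast elim: eventually_mono)

text \<open>Linear growth turns bounded arguments into bounded values without a loss in e. This is
  the source of c-boundedness of the time derivative of the flow.\<close>

lemma f_comp_locally_bounded:
  assumes "locally_bounded v"
  shows "locally_bounded (\<lambda>e k z. f e (v e k z))"
  unfolding locally_bounded_def
proof (intro allI impI)
  fix K :: "'c set" assume "compact K"
  then obtain R where R: "\<forall>\<^sub>F e in at_right 0. \<forall>k. \<forall>x\<in>K. norm (v e k x) \<le> R"
    using assms unfolding locally_bounded_def by blast
  have "\<forall>\<^sub>F e in at_right 0. \<forall>k. \<forall>x\<in>K. norm (f e (v e k x)) \<le> C * (1 + R)"
    using R eventually_unit
  proof eventually_elim
    case (elim e)
    have "norm (f e (v e k x)) \<le> C * (1 + R)" if "x \<in> K" for k x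
    proof -
      have "norm (f e (v e k x)) \<le> C * (1 + norm (v e k x))" using elim(2) by (intro growth) simp
      also have "\<dots> \<le> C * (1 + R)" using elim(1) that C_pos by (intro mult_left_mono) auto
      finally show ?thesis .
    qed
    then show ?case by blast
  qed
  then show "\<exists>R. \<forall>\<^sub>F e in at_right 0. \<forall>k. \<forall>x\<in>K. norm (f e (v e k x)) \<le> R" by blast
qed

text \<open>Gronwall's inequality applied along each time line. The parameter p is of arbitrary
  type: it is the initial point in the uniqueness proof, and the pair (s, x) in the proof of the
  flow property.\<close>

lemma approximate_flows_negligible:
  fixes y z :: "real \<Rightarrow> real \<times> 'p::euclidean_space \<Rightarrow> 'a"
  assumes bounded: "locally_bounded (\<lambda>e (_::unit). y e)" "locally_bounded (\<lambda>e (_::unit). z e)"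
    and y: "\<And>e t p. e \<in> {0<..1} \<Longrightarrow> ((\<lambda>\<tau>. y e (\<tau>, p)) has_vector_derivative y' e (t, p)) (at t)"
      "negligible_net (\<lambda>e w. y' e w - f e (y e w))"
    and z: "\<And>e t p. e \<in> {0<..1} \<Longrightarrow> ((\<lambda>\<tau>. z e (\<tau>, p)) has_vector_derivative z' e (t, p)) (at t)"
      "negligible_net (\<lambda>e w. z' e w - f e (z e w))"
    and init: "negligible_net (\<lambda>e p. y e (0, p) - z e (0, p))"
  shows "negligible_net (\<lambda>e w. y e w - z e w)"
  unfolding negligible_net_def
proof (intro allI impI)
  fix K :: "(real \<times> 'p) set" and q :: nat assume "compact K"
  then obtain T r where T: "T > 0" "r > 0" and K: "K \<subseteq> {-T..T} \<times> cball 0 r"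
    by (rule compact_subset_time_box)
  have box: "compact ({-T..T} \<times> cball (0::'p) r)" by (intro compact_Times) auto
  obtain R1 where R1: "\<forall>\<^sub>F e in at_right 0. \<forall>k::unit. \<forall>w\<in>{-T..T} \<times> cball 0 r. norm (y e w) \<le> R1"
    using bounded(1) box unfolding locally_bounded_def by blast
  obtain R2 where R2: "\<forall>\<^sub>F e in at_right 0. \<forall>k::unit. \<forall>w\<in>{-T..T} \<times> cball 0 r. norm (z e w) \<le> R2"
    using bounded(2) box unfolding locally_bounded_def by blast
  obtain L where L: "L \<ge> 0" "\<forall>\<^sub>F e in at_right 0. \<forall>x\<in>cball 0 (max R1 R2). \<forall>y\<in>cball 0 (max R1 R2).
      norm (f e x - f e y) \<le> L * \<bar>ln e\<bar> * norm (x - y)"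
    by (rule log_lipschitz[OF f_differentiable log])
  define n where "n = nat \<lceil>2 * L * T\<rceil>"
  have n: "2 * L * T \<le> real n" unfolding n_def by linarith
  \<comment> \<open>The squared Gronwall bound carries the factor
    \<open>5 * exp T * (1 / e) ^ n\<close>. Of the exponent, n cancels the power, 1 absorbs
    \<open>5 * exp T\<close>, and what is left of the squared errors is at most the square of
    \<open>e ^ q\<close>.\<close>
  let ?p = "n + 1 + q"
  have yn: "\<forall>\<^sub>F e in at_right 0. \<forall>w\<in>{-T..T} \<times> cball 0 r. norm (y' e w - f e (y e w)) \<le> e ^ ?p"
    using y(2) box unfolding negligible_net_def by blast
  have zn: "\<forall>\<^sub>F e in at_right 0. \<forall>w\<in>{-T..T} \<times> cball 0 r. norm (z' e w - f e (z e w)) \<le> e ^ ?p"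
    using z(2) box unfolding negligible_net_def by blast
  have "\<forall>\<^sub>F e in at_right 0. \<forall>p\<in>cball 0 r. norm (y e (0, p) - z e (0, p)) \<le> e ^ ?p"
    using init compact_cball unfolding negligible_net_def by blast
  then show "\<forall>\<^sub>F e in at_right 0. \<forall>w\<in>K. norm (y e w - z e w) \<le> e ^ q"
    using R1 R2 L(2) yn zn eventually_inverse_ge[of "5 * exp T"]
  proof eventually_elim
    case (elim e)
    from elim(7) have e: "e \<in> {0<..1}" by simp
    define \<Lambda> where "\<Lambda> = L * \<bar>ln e\<bar>"
    have \<Lambda>: "\<Lambda> \<ge> 0" unfolding \<Lambda>_def using L(1) by simp
    have "norm (y e (t, p) - z e (t, p)) \<le> e ^ q" if "(t, p) \<in> K" for t p
    proof -
      have tp: "\<bar>t\<bar> \<le> T" "norm p \<le> r" using that K by (auto simp: abs_le_iff)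
      let ?w = "\<lambda>s. y e (s, p) - z e (s, p)"
      have "norm (?w t) ^ 2 \<le> (norm (?w 0) ^ 2 + (2 * e ^ ?p) ^ 2) * exp ((2 * \<Lambda> + 1) * \<bar>t\<bar>)"
      proof (rule gronwall[OF \<Lambda>])
        show "(?w has_vector_derivative y' e (s, p) - z' e (s, p)) (at s)" for s
          by (intro has_vector_derivative_diff y z e)
        fix s assume "\<bar>s\<bar> \<le> \<bar>t\<bar>"
        with tp have s: "(s, p) \<in> {-T..T} \<times> cball 0 r" by (auto simp: abs_le_iff)
        have "norm (y e (s, p)) \<le> R1" "norm (z e (s, p)) \<le> R2"
          using elim(2,3) s by blast+
        then have "norm (f e (y e (s, p)) - f e (z e (s, p))) \<le> \<Lambda> * norm (?w s)"
          unfolding \<Lambda>_def by (intro elim(4)[rule_format]) auto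
        moreover have "norm (y' e (s, p) - f e (y e (s, p))) \<le> e ^ ?p"
          "norm (z' e (s, p) - f e (z e (s, p))) \<le> e ^ ?p"
          using elim(5,6) s by blast+
        moreover have "y' e (s, p) - z' e (s, p) = (f e (y e (s, p)) - f e (z e (s, p))) +
            ((y' e (s, p) - f e (y e (s, p))) - (z' e (s, p) - f e (z e (s, p))))" by simp
        ultimately show "norm (y' e (s, p) - z' e (s, p)) \<le> \<Lambda> * norm (?w s) + 2 * e ^ ?p"
          by (smt (verit) norm_triangle_ineq norm_triangle_ineq4)
      qed
      also have "\<dots> \<le> ((e ^ ?p) ^ 2 + (2 * e ^ ?p) ^ 2) * exp ((2 * \<Lambda> + 1) * T)"
      proof (intro mult_mono add_mono power_mono)
        show "norm (?w 0) \<le> e ^ ?p" using elim(1) tp by (simp del: power_Suc)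
      qed (use tp \<Lambda> e in \<open>auto intro: mult_left_mono\<close>)
      \<comment> \<open>The 5 is 1 + 4: the squared initial error plus the square of the two
        residuals added together.\<close>
      also have "\<dots> = 5 * exp T * exp (2 * L * T * \<bar>ln e\<bar>) * (e ^ ?p) ^ 2"
        unfolding \<Lambda>_def by (simp add: power_mult_distrib exp_add algebra_simps)
      also have "\<dots> \<le> 1 / e * (1 / e) ^ n * (e ^ ?p) ^ 2"
        using n elim(7) by (intro mult_mono exp_mult_abs_ln_le) auto
      also have "\<dots> = e ^ q * e ^ ?p" using elim(7)
        by (simp add: power_add power_divide power2_eq_square)
      also have "\<dots> \<le> e ^ q * e ^ q"
        using elim(7) by (intro mult_left_mono power_decreasing) auto
      finally have "norm (?w t) ^ 2 \<le> (e ^ q) ^ 2" by (simp add: power2_eq_square)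
      then show ?thesis using elim(7) by (auto intro: power2_le_imp_le)
    qed
    then show ?case by auto
  qed
qed

text \<open>With a global gradient bound the variational recursion has coefficients bounded
  independently of e, so the exponential weight no longer depends on e and the spatial gradient is
  bounded instead of merely moderate.\<close>

lemma iterate_gradient_bound:
  assumes M: "M \<ge> 0" "\<And>e x b. e \<in> {0<..1} \<Longrightarrow> b \<in> Basis \<Longrightarrow>
      norm (frechet_derivative (f e) (at x) b) \<le> M"
    and e: "e \<in> {0<..1}" and \<xi>: "\<xi> \<in> Basis"
  shows "norm (frechet_derivative (iterate e k) (at (t, x)) (0, \<xi>)) \<le> exp (real DIM('a) * M * \<bar>t\<bar>)"
proof (induction k arbitrary: t)
  case 0
  have "frechet_derivative snd (at (t, x)) = snd"
    using frechet_derivative_at[OF bounded_linear_imp_has_derivative[OF bounded_linear_snd]] by metis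
  then show ?case using \<xi> M by simp
next
  case (Suc k)
  let ?Q = "real DIM('a) * M"
  let ?g = "\<lambda>z. frechet_derivative (f e) (at (iterate e k z))
    (frechet_derivative (iterate e k) (at z) (0, \<xi>))"
  have "norm (time_integral ?g (t, x)) \<le> 1 * exp (?Q * \<bar>t\<bar>) - 1"
  proof (rule norm_time_integral_exp_le)
    show "continuous_on UNIV ?g"
      by (rule f_iterate_derivative_continuous[OF e Basis_space[OF \<xi>]])
    fix s
    have "norm (?g (s, x)) \<le> ?Q * norm (frechet_derivative (iterate e k) (at (s, x)) (0, \<xi>))"
      using norm_combination_le[of "frechet_derivative (f e) (at (iterate e k (s, x)))" M
          "frechet_derivative (iterate e k) (at (s, x)) (0, \<xi>)"] M(2)[OF e]
      by (simp add: f_expand[OF e])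
    also have "\<dots> \<le> ?Q * exp (?Q * \<bar>s\<bar>)" using Suc.IH M(1) by (intro mult_left_mono) auto
    finally show "norm (?g (s, x)) \<le> 1 * ?Q * exp (?Q * \<bar>s\<bar>)" by simp
  qed
  then have "norm (\<xi> + time_integral ?g (t, x)) \<le> exp (?Q * \<bar>t\<bar>)"
    using norm_triangle_ineq[of \<xi> "time_integral ?g (t, x)"] \<xi> by simp
  then show ?case
    by (simp add: frechet_derivative_at[OF iterate_has_derivative[OF e], symmetric] del: iterate.simps)
qed

lemma flow_gradient_locally_bounded:
  assumes M: "M \<ge> 0" "\<And>e x b. e \<in> {0<..1} \<Longrightarrow> b \<in> Basis \<Longrightarrow>
      norm (frechet_derivative (f e) (at x) b) \<le> M"
    and \<xi>: "\<xi> \<in> Basis"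
  shows "locally_bounded (\<lambda>e (_::unit) z. frechet_derivative (flow e) (at z) (0, \<xi>))"
  unfolding locally_bounded_def
proof (intro allI impI)
  fix K :: "(real \<times> 'a) set" assume "compact K"
  then obtain T r where T: "T > 0" "r > 0" and K: "K \<subseteq> {-T..T} \<times> cball 0 r"
    by (rule compact_subset_time_box)
  have "norm (frechet_derivative (flow e) (at (t, x)) (0, \<xi>)) \<le> exp (real DIM('a) * M * T)"
    if "(t, x) \<in> K" "e \<in> {0<..1}" for e t x
  proof -
    have "\<bar>t\<bar> \<le> T" using that K by (auto simp: abs_le_iff)
    then have "exp (real DIM('a) * M * \<bar>t\<bar>) \<le> exp (real DIM('a) * M * T)"
      using M(1) by (simp add: mult_left_mono)
    then show ?thesis
      unfolding flow_def using iterate_gradient_bound[OF M that(2) \<xi>] order_trans by blast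
  qed
  then have "\<forall>\<^sub>F e in at_right 0. \<forall>k::unit. \<forall>z\<in>K.
      norm (frechet_derivative (flow e) (at z) (0, \<xi>)) \<le> exp (real DIM('a) * M * T)"
    by (intro eventually_mono[OF eventually_unit]) auto
  then show "\<exists>R. \<forall>\<^sub>F e in at_right 0. \<forall>k::unit. \<forall>z\<in>K.
      norm (frechet_derivative (flow e) (at z) (0, \<xi>)) \<le> R" by blast
qed

end

section \<open>Negligible nets\<close>

lemma negligible_netD:
  "negligible_net u \<Longrightarrow> compact K \<Longrightarrow> \<forall>\<^sub>F e in at_right 0. \<forall>x\<in>K. norm (u e x) \<le> e ^ q"
  unfolding negligible_net_def by blast

lemma negligible_netI:
  fixes u :: "real \<Rightarrow> 'a::euclidean_space \<Rightarrow> 'b::euclidean_space"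
  assumes "\<And>K q. compact K \<Longrightarrow> \<exists>c. \<forall>\<^sub>F e in at_right 0. \<forall>x\<in>K. norm (u e x) \<le> c * e ^ q"
  shows "negligible_net u"
  unfolding negligible_net_def
proof (intro allI impI)
  fix K :: "'a set" and q :: nat assume "compact K"
  then obtain c where c: "\<forall>\<^sub>F e in at_right 0. \<forall>x\<in>K. norm (u e x) \<le> c * e ^ Suc q"
    using assms by blast
  show "\<forall>\<^sub>F e in at_right 0. \<forall>x\<in>K. norm (u e x) \<le> e ^ q"
    using c eventually_inverse_ge[of c]
  proof eventually_elim
    case (elim e)
    have "c * e ^ Suc q \<le> 1 / e * e ^ Suc q" using elim(2) by (intro mult_right_mono) auto
    also have "\<dots> = e ^ q" using elim(2) by simp
    finally show ?case using elim(1) by (auto intro: order_trans)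
  qed
qed

lemma negligible_net_cong:
  fixes u v :: "real \<Rightarrow> 'a::euclidean_space \<Rightarrow> 'b::euclidean_space"
  assumes "negligible_net u" "\<And>e x. e \<in> {0<..1} \<Longrightarrow> u e x = v e x"
  shows "negligible_net v"
  unfolding negligible_net_def
proof (intro allI impI)
  fix K :: "'a set" and q :: nat assume "compact K"
  from negligible_netD[OF assms(1) this, of q] eventually_unit
  show "\<forall>\<^sub>F e in at_right 0. \<forall>x\<in>K. norm (v e x) \<le> e ^ q"
    by eventually_elim (simp add: assms(2)[symmetric])
qed

lemma negligible_net_zero:
  "negligible_net (\<lambda>e (x :: 'a::euclidean_space). 0 :: 'b::euclidean_space)"
  unfolding negligible_net_def
proof (intro allI impI)
  fix K :: "'a set" and q :: nat
  show "\<forall>\<^sub>F e in at_right 0. \<forall>x\<in>K. norm (0 :: 'b) \<le> e ^ q"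
    using eventually_unit by (rule eventually_mono) simp
qed

lemma negligible_net_add:
  fixes u v :: "real \<Rightarrow> 'a::euclidean_space \<Rightarrow> 'b::euclidean_space"
  assumes "negligible_net u" "negligible_net v"
  shows "negligible_net (\<lambda>e x. u e x + v e x)"
proof (rule negligible_netI)
  fix K :: "'a set" and q assume K: "compact K"
  from negligible_netD[OF assms(1) K, of q] negligible_netD[OF assms(2) K, of q]
  have "\<forall>\<^sub>F e in at_right 0. \<forall>x\<in>K. norm (u e x + v e x) \<le> 2 * e ^ q"
  proof eventually_elim
    case (elim e)
    have "norm (u e x + v e x) \<le> 2 * e ^ q" if "x \<in> K" for x
    proof -
      have "norm (u e x) \<le> e ^ q" "norm (v e x) \<le> e ^ q" using elim that by auto
      then show ?thesis using norm_triangle_ineq[of "u e x" "v e x"] by linarith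
    qed
    then show ?case by blast
  qed
  then show "\<exists>c. \<forall>\<^sub>F e in at_right 0. \<forall>x\<in>K. norm (u e x + v e x) \<le> c * e ^ q" by blast
qed

lemma negligible_net_diff_trans:
  assumes "negligible_net (\<lambda>e x. u e x - v e x)" "negligible_net (\<lambda>e x. v e x - w e x)"
  shows "negligible_net (\<lambda>e x. u e x - w e x)"
  using negligible_net_add[OF assms] by simp

lemma negligible_net_diff_sym:
  "negligible_net (\<lambda>e x. u e x - v e x) \<Longrightarrow> negligible_net (\<lambda>e x. v e x - u e x)"
  unfolding negligible_net_def by (simp add: norm_minus_commute)

lemma negligible_net_componentwise:
  fixes u :: "real \<Rightarrow> 'a::euclidean_space \<Rightarrow> 'b::euclidean_space"
  shows "negligible_net u \<longleftrightarrow> (\<forall>b\<in>Basis. negligible_net (\<lambda>e x. u e x \<bullet> b))"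
proof
  assume u: "negligible_net u"
  show "\<forall>b\<in>Basis. negligible_net (\<lambda>e x. u e x \<bullet> b)"
    unfolding negligible_net_def
  proof (intro ballI allI impI)
    fix b :: 'b and K :: "'a set" and q :: nat assume b: "b \<in> Basis" and "compact K"
    from negligible_netD[OF u this(2), of q]
    show "\<forall>\<^sub>F e in at_right 0. \<forall>x\<in>K. norm (u e x \<bullet> b) \<le> e ^ q"
      by eventually_elim (use Basis_le_norm[OF b] order_trans in \<open>fastforce simp: real_norm_def\<close>)
  qed
next
  assume *: "\<forall>b\<in>Basis. negligible_net (\<lambda>e x. u e x \<bullet> b)"
  show "negligible_net u"
  proof (rule negligible_netI)
    fix K :: "'a set" and q :: nat assume "compact K"
    then have "\<forall>b\<in>Basis. \<forall>\<^sub>F e in at_right 0. \<forall>x\<in>K. norm (u e x \<bullet> b) \<le> e ^ q"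
      using * negligible_netD by blast
    then have "\<forall>\<^sub>F e in at_right 0. \<forall>b\<in>Basis. \<forall>x\<in>K. norm (u e x \<bullet> b) \<le> e ^ q"
      by (simp add: eventually_ball_finite_distrib)
    then have "\<forall>\<^sub>F e in at_right 0. \<forall>x\<in>K. norm (u e x) \<le> real DIM('b) * e ^ q"
    proof (rule eventually_mono, intro ballI)
      fix e x assume "\<forall>b\<in>Basis. \<forall>x\<in>K. norm (u e x \<bullet> b) \<le> e ^ q" "x \<in> K"
      then have "(\<Sum>b\<in>Basis. \<bar>u e x \<bullet> b\<bar>) \<le> (\<Sum>b\<in>(Basis :: 'b set). e ^ q)"
        by (intro sum_mono) simp
      then show "norm (u e x) \<le> real DIM('b) * e ^ q" using norm_le_l1[of "u e x"] by simp
    qed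
    then show "\<exists>c. \<forall>\<^sub>F e in at_right 0. \<forall>x\<in>K. norm (u e x) \<le> c * e ^ q" by blast
  qed
qed

lemma negligible_net_comp:
  fixes v :: "real \<Rightarrow> 'a::euclidean_space \<Rightarrow> 'b::euclidean_space"
  assumes "negligible_net u" "locally_bounded (\<lambda>e (_::unit). v e)"
  shows "negligible_net (\<lambda>e x. u e (v e x))"
  unfolding negligible_net_def
proof (intro allI impI)
  fix K :: "'a set" and q :: nat assume "compact K"
  then obtain R where "\<forall>\<^sub>F e in at_right 0. \<forall>k::unit. \<forall>x\<in>K. norm (v e x) \<le> R"
    using assms(2) unfolding locally_bounded_def by blast
  then show "\<forall>\<^sub>F e in at_right 0. \<forall>x\<in>K. norm (u e (v e x)) \<le> e ^ q"
    using negligible_netD[OF assms(1) compact_cball[of 0 R], of q]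
    by eventually_elim simp
qed

lemma locally_moderate_finite:
  assumes "finite S" "\<And>b. b \<in> S \<Longrightarrow> locally_moderate (a b)" "compact K"
  obtains N where
    "\<forall>\<^sub>F e in at_right 0. \<forall>b\<in>S. \<forall>k. \<forall>x\<in>K. norm (a b e k x) \<le> (1 / e) ^ N"
proof -
  have "\<forall>b\<in>S. \<exists>N::nat. \<forall>\<^sub>F e in at_right 0. \<forall>k. \<forall>x\<in>K. norm (a b e k x) \<le> (1 / e) ^ N"
    using assms(2,3) unfolding locally_moderate_def by simp
  from bchoice[OF this] obtain N :: "_ \<Rightarrow> nat" where
    N: "\<forall>b\<in>S. \<forall>\<^sub>F e in at_right 0. \<forall>k. \<forall>x\<in>K. norm (a b e k x) \<le> (1 / e) ^ N b"
    by blast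
  have "\<forall>\<^sub>F e in at_right 0. \<forall>b\<in>S. \<forall>k. \<forall>x\<in>K. norm (a b e k x) \<le> (1 / e) ^ N b"
    using N assms(1) by (simp add: eventually_ball_finite_distrib)
  then have "\<forall>\<^sub>F e in at_right 0. \<forall>b\<in>S. \<forall>k. \<forall>x\<in>K. norm (a b e k x) \<le> (1 / e) ^ sum N S"
    using eventually_unit
  proof eventually_elim
    case (elim e)
    have "(1 / e) ^ N b \<le> (1 / e) ^ sum N S" if "b \<in> S" for b
      using elim(2) member_le_sum[OF that _ assms(1), of N] by (intro power_increasing) auto
    then show ?case using elim(1) order_trans by blast
  qed
  then show ?thesis by (rule that)
qed

text \<open>On a ball containing both inner nets u has a Lipschitz constant of size
  \<open>(1 / e) ^ N\<close>, which is compensated by using the negligible difference at order N +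
  q. This gives independence of the inner representative in a composition.\<close>

lemma negligible_net_moderate_comp_diff:
  fixes u :: "real \<Rightarrow> 'b::euclidean_space \<Rightarrow> 'c::euclidean_space"
    and v w :: "real \<Rightarrow> 'a::euclidean_space \<Rightarrow> 'b"
  assumes u: "moderate_upto (Suc 0) (\<lambda>e (_::unit). u e)"
    and v: "locally_bounded (\<lambda>e (_::unit). v e)" and w: "locally_bounded (\<lambda>e (_::unit). w e)"
    and vw: "negligible_net (\<lambda>e x. v e x - w e x)"
  shows "negligible_net (\<lambda>e x. u e (v e x) - u e (w e x))"
proof (rule negligible_netI)
  fix K :: "'a set" and q :: nat assume K: "compact K"
  obtain R1 where R1: "\<forall>\<^sub>F e in at_right 0. \<forall>k::unit. \<forall>x\<in>K. norm (v e x) \<le> R1"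
    using v K unfolding locally_bounded_def by blast
  obtain R2 where R2: "\<forall>\<^sub>F e in at_right 0. \<forall>k::unit. \<forall>x\<in>K. norm (w e x) \<le> R2"
    using w K unfolding locally_bounded_def by blast
  have Du: "locally_moderate (\<lambda>e (k::unit) x. frechet_derivative (u e) (at x) b)" if "b \<in> Basis" for b
    using moderate_upto_imp_locally_moderate[OF moderate_upto_derivative[OF u that]] .
  obtain N where N: "\<forall>\<^sub>F e in at_right 0. \<forall>b\<in>Basis. \<forall>k::unit. \<forall>x\<in>cball 0 (max R1 R2).
      norm (frechet_derivative (u e) (at x) b) \<le> (1 / e) ^ N"
    using locally_moderate_finite[OF finite_Basis Du compact_cball[of 0 "max R1 R2"]] .
  have "\<forall>\<^sub>F e in at_right 0. \<forall>x\<in>K. norm (u e (v e x) - u e (w e x)) \<le> real DIM('b) * e ^ q"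
    using R1 R2 N negligible_netD[OF vw K, of "N + q"] eventually_unit
  proof eventually_elim
    case (elim e)
    show ?case
    proof
      fix x assume x: "x \<in> K"
      have "norm (u e (v e x) - u e (w e x)) \<le> real DIM('b) * (1 / e) ^ N * norm (v e x - w e x)"
      proof (rule lipschitz_on_cball_if_partials_le)
        show "u e differentiable at y" for y using u elim(5) by simp
        show "norm (frechet_derivative (u e) (at y) b) \<le> (1 / e) ^ N"
          if "y \<in> cball 0 (max R1 R2)" "b \<in> Basis" for y b
          using elim(3) that by blast
        have "norm (v e x) \<le> R1" "norm (w e x) \<le> R2" using elim(1,2) x by blast+
        then show "v e x \<in> cball 0 (max R1 R2)" "w e x \<in> cball 0 (max R1 R2)" by auto
      qed (use elim(5) in simp)
      also have "\<dots> \<le> real DIM('b) * (1 / e) ^ N * e ^ (N + q)"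
        using elim(4,5) x by (intro mult_left_mono) auto
      also have "\<dots> = real DIM('b) * e ^ q" using elim(5) by (simp add: power_add power_divide)
      finally show "norm (u e (v e x) - u e (w e x)) \<le> real DIM('b) * e ^ q" .
    qed
  qed
  then show "\<exists>c. \<forall>\<^sub>F e in at_right 0. \<forall>x\<in>K. norm (u e (v e x) - u e (w e x)) \<le> c * e ^ q" by blast
qed

lemma norm_increment_le:
  fixes g :: "real \<Rightarrow> 'a::euclidean_space"
  assumes deriv: "\<And>s. (g has_vector_derivative g' s) (at s)"
    and le: "\<And>s. 0 \<le> s \<Longrightarrow> s \<le> h \<Longrightarrow> norm (g' s) \<le> M" and h: "h > 0"
  shows "norm (g h - g 0) \<le> h * M"
proof -
  have "norm (g h - g 0) \<le> h * M - 0 * M"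
  proof (rule differentiable_bound_general[OF h])
    show "continuous_on {0..h} g"
      using deriv has_vector_derivative_continuous continuous_at_imp_continuous_on by blast
    show "continuous_on {0..h} (\<lambda>s. s * M)" by (intro continuous_intros)
    show "((\<lambda>s. s * M) has_vector_derivative M) (at s)" for s
      unfolding has_real_derivative_iff_has_vector_derivative[symmetric]
      by (auto intro!: derivative_eq_intros)
  qed (use deriv le in auto)
  then show ?thesis by simp
qed

text \<open>
  A Taylor expansion of order two along \<open>b\<close> with step \<open>h = e\<^sup>p\<close>: the first derivative is
  controlled by \<open>\<bar>u\<bar> / h\<close> and \<open>h\<close> times the moderate second derivative.
\<close>

lemma negligible_net_derivative:
  fixes u :: "real \<Rightarrow> 'a::euclidean_space \<Rightarrow> 'b::euclidean_space"
  assumes u: "moderate_upto (Suc (Suc 0)) (\<lambda>e (_::unit). u e)" and neg: "negligible_net u"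
    and b: "b \<in> Basis"
  shows "negligible_net (\<lambda>e x. frechet_derivative (u e) (at x) b)"
proof (rule negligible_netI)
  fix K :: "'a set" and q :: nat assume K: "compact K"
  \<comment> \<open>Since the step h is at most 1, this one compact set contains the Taylor segments
    for all e.\<close>
  define K' where "K' = (\<lambda>(x, s). x + s *\<^sub>R b) ` (K \<times> {0..1::real})"
  have K': "compact K'"
    unfolding K'_def case_prod_beta
    by (intro compact_continuous_image compact_Times K continuous_intros) auto
  have K'_I: "x + s *\<^sub>R b \<in> K'" if "x \<in> K" "0 \<le> s" "s \<le> 1" for x s
    unfolding K'_def using that by force
  define g where "g e x = frechet_derivative (u e) (at x) b" for e x
  have g: "moderate_upto (Suc 0) (\<lambda>e (_::unit). g e)"
    using moderate_upto_derivative[OF u b] unfolding g_def .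
  obtain N where N: "\<forall>\<^sub>F e in at_right 0. \<forall>k::unit. \<forall>x\<in>K'. norm (frechet_derivative (g e) (at x) b) \<le> (1 / e) ^ N"
    using locally_moderateD[OF moderate_upto_imp_locally_moderate[OF moderate_upto_derivative[OF g b]] K'] .
  \<comment> \<open>With h = \<open>e ^ p\<close>, negligibility at order 2 p bounds u by the square
    of h, so each of the two values of u contributes at most h \<le> \<open>e ^ q\<close> after
    division by h. The second-derivative term is h times \<open>(1 / e) ^ N\<close>, that is
    \<open>e ^ q\<close>. Three terms make the constant 3.\<close>
  define p where "p = N + q"
  have "\<forall>\<^sub>F e in at_right 0. \<forall>x\<in>K. norm (g e x) \<le> 3 * e ^ q"
    using N negligible_netD[OF neg K', of "2 * p"] eventually_unit
  proof eventually_elim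
    case (elim e)
    then have e: "e \<in> {0<..1}" by simp
    define h where "h = e ^ p"
    have hh: "h * h = e ^ (2 * p)"
      unfolding h_def by (subst mult_2) (rule power_add[symmetric])
    have h: "0 < h" "h \<le> 1" unfolding h_def using elim(3) by (auto intro: power_le_one)
    show ?case
    proof
      fix x assume x: "x \<in> K"
      have line: "((\<lambda>s. x + s *\<^sub>R b) has_derivative (\<lambda>r. r *\<^sub>R b)) (at s)" for s
        by (auto intro!: derivative_eq_intros)
      have du: "((\<lambda>s. u e (x + s *\<^sub>R b)) has_vector_derivative g e (x + s *\<^sub>R b)) (at s)" for s
        using has_derivative_compose[OF line moderate_upto_has_derivative[OF u e]]
          linear_scale[OF has_derivative_linear[OF moderate_upto_has_derivative[OF u e]]]
        by (simp add: has_vector_derivative_def g_def)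
      have dg: "((\<lambda>s. g e (x + s *\<^sub>R b)) has_vector_derivative
          frechet_derivative (g e) (at (x + s *\<^sub>R b)) b) (at s)" for s
        using has_derivative_compose[OF line moderate_upto_has_derivative[OF g e]]
          linear_scale[OF has_derivative_linear[OF moderate_upto_has_derivative[OF g e]]]
        by (simp add: has_vector_derivative_def)
      have dg_le: "norm (g e (x + s *\<^sub>R b) - g e x) \<le> h * (1 / e) ^ N" if s: "0 \<le> s" "s \<le> h" for s
      proof (cases "s = 0")
        case False
        with s have "s > 0" by simp
        have "norm (g e (x + s *\<^sub>R b) - g e (x + 0 *\<^sub>R b)) \<le> s * (1 / e) ^ N"
        proof (rule norm_increment_le[OF dg _ \<open>s > 0\<close>])
          fix r assume "0 \<le> r" "r \<le> s"
          then have "x + r *\<^sub>R b \<in> K'" using s h x by (intro K'_I) auto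
          then show "norm (frechet_derivative (g e) (at (x + r *\<^sub>R b)) b) \<le> (1 / e) ^ N"
            using elim(1) by blast
        qed
        also have "\<dots> \<le> h * (1 / e) ^ N" using s elim(3) by (intro mult_right_mono) auto
        finally show ?thesis by simp
      qed (use h elim(3) in auto)
      have "norm ((u e (x + h *\<^sub>R b) - h *\<^sub>R g e x) - (u e (x + 0 *\<^sub>R b) - 0 *\<^sub>R g e x)) \<le>
          h * (h * (1 / e) ^ N)"
      proof (rule norm_increment_le[OF _ dg_le h(1)])
        fix s
        have "((\<lambda>s. s *\<^sub>R g e x) has_vector_derivative 1 *\<^sub>R g e x) (at s)"
          by (auto intro!: derivative_eq_intros)
        then show "((\<lambda>s. u e (x + s *\<^sub>R b) - s *\<^sub>R g e x) has_vector_derivative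
            g e (x + s *\<^sub>R b) - g e x) (at s)"
          using has_vector_derivative_diff[OF du] by simp
      qed
      moreover have "norm (u e (x + h *\<^sub>R b)) \<le> h * h" "norm (u e (x + 0 *\<^sub>R b)) \<le> h * h"
        using elim(2) K'_I[OF x, of h] K'_I[OF x, of 0] h(1,2) hh by auto
      moreover have "norm (h *\<^sub>R g e x) = h * norm (g e x)" using h by simp
      moreover have "h *\<^sub>R g e x = u e (x + h *\<^sub>R b) - u e (x + 0 *\<^sub>R b) -
         ((u e (x + h *\<^sub>R b) - h *\<^sub>R g e x) - (u e (x + 0 *\<^sub>R b) - 0 *\<^sub>R g e x))" by simp
      ultimately have "h * norm (g e x) \<le> h * h + h * h + h * (h * (1 / e) ^ N)"
        by (smt (verit) norm_triangle_ineq4)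
      then have "h * norm (g e x) \<le> h * (h + h + h * (1 / e) ^ N)" by (simp add: algebra_simps)
      then have "norm (g e x) \<le> h + h + h * (1 / e) ^ N" using h(1) by simp
      moreover have "h * (1 / e) ^ N = e ^ q"
        unfolding h_def p_def using elim(3) by (simp add: power_add power_divide)
      moreover have "h \<le> e ^ q"
        unfolding h_def p_def using elim(3) by (intro power_decreasing) auto
      ultimately show "norm (g e x) \<le> 3 * e ^ q" by simp
    qed
  qed
  then show "\<exists>c. \<forall>\<^sub>F e in at_right 0. \<forall>x\<in>K. norm (frechet_derivative (u e) (at x) b) \<le> c * e ^ q"
    unfolding g_def by blast
qed

section \<open>Classes of nets\<close>

lemma c_bounded_iff: "c_bounded u \<longleftrightarrow> locally_bounded (\<lambda>e (_::unit). u e)"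
proof
  assume u: "c_bounded u"
  show "locally_bounded (\<lambda>e (_::unit). u e)"
    unfolding locally_bounded_def
  proof (intro allI impI)
    fix K :: "'a set" assume "compact K"
    then obtain e0 K' where K': "e0 > 0" "compact K'" "\<forall>e\<in>{0<..1}. e < e0 \<longrightarrow> u e ` K \<subseteq> K'"
      using u unfolding c_bounded_def by blast
    from compact_imp_bounded[OF K'(2)] obtain R where R: "\<forall>y\<in>K'. norm y \<le> R"
      unfolding bounded_iff by blast
    have "\<forall>\<^sub>F e in at_right 0. \<forall>k::unit. \<forall>x\<in>K. norm (u e x) \<le> R"
      using eventually_small[OF K'(1)]
    proof eventually_elim
      case (elim e)
      then have "u e ` K \<subseteq> K'" using K'(3) by simp
      then show ?case using R by blast
    qed
    then show "\<exists>R. \<forall>\<^sub>F e in at_right 0. \<forall>k::unit. \<forall>x\<in>K. norm (u e x) \<le> R" by blast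
  qed
next
  assume u: "locally_bounded (\<lambda>e (_::unit). u e)"
  show "c_bounded u"
    unfolding c_bounded_def
  proof (intro allI impI)
    fix K :: "'a set" assume "compact K"
    then obtain R where "\<forall>\<^sub>F e in at_right 0. \<forall>k::unit. \<forall>x\<in>K. norm (u e x) \<le> R"
      using u unfolding locally_bounded_def by blast
    then obtain b where b: "b > 0" "\<forall>e>0. e < b \<longrightarrow> (\<forall>x\<in>K. norm (u e x) \<le> R)"
      unfolding eventually_at_right_field by auto
    then have "\<forall>e\<in>{0<..1}. e < b \<longrightarrow> u e ` K \<subseteq> cball 0 R" by (simp add: image_subset_iff)
    then show "\<exists>e0>0. \<exists>K'. compact K' \<and> (\<forall>e\<in>{0<..1}. e < e0 \<longrightarrow> u e ` K \<subseteq> K')"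
      by (intro exI[of _ b] exI[of _ "cball 0 R"] conjI b(1) compact_cball)
  qed
qed

text \<open>Continuity on the compact set makes the family bounded above, so that the supremum
  dominates the values; nonemptiness and nonnegativity yield the converse. All growth conditions of
  the definitions are translated into pointwise bounds through this equivalence.\<close>

lemma SUP_bigo_iff:
  fixes h :: "real \<Rightarrow> 'a::euclidean_space \<Rightarrow> real"
  assumes K: "compact K" "K \<noteq> {}"
    and cont: "\<And>e. e \<in> {0<..1} \<Longrightarrow> continuous_on K (h e)" and nonneg: "\<And>e x. h e x \<ge> 0"
  shows "(\<lambda>e. SUP x\<in>K. h e x) \<in> O[at_right 0](p) \<longleftrightarrow>
    (\<exists>c. \<forall>\<^sub>F e in at_right 0. \<forall>x\<in>K. h e x \<le> c * \<bar>p e\<bar>)"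
proof
  assume "(\<lambda>e. SUP x\<in>K. h e x) \<in> O[at_right 0](p)"
  then obtain c where c: "\<forall>\<^sub>F e in at_right 0. norm (SUP x\<in>K. h e x) \<le> c * norm (p e)"
    by (rule landau_o.bigE) 
  have "\<forall>\<^sub>F e in at_right 0. \<forall>x\<in>K. h e x \<le> c * \<bar>p e\<bar>"
    using c eventually_unit
  proof eventually_elim
    case (elim e)
    show ?case
    proof
      fix x assume "x \<in> K"
      have "bdd_above (h e ` K)"
        using compact_continuous_image[OF cont K(1)] elim(2)
        by (intro bounded_imp_bdd_above compact_imp_bounded) simp
      with \<open>x \<in> K\<close> have "h e x \<le> (SUP x\<in>K. h e x)" by (rule cSUP_upper)
      with elim(1) show "h e x \<le> c * \<bar>p e\<bar>" by simp
    qed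
  qed
  then show "\<exists>c. \<forall>\<^sub>F e in at_right 0. \<forall>x\<in>K. h e x \<le> c * \<bar>p e\<bar>" by blast
next
  assume "\<exists>c. \<forall>\<^sub>F e in at_right 0. \<forall>x\<in>K. h e x \<le> c * \<bar>p e\<bar>"
  then obtain c where c: "\<forall>\<^sub>F e in at_right 0. \<forall>x\<in>K. h e x \<le> c * \<bar>p e\<bar>" by blast
  have "\<forall>\<^sub>F e in at_right 0. norm (SUP x\<in>K. h e x) \<le> c * norm (p e)"
    using c
  proof eventually_elim
    case (elim e)
    obtain y where y: "y \<in> K" using K(2) by blast
    have "bdd_above (h e ` K)" using elim by (intro bdd_aboveI2[of _ _ "c * \<bar>p e\<bar>"]) blast
    with y have "h e y \<le> (SUP x\<in>K. h e x)" by (rule cSUP_upper)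
    then have "0 \<le> (SUP x\<in>K. h e x)" using nonneg[of e y] by linarith
    moreover have "(SUP x\<in>K. h e x) \<le> c * \<bar>p e\<bar>" using elim by (intro cSUP_least K) blast
    ultimately show ?case by simp
  qed
  then show "(\<lambda>e. SUP x\<in>K. h e x) \<in> O[at_right 0](p)" by (rule bigoI)
qed

section \<open>Moderate and negligible nets expressed by pointwise estimates\<close>

lemma partials_append: "partials (bs @ cs) g = partials bs (partials cs g)"
  by (simp add: partials_def)

lemma partials_continuous_on:
  assumes "smooth g" "bs \<in> lists Basis"
  shows "continuous_on S (partials bs g)"
  using assms unfolding smooth_def
  by (meson continuous_on_subset differentiable_imp_continuous_on subset_UNIV)

lemma moderate_iff:
  "u \<in> moderate \<longleftrightarrow> (\<forall>e\<in>{0<..1}. smooth (u e)) \<and>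
    (\<forall>bs\<in>lists Basis. locally_moderate (\<lambda>e (_::unit). partials bs (u e)))"
proof (cases "\<forall>e\<in>{0<..1}. smooth (u e)")
  case smooth: True
  have SUP: "(\<lambda>e. SUP x\<in>K. \<bar>partials bs (u e) x\<bar>) \<in> O[at_right 0](\<lambda>e. 1 / e ^ N) \<longleftrightarrow>
      (\<exists>c. \<forall>\<^sub>F e in at_right 0. \<forall>x\<in>K. \<bar>partials bs (u e) x\<bar> \<le> c * \<bar>1 / e ^ N\<bar>)"
    if "compact K" "K \<noteq> {}" "bs \<in> lists Basis" for K bs and N :: nat
    using that smooth
    by (intro SUP_bigo_iff) (auto intro!: continuous_intros partials_continuous_on simp del: in_lists_conv_set)
  have abs_eq: "(\<forall>\<^sub>F e in at_right 0. \<forall>x\<in>K. \<bar>partials bs (u e) x\<bar> \<le> c * \<bar>1 / e ^ N\<bar>) \<longleftrightarrow>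
      (\<forall>\<^sub>F e in at_right 0. \<forall>k::unit. \<forall>x\<in>K. norm (partials bs (u e) x) \<le> c * (1 / e) ^ N)"
    for K bs N c
    by (rule eventually_cong[OF eventually_unit]) (auto simp: power_divide)
  have "(\<forall>K. compact K \<and> K \<noteq> {} \<longrightarrow> (\<exists>N::nat. (\<lambda>e. SUP x\<in>K. \<bar>partials bs (u e) x\<bar>) \<in> O[at_right 0](\<lambda>e. 1 / e ^ N)))
      \<longleftrightarrow> locally_moderate (\<lambda>e (_::unit). partials bs (u e))" (is "?l \<longleftrightarrow> ?r")
    if bs: "bs \<in> lists Basis" for bs
  proof
    assume l: ?l
    show ?r
    proof (rule locally_moderateI)
      fix K :: "'a set" assume K: "compact K"
      show "\<exists>N c. \<forall>\<^sub>F e in at_right 0. \<forall>k::unit. \<forall>x\<in>K. norm (partials bs (u e) x) \<le> c * (1 / e) ^ N"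
      proof (cases "K = {}")
        case False
        then show ?thesis using l K SUP[OF K False bs] unfolding abs_eq by blast
      qed simp
    qed
  next
    assume r: ?r
    show ?l
    proof (intro allI impI)
      fix K :: "'a set" assume K: "compact K \<and> K \<noteq> {}"
      obtain N where "\<forall>\<^sub>F e in at_right 0. \<forall>k::unit. \<forall>x\<in>K. norm (partials bs (u e) x) \<le> (1 / e) ^ N"
        using locally_moderateD[OF r] K by blast
      then have "\<forall>\<^sub>F e in at_right 0. \<forall>k::unit. \<forall>x\<in>K. norm (partials bs (u e) x) \<le> 1 * (1 / e) ^ N"
        by simp
      then show "\<exists>N::nat. (\<lambda>e. SUP x\<in>K. \<bar>partials bs (u e) x\<bar>) \<in> O[at_right 0](\<lambda>e. 1 / e ^ N)"
        using SUP[of K bs] K bs unfolding abs_eq by blast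
    qed
  qed
  then have eq: "(\<forall>bs\<in>lists Basis. \<forall>K. compact K \<and> K \<noteq> {} \<longrightarrow>
        (\<exists>N::nat. (\<lambda>e. SUP x\<in>K. \<bar>partials bs (u e) x\<bar>) \<in> O[at_right 0](\<lambda>e. 1 / e ^ N)))
      \<longleftrightarrow> (\<forall>bs\<in>lists Basis. locally_moderate (\<lambda>e (_::unit). partials bs (u e)))"
    by (rule ball_cong[OF refl])
  have swap: "(\<forall>K. c K \<longrightarrow> (\<forall>b\<in>A. P b K)) \<longleftrightarrow> (\<forall>b\<in>A. \<forall>K. c K \<longrightarrow> P b K)"
    for c :: "'a set \<Rightarrow> bool" and A :: "'a list set" and P by blast
  have "u \<in> moderate \<longleftrightarrow> (\<forall>bs\<in>lists Basis. \<forall>K. compact K \<and> K \<noteq> {} \<longrightarrow>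
        (\<exists>N::nat. (\<lambda>e. SUP x\<in>K. \<bar>partials bs (u e) x\<bar>) \<in> O[at_right 0](\<lambda>e. 1 / e ^ N)))"
    unfolding moderate_def mem_Collect_eq swap by (rule iffI, erule conjunct2, rule conjI[OF smooth])
  then show ?thesis unfolding eq using smooth by blast
next
  case False
  then show ?thesis unfolding moderate_def mem_Collect_eq by (simp only: simp_thms)
qed

lemma moderate_iff_moderate_upto:
  fixes u :: "real \<Rightarrow> 'a::euclidean_space \<Rightarrow> real"
  shows "u \<in> moderate \<longleftrightarrow> (\<forall>m. moderate_upto m (\<lambda>e (_::unit). u e))"
proof
  show "\<forall>m. moderate_upto m (\<lambda>e (_::unit). u e)" if "u \<in> moderate"
  proof
    fix m show "moderate_upto m (\<lambda>e (_::unit). u e)"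
      using that
    proof (induction m arbitrary: u)
      case (0 u)
      then have "continuous_on UNIV (partials [] (u e))" if "e \<in> {0<..1}" for e
        using that by (intro partials_continuous_on) (auto simp: moderate_iff)
      moreover have "locally_moderate (\<lambda>e (_::unit). partials [] (u e))"
        using 0 unfolding moderate_iff by (metis lists.Nil)
      ultimately show ?case by (simp add: partials_def)
    next
      case (Suc m u)
      have "locally_moderate (\<lambda>e (_::unit). partials [] (u e))"
        using Suc.prems unfolding moderate_iff by (metis lists.Nil)
      moreover have "partials [] (u e) differentiable_on UNIV" if "e \<in> {0<..1}" for e
        using Suc.prems that unfolding moderate_iff smooth_def by (metis lists.Nil)
      moreover have "moderate_upto m (\<lambda>e (_::unit) x. frechet_derivative (u e) (at x) b)"
        if b: "b \<in> Basis" for b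
      proof -
        \<comment> \<open>In a list of directions the last one is applied first, whereas
          \<open>moderate_upto\<close> takes the innermost derivative off first. The directional
          derivative thus corresponds to appending b at the end.\<close>
        have eq: "partials bs (\<lambda>x. frechet_derivative (u e) (at x) b) = partials (bs @ [b]) (u e)" for bs e
          by (simp add: partials_append) (simp add: partials_def partial_def)
        have "bs @ [b] \<in> lists Basis" if "bs \<in> lists Basis" for bs using b that by simp
        then have "(\<lambda>e x. frechet_derivative (u e) (at x) b) \<in> moderate"
          using Suc.prems unfolding moderate_iff smooth_def eq by blast
        then show ?thesis by (rule Suc.IH)
      qed
      ultimately show ?case by (simp add: partials_def differentiable_on_def)
    qed
  qed
next
  assume u: "\<forall>m. moderate_upto m (\<lambda>e (_::unit). u e)"
  have *: "moderate_upto m (\<lambda>e (_::unit). partials bs (u e))" if "bs \<in> lists Basis" for bs m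
    using that
  proof (induction bs arbitrary: m)
    case Nil
    then show ?case using u by (simp add: partials_def)
  next
    case (Cons b bs)
    then show ?case
      using moderate_upto_derivative[OF Cons.IH, of b m] by (simp add: partials_def partial_def)
  qed
  have "smooth (u e)" if "e \<in> {0<..1}" for e
    unfolding smooth_def differentiable_on_def
    using *[of _ "Suc 0"] that by (auto simp del: in_lists_conv_set)
  then show "u \<in> moderate"
    using * moderate_upto_imp_locally_moderate unfolding moderate_iff by blast
qed

lemma moderate_vec_iff: "u \<in> moderate_vec \<longleftrightarrow> (\<forall>m. moderate_upto m (\<lambda>e (_::unit). u e))"
  unfolding moderate_vec_def
  by (auto simp: moderate_iff_moderate_upto moderate_upto_componentwise[where u="\<lambda>e _. u e"])

lemma moderate_vecD: "u \<in> moderate_vec \<Longrightarrow> moderate_upto m (\<lambda>e (_::unit). u e)"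
  by (simp add: moderate_vec_iff)

lemma negligible_nets_iff: "u \<in> negligible_nets \<longleftrightarrow> u \<in> moderate \<and> negligible_net u"
proof (cases "u \<in> moderate")
  case True
  have cont: "continuous_on K (u e)" if "e \<in> {0<..1}" for K e
    using moderate_upto_continuous_on[of 0 "\<lambda>e _. u e", OF _ that] True
    by (auto simp: moderate_iff_moderate_upto intro: continuous_on_subset simp del: moderate_upto.simps)
  have SUP: "(\<lambda>e. SUP x\<in>K. \<bar>u e x\<bar>) \<in> O[at_right 0](\<lambda>e. e ^ q) \<longleftrightarrow>
      (\<exists>c. \<forall>\<^sub>F e in at_right 0. \<forall>x\<in>K. \<bar>u e x\<bar> \<le> c * \<bar>e ^ q\<bar>)"
    if "compact K" "K \<noteq> {}" for K and q :: nat
    using that by (intro SUP_bigo_iff continuous_intros cont) auto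
  have abs_eq: "(\<forall>\<^sub>F e in at_right 0. \<forall>x\<in>K. \<bar>u e x\<bar> \<le> c * \<bar>e ^ q\<bar>) \<longleftrightarrow>
      (\<forall>\<^sub>F e in at_right 0. \<forall>x\<in>K. norm (u e x) \<le> c * e ^ q)" for K c and q :: nat
    by (rule eventually_cong[OF eventually_unit]) auto
  have "(\<forall>K. compact K \<and> K \<noteq> {} \<longrightarrow> (\<forall>q::nat. (\<lambda>e. SUP x\<in>K. \<bar>u e x\<bar>) \<in> O[at_right 0](\<lambda>e. e ^ q)))
      \<longleftrightarrow> negligible_net u" (is "?l \<longleftrightarrow> ?r")
  proof
    assume l: ?l
    show ?r
    proof (rule negligible_netI)
      fix K :: "'a set" and q :: nat assume K: "compact K"
      show "\<exists>c. \<forall>\<^sub>F e in at_right 0. \<forall>x\<in>K. norm (u e x) \<le> c * e ^ q"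
      proof (cases "K = {}")
        case False
        then show ?thesis using l K SUP[OF K False] unfolding abs_eq by blast
      qed simp
    qed
  next
    assume r: ?r
    show ?l
    proof (intro allI impI)
      fix K :: "'a set" and q :: nat assume K: "compact K \<and> K \<noteq> {}"
      have "\<forall>\<^sub>F e in at_right 0. \<forall>x\<in>K. norm (u e x) \<le> 1 * e ^ q"
        using negligible_netD[OF r, of K q] K by simp
      then show "(\<lambda>e. SUP x\<in>K. \<bar>u e x\<bar>) \<in> O[at_right 0](\<lambda>e. e ^ q)"
        using SUP[of K q] K unfolding abs_eq by blast
    qed
  qed
  then show ?thesis using True unfolding negligible_nets_def by blast
qed (simp add: negligible_nets_def)

lemma colombeau_rel_iff: "(u, v) \<in> colombeau_rel \<longleftrightarrow>
  u \<in> moderate_vec \<and> v \<in> moderate_vec \<and> negligible_net (\<lambda>e x. u e x - v e x)"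
proof -
  have "(\<lambda>e x. (u e x - v e x) \<bullet> b) \<in> moderate"
    if "u \<in> moderate_vec" "v \<in> moderate_vec" "b \<in> Basis" for b
  proof -
    have "(\<lambda>e x. u e x - v e x) \<in> moderate_vec"
      using that by (simp add: moderate_vec_iff moderate_upto_diff)
    then show ?thesis using that unfolding moderate_vec_def by simp
  qed
  then show ?thesis
    unfolding colombeau_rel_def negligible_nets_iff
      negligible_net_componentwise[of "\<lambda>e x. u e x - v e x"] by auto
qed

section \<open>The quotient, c-bounded classes and well-definedness of operations\<close>

lemma equiv_colombeau_rel: "equiv moderate_vec colombeau_rel"
proof (rule equivI)
  show "colombeau_rel \<subseteq> moderate_vec \<times> moderate_vec" by (auto simp: colombeau_rel_iff)
  show "refl_on moderate_vec colombeau_rel"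
    by (rule refl_onI) (auto simp: colombeau_rel_iff negligible_net_zero)
  show "sym colombeau_rel"
    by (rule symI) (auto simp: colombeau_rel_iff intro: negligible_net_diff_sym)
  show "trans colombeau_rel"
    by (rule transI) (auto simp: colombeau_rel_iff intro: negligible_net_diff_trans)
qed

lemma gclass_eq_iff:
  "u \<in> moderate_vec \<Longrightarrow> v \<in> moderate_vec \<Longrightarrow>
    gclass u = gclass v \<longleftrightarrow> negligible_net (\<lambda>e x. u e x - v e x)"
  unfolding gclass_def by (simp add: eq_equiv_class_iff[OF equiv_colombeau_rel] colombeau_rel_iff)

lemma gclass_eqI: "(u, v) \<in> colombeau_rel \<Longrightarrow> gclass u = gclass v"
  by (simp add: gclass_eq_iff colombeau_rel_iff)

lemma mem_gclass_iff: "v \<in> gclass u \<longleftrightarrow> (u, v) \<in> colombeau_rel"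
  by (simp add: gclass_def)

lemma colombeau_eq_gclass:
  assumes "U \<in> colombeau" "u \<in> U"
  shows "U = gclass u" "u \<in> moderate_vec"
proof -
  obtain v where v: "v \<in> moderate_vec" "U = gclass v"
    using assms(1) unfolding colombeau_def gclass_def by (rule quotientE)
  then have "(v, u) \<in> colombeau_rel" using assms(2) by (simp add: mem_gclass_iff)
  then show "U = gclass u" "u \<in> moderate_vec" using v gclass_eqI by (auto simp: colombeau_rel_iff)
qed

lemma gclass_in_colombeau: "u \<in> moderate_vec \<Longrightarrow> gclass u \<in> colombeau"
  unfolding colombeau_def gclass_def by (rule quotientI)

lemma colombeau_cbE:
  assumes "U \<in> colombeau_cb"
  obtains u where "u \<in> moderate_vec" "c_bounded u" "U = gclass u"
  using assms unfolding colombeau_cb_def gclass_def by (auto elim!: quotientE)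

lemma gclass_in_colombeau_cb: "u \<in> moderate_vec \<Longrightarrow> c_bounded u \<Longrightarrow> gclass u \<in> colombeau_cb"
  unfolding colombeau_cb_def gclass_def by (auto intro: quotientI)

lemma locally_bounded_negligible_diff:
  fixes u v :: "real \<Rightarrow> 'a::euclidean_space \<Rightarrow> 'b::euclidean_space"
  assumes "locally_bounded (\<lambda>e (_::unit). u e)" "negligible_net (\<lambda>e x. u e x - v e x)"
  shows "locally_bounded (\<lambda>e (_::unit). v e)"
  unfolding locally_bounded_def
proof (intro allI impI)
  fix K :: "'a set" assume K: "compact K"
  then obtain R where R: "\<forall>\<^sub>F e in at_right 0. \<forall>k::unit. \<forall>x\<in>K. norm (u e x) \<le> R"
    using assms(1) unfolding locally_bounded_def by blast
  have "\<forall>\<^sub>F e in at_right 0. \<forall>k::unit. \<forall>x\<in>K. norm (v e x) \<le> R + 1"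
    using R negligible_netD[OF assms(2) K, of 0]
  proof eventually_elim
    case (elim e)
    have "norm (v e x) \<le> R + 1" if "x \<in> K" for x
    proof -
      have "norm (u e x) \<le> R" "norm (u e x - v e x) \<le> 1" using elim that by auto
      then show ?thesis using norm_triangle_sub[of "v e x" "u e x"] by (simp add: norm_minus_commute)
    qed
    then show ?case by blast
  qed
  then show "\<exists>R. \<forall>\<^sub>F e in at_right 0. \<forall>k::unit. \<forall>x\<in>K. norm (v e x) \<le> R" by blast
qed

lemma c_bounded_colombeau_rel: "(u, v) \<in> colombeau_rel \<Longrightarrow> c_bounded u \<Longrightarrow> c_bounded v"
  unfolding c_bounded_iff colombeau_rel_iff by (blast intro: locally_bounded_negligible_diff)

lemma c_bounded_gfun_gclass: "u \<in> moderate_vec \<Longrightarrow> c_bounded u \<Longrightarrow> c_bounded_gfun (gclass u)"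
  unfolding c_bounded_gfun_def
  by (auto simp: gclass_in_colombeau mem_gclass_iff intro: c_bounded_colombeau_rel)

text \<open>If T sends all representatives into the class of one w, the union defining
  \<open>gmap\<close> collapses to that class. The net w may be chosen more conveniently than
  \<open>T u\<close>, for instance as one that agrees with it only on (0, 1].\<close>

lemma gmap_gclass:
  assumes "u \<in> moderate_vec" "\<And>v. (u, v) \<in> colombeau_rel \<Longrightarrow> (w, T v) \<in> colombeau_rel"
  shows "gmap T (gclass u) = gclass w"
proof -
  have "u \<in> gclass u" using assms(1) by (simp add: mem_gclass_iff colombeau_rel_iff negligible_net_zero)
  moreover have "gclass (T v) = gclass w" if "v \<in> gclass u" for v
    using gclass_eqI[OF assms(2)] that by (simp add: mem_gclass_iff)
  ultimately show ?thesis unfolding gmap_def by auto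
qed

lemma moderate_vec_comp:
  assumes "u \<in> moderate_vec" "v \<in> moderate_vec" "c_bounded v"
  shows "(\<lambda>e. u e \<circ> v e) \<in> moderate_vec"
  unfolding moderate_vec_iff comp_def
  using moderate_upto_comp[OF assms(3)[unfolded c_bounded_iff] moderate_vecD[OF assms(1)] moderate_vecD[OF assms(2)]]
  by blast

text \<open>The outer net is exchanged before the inner one: the first change is a negligible net
  evaluated in a ball, the second is handled by the moderate Lipschitz constant of the outer
  net.\<close>

lemma colombeau_rel_comp:
  assumes uu': "(u, u') \<in> colombeau_rel" and vv': "(v, v') \<in> colombeau_rel" and v: "c_bounded v"
  shows "((\<lambda>e. u e \<circ> v e), (\<lambda>e. u' e \<circ> v' e)) \<in> colombeau_rel"
proof -
  have v': "c_bounded v'" using vv' v by (rule c_bounded_colombeau_rel)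
  note m = uu'[unfolded colombeau_rel_iff] vv'[unfolded colombeau_rel_iff]
  have "negligible_net (\<lambda>e x. u e (v e x) - u' e (v e x))"
    using negligible_net_comp[of "\<lambda>e x. u e x - u' e x" v] m v by (simp add: c_bounded_iff)
  moreover have "negligible_net (\<lambda>e x. u' e (v e x) - u' e (v' e x))"
    by (rule negligible_net_moderate_comp_diff[OF moderate_vecD])
      (use m v v' in \<open>simp_all add: c_bounded_iff\<close>)
  ultimately have "negligible_net (\<lambda>e x. u e (v e x) - u' e (v' e x))"
    by (rule negligible_net_diff_trans)
  then show ?thesis using m v v' by (simp add: colombeau_rel_iff moderate_vec_comp)
qed

lemma gcomp_gclass:
  assumes "u \<in> moderate_vec" "v \<in> moderate_vec" "c_bounded v"
  shows "gcomp (gclass u) (gclass v) = gclass (\<lambda>e. u e \<circ> v e)"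
proof -
  have ne: "gclass u \<noteq> {}" "gclass v \<noteq> {}"
    using assms mem_gclass_iff[of u u] mem_gclass_iff[of v v]
    by (auto simp: colombeau_rel_iff negligible_net_zero)
  have eq: "gclass (\<lambda>e. u' e \<circ> v' e) = gclass (\<lambda>e. u e \<circ> v e)"
    if "u' \<in> gclass u" "v' \<in> gclass v" for u' v'
    using that assms(3) by (intro gclass_eqI[OF colombeau_rel_comp, symmetric]) (simp_all add: mem_gclass_iff)
  have "gcomp (gclass u) (gclass v) = (\<Union>u'\<in>gclass u. \<Union>v'\<in>gclass v. gclass (\<lambda>e. u e \<circ> v e))"
    unfolding gcomp_def by (intro SUP_cong refl eq)
  then show ?thesis using ne by simp
qed

lemma locally_bounded_comp:
  fixes u :: "real \<Rightarrow> 'k \<Rightarrow> 'b::euclidean_space \<Rightarrow> 'c::euclidean_space"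
    and v :: "real \<Rightarrow> 'k \<Rightarrow> 'a::euclidean_space \<Rightarrow> 'b"
  assumes "locally_bounded u" "locally_bounded v"
  shows "locally_bounded (\<lambda>e k x. u e k (v e k x))"
  unfolding locally_bounded_def
proof (intro allI impI)
  fix K :: "'a set" assume "compact K"
  then obtain R where R: "\<forall>\<^sub>F e in at_right 0. \<forall>k. \<forall>x\<in>K. norm (v e k x) \<le> R"
    using assms(2) unfolding locally_bounded_def by blast
  obtain R' where "\<forall>\<^sub>F e in at_right 0. \<forall>k. \<forall>x\<in>cball 0 R. norm (u e k x) \<le> R'"
    using assms(1) compact_cball unfolding locally_bounded_def by blast
  with R have "\<forall>\<^sub>F e in at_right 0. \<forall>k. \<forall>x\<in>K. norm (u e k (v e k x)) \<le> R'"
    by eventually_elim simp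
  then show "\<exists>R. \<forall>\<^sub>F e in at_right 0. \<forall>k. \<forall>x\<in>K. norm (u e k (v e k x)) \<le> R" by blast
qed

lemma locally_bounded_Pair:
  fixes u :: "real \<Rightarrow> 'k \<Rightarrow> 'a::euclidean_space \<Rightarrow> 'b::euclidean_space"
    and v :: "real \<Rightarrow> 'k \<Rightarrow> 'a \<Rightarrow> 'c::euclidean_space"
  assumes "locally_bounded u" "locally_bounded v"
  shows "locally_bounded (\<lambda>e k x. (u e k x, v e k x))"
  unfolding locally_bounded_def
proof (intro allI impI)
  fix K :: "'a set" assume K: "compact K"
  obtain R where R: "\<forall>\<^sub>F e in at_right 0. \<forall>k. \<forall>x\<in>K. norm (u e k x) \<le> R"
    using assms(1) K unfolding locally_bounded_def by blast
  obtain R' where R': "\<forall>\<^sub>F e in at_right 0. \<forall>k. \<forall>x\<in>K. norm (v e k x) \<le> R'"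
    using assms(2) K unfolding locally_bounded_def by blast
  have "\<forall>\<^sub>F e in at_right 0. \<forall>k. \<forall>x\<in>K. norm (u e k x, v e k x) \<le> R + R'"
    using R R'
  proof eventually_elim
    case (elim e)
    have "norm (u e k x, v e k x) \<le> R + R'" if "x \<in> K" for k x
    proof -
      have "norm (u e k x) \<le> R" "norm (v e k x) \<le> R'" using elim that by auto
      then show ?thesis using norm_Pair_le[of "u e k x" "v e k x"] by linarith
    qed
    then show ?case by blast
  qed
  then show "\<exists>R. \<forall>\<^sub>F e in at_right 0. \<forall>k. \<forall>x\<in>K. norm (u e k x, v e k x) \<le> R" by blast
qed

lemma moderate_upto_Pair:
  fixes u :: "real \<Rightarrow> 'k \<Rightarrow> 'a::euclidean_space \<Rightarrow> 'b::euclidean_space"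
    and v :: "real \<Rightarrow> 'k \<Rightarrow> 'a \<Rightarrow> 'c::euclidean_space"
  assumes "moderate_upto m u" "moderate_upto m v"
  shows "moderate_upto m (\<lambda>e k x. (u e k x, v e k x))"
proof -
  have lin: "bounded_linear (\<lambda>y::'b. (y, 0::'c))" "bounded_linear (\<lambda>y::'c. (0::'b, y))"
    by (intro bounded_linear_Pair bounded_linear_ident bounded_linear_zero)+
  show ?thesis
    using moderate_upto_add[OF moderate_upto_linear_comp[OF lin(1) assms(1)]
        moderate_upto_linear_comp[OF lin(2) assms(2)]] by simp
qed

lemma colombeau_rel_cong:
  assumes "u \<in> moderate_vec" "\<And>e x. e \<in> {0<..1} \<Longrightarrow> u e x = v e x"
  shows "(u, v) \<in> colombeau_rel"
proof -
  have "v \<in> moderate_vec"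
    using assms unfolding moderate_vec_iff by (blast intro: moderate_upto_cong)
  moreover have "negligible_net (\<lambda>e x. u e x - v e x)"
    using negligible_net_zero by (rule negligible_net_cong) (simp add: assms(2))
  ultimately show ?thesis using assms(1) by (simp add: colombeau_rel_iff)
qed

lemma colombeau_rel_trans:
  "(u, v) \<in> colombeau_rel \<Longrightarrow> (v, w) \<in> colombeau_rel \<Longrightarrow> (u, w) \<in> colombeau_rel"
  using equiv_colombeau_rel by (meson equivE transD)

text \<open>Derivatives descend to classes because the estimate for negligible derivatives applies
  to the difference of two representatives, which is negligible at order zero and moderate at all
  orders.\<close>

lemma colombeau_rel_frechet_derivative:
  fixes u v :: "real \<Rightarrow> 'a::euclidean_space \<Rightarrow> 'b::euclidean_space"
  assumes uv: "(u, v) \<in> colombeau_rel" and b: "b \<in> Basis"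
  shows "((\<lambda>e x. frechet_derivative (u e) (at x) b), (\<lambda>e x. frechet_derivative (v e) (at x) b)) \<in> colombeau_rel"
proof -
  note m = uv[unfolded colombeau_rel_iff]
  have u: "moderate_upto m (\<lambda>e (_::unit). u e)" and v: "moderate_upto m (\<lambda>e (_::unit). v e)" for m
    using m moderate_vecD by blast+
  have "negligible_net (\<lambda>e x. frechet_derivative (\<lambda>x. u e x - v e x) (at x) b)"
    by (rule negligible_net_derivative[OF moderate_upto_diff[OF u v] _ b]) (use m in simp)
  moreover have "frechet_derivative (\<lambda>x. u e x - v e x) (at x) b =
      frechet_derivative (u e) (at x) b - frechet_derivative (v e) (at x) b" if "e \<in> {0<..1}" for e x
    using frechet_derivative_at[OF has_derivative_diff[OF moderate_upto_has_derivative[OF u that]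
          moderate_upto_has_derivative[OF v that]], of x] by (simp add: fun_eq_iff)
  ultimately have "negligible_net (\<lambda>e x. frechet_derivative (u e) (at x) b - frechet_derivative (v e) (at x) b)"
    by (rule negligible_net_cong)
  moreover have "moderate_upto m (\<lambda>e (_::unit) x. frechet_derivative (u e) (at x) b)"
    "moderate_upto m (\<lambda>e (_::unit) x. frechet_derivative (v e) (at x) b)" for m
    using moderate_upto_derivative[OF u b] moderate_upto_derivative[OF v b] by blast+
  ultimately show ?thesis by (simp add: colombeau_rel_iff moderate_vec_iff)
qed

section \<open>Time derivative, restriction, time shift and iteration of classes\<close>

lemma moderate_vec_has_derivative:
  assumes "u \<in> moderate_vec" "e \<in> {0<..1}"
  shows "(u e has_derivative frechet_derivative (u e) (at x)) (at x)"
  using moderate_upto_has_derivative[OF moderate_vecD[OF assms(1)] assms(2)] .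

lemma moderate_vec_has_time_derivative:
  fixes \<phi> :: "real \<Rightarrow> real \<times> 'a::euclidean_space \<Rightarrow> 'b::euclidean_space"
  assumes "\<phi> \<in> moderate_vec" "e \<in> {0<..1}"
  shows "((\<lambda>\<tau>. \<phi> e (\<tau>, x)) has_vector_derivative frechet_derivative (\<phi> e) (at (t, x)) (1, 0)) (at t)"
proof -
  note D = moderate_vec_has_derivative[OF assms, of "(t, x)"]
  have "((\<lambda>\<tau>. (\<tau>, x)) has_derivative (\<lambda>h. (h, 0))) (at t)"
    by (auto intro!: derivative_eq_intros)
  from has_derivative_compose[OF this D]
  have 1: "((\<lambda>\<tau>. \<phi> e (\<tau>, x)) has_derivative (\<lambda>h. frechet_derivative (\<phi> e) (at (t, x)) (h, 0))) (at t)" .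
  have 2: "(\<lambda>h. frechet_derivative (\<phi> e) (at (t, x)) (h, 0)) =
      (\<lambda>h. h *\<^sub>R frechet_derivative (\<phi> e) (at (t, x)) (1, 0))"
  proof
    show "frechet_derivative (\<phi> e) (at (t, x)) (h, 0) = h *\<^sub>R frechet_derivative (\<phi> e) (at (t, x)) (1, 0)" for h
      using linear_scale[OF has_derivative_linear[OF D], of h "(1, 0)"] by simp
  qed
  show ?thesis unfolding has_vector_derivative_def using 1 unfolding 2 .
qed

lemma ddt_gclass:
  fixes \<phi> :: "(real \<times> (real^'n), real^'n) fnet"
  assumes \<phi>: "\<phi> \<in> moderate_vec"
  shows "ddt (gclass \<phi>) = gclass (\<lambda>e z. frechet_derivative (\<phi> e) (at z) (1, 0))"
  unfolding ddt_def
proof (rule gmap_gclass[OF \<phi>])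
  fix \<psi> :: "(real \<times> (real^'n), real^'n) fnet" assume rel: "(\<phi>, \<psi>) \<in> colombeau_rel"
  have b: "(1, 0) \<in> (Basis :: (real \<times> (real^'n)) set)" by (simp add: Basis_prod_def)
  note r = colombeau_rel_frechet_derivative[OF rel b]
  have \<psi>: "\<psi> \<in> moderate_vec" using rel by (simp add: colombeau_rel_iff)
  show "((\<lambda>e z. frechet_derivative (\<phi> e) (at z) (1, 0)),
      (\<lambda>e (t, x). vector_derivative (\<lambda>\<tau>. \<psi> e (\<tau>, x)) (at t))) \<in> colombeau_rel"
  proof (rule colombeau_rel_trans[OF r colombeau_rel_cong])
    show "(\<lambda>e z. frechet_derivative (\<psi> e) (at z) (1, 0)) \<in> moderate_vec"
      using r by (simp add: colombeau_rel_iff)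
    show "frechet_derivative (\<psi> e) (at z) (1, 0) =
        (case z of (t, x) \<Rightarrow> vector_derivative (\<lambda>\<tau>. \<psi> e (\<tau>, x)) (at t))" if "e \<in> {0<..1}" for e z
      using vector_derivative_at[OF moderate_vec_has_time_derivative[OF \<psi> that]]
      by (simp add: case_prod_beta)
  qed
qed

text \<open>A fixed linear map is a moderate c-bounded net, so substituting it is a case of
  composition. Both the restriction to time 0 and the passage to t + s are of this form.\<close>

lemma gmap_comp_linear:
  fixes u :: "('b::euclidean_space, 'c::euclidean_space) fnet" and A :: "'a::euclidean_space \<Rightarrow> 'b"
  assumes A: "bounded_linear A" and u: "u \<in> moderate_vec"
    and T: "\<And>v e x. T v e x = v e (A x)"
  shows "gmap T (gclass u) = gclass (\<lambda>e x. u e (A x))"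
proof (rule gmap_gclass[OF u])
  fix v assume rel: "(u, v) \<in> colombeau_rel"
  have "(\<lambda>e. A) \<in> moderate_vec" unfolding moderate_vec_iff using moderate_upto_linear[OF A] by blast
  then have AA: "((\<lambda>e. A), (\<lambda>e. A)) \<in> colombeau_rel" by (rule colombeau_rel_cong) simp
  have "c_bounded (\<lambda>e. A)"
    unfolding c_bounded_iff by (rule locally_bounded_const[OF linear_continuous_on[OF A]])
  from colombeau_rel_comp[OF rel AA this]
  have "((\<lambda>e. u e \<circ> A), (\<lambda>e. v e \<circ> A)) \<in> colombeau_rel" .
  moreover have "T v = (\<lambda>e. v e \<circ> A)" by (simp add: T fun_eq_iff)
  moreover have "(\<lambda>e x. u e (A x)) = (\<lambda>e. u e \<circ> A)" by (simp add: fun_eq_iff)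
  ultimately show "((\<lambda>e x. u e (A x)), T v) \<in> colombeau_rel" by simp
qed

lemma at_time_0_gclass: "\<phi> \<in> moderate_vec \<Longrightarrow> at_time_0 (gclass \<phi>) = gclass (\<lambda>e x. \<phi> e (0, x))"
  unfolding at_time_0_def
  by (rule gmap_comp_linear)
    (auto intro!: bounded_linear_Pair bounded_linear_zero bounded_linear_ident)

lemma bounded_linear_time_sum:
  "bounded_linear (\<lambda>z::real \<times> real \<times> 'a::euclidean_space. (fst z + fst (snd z), snd (snd z)))"
  by (intro bounded_linear_Pair bounded_linear_add bounded_linear_fst bounded_linear_fst_comp
      bounded_linear_snd_comp bounded_linear_snd)

lemma flow_sum_gclass:
  "\<phi> \<in> moderate_vec \<Longrightarrow>
    flow_sum (gclass \<phi>) = gclass (\<lambda>e z. \<phi> e (fst z + fst (snd z), snd (snd z)))"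
  unfolding flow_sum_def
  by (rule gmap_comp_linear[OF bounded_linear_time_sum]) (auto simp: case_prod_beta)

lemma flow_iterate_gclass:
  fixes \<phi> :: "(real \<times> (real^'n), real^'n) fnet"
  assumes \<phi>: "\<phi> \<in> moderate_vec" and b: "c_bounded \<phi>"
  shows "flow_iterate (gclass \<phi>) = gclass (\<lambda>e z. \<phi> e (fst z, \<phi> e (snd z)))"
    and "(\<lambda>e z::real \<times> real \<times> (real^'n). \<phi> e (fst z, \<phi> e (snd z))) \<in> moderate_vec"
    and "c_bounded (\<lambda>e z::real \<times> real \<times> (real^'n). (fst z, \<phi> e (snd z)))"
proof -
  have snd_comp: "moderate_upto m (\<lambda>e (_::unit) z::real \<times> real \<times> (real^'n). \<psi> e (snd z))" if "\<psi> \<in> moderate_vec"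
    for m and \<psi> :: "(real \<times> (real^'n), real^'n) fnet"
    using moderate_upto_comp[OF locally_bounded_const[OF linear_continuous_on[OF bounded_linear_snd]]
        moderate_vecD[OF that] moderate_upto_linear[OF bounded_linear_snd]] .
  have mod: "(\<lambda>e z::real \<times> real \<times> (real^'n). (fst z, \<psi> e (snd z))) \<in> moderate_vec" if "\<psi> \<in> moderate_vec"
    for \<psi> :: "(real \<times> (real^'n), real^'n) fnet"
    unfolding moderate_vec_iff
    using moderate_upto_Pair[OF moderate_upto_linear[OF bounded_linear_fst] snd_comp[OF that]] by blast
  have "locally_bounded (\<lambda>e (_::unit) z::real \<times> real \<times> (real^'n). \<phi> e (snd z))"
    using locally_bounded_comp[OF b[unfolded c_bounded_iff]
        locally_bounded_const[OF linear_continuous_on[OF bounded_linear_snd]]] .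
  from locally_bounded_Pair[OF locally_bounded_const[OF linear_continuous_on[OF bounded_linear_fst]] this]
  show cb: "c_bounded (\<lambda>e z::real \<times> real \<times> (real^'n). (fst z, \<phi> e (snd z)))" unfolding c_bounded_iff .
  have "gmap (\<lambda>\<phi> e (t::real, s, x). (t, \<phi> e (s, x))) (gclass \<phi>) = gclass (\<lambda>e z. (fst z, \<phi> e (snd z)))"
  proof (rule gmap_gclass[OF \<phi>])
    fix \<psi> :: "(real \<times> (real^'n), real^'n) fnet" assume rel: "(\<phi>, \<psi>) \<in> colombeau_rel"
    then have \<psi>: "\<psi> \<in> moderate_vec" by (simp add: colombeau_rel_iff)
    have "negligible_net (\<lambda>e z::real \<times> real \<times> (real^'n). \<phi> e (snd z) - \<psi> e (snd z))"
      using negligible_net_comp[of "\<lambda>e x. \<phi> e x - \<psi> e x" "\<lambda>e. snd"] rel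
        locally_bounded_const[OF linear_continuous_on[OF bounded_linear_snd]]
      by (simp add: colombeau_rel_iff)
    then have neg: "negligible_net (\<lambda>e z::real \<times> real \<times> (real^'n). (fst z, \<phi> e (snd z)) - (fst z, \<psi> e (snd z)))"
      unfolding negligible_net_def by (simp add: norm_Pair)
    have eq: "(\<lambda>e (t, s, x). (t, \<psi> e (s, x))) = (\<lambda>e z::real \<times> real \<times> (real^'n). (fst z, \<psi> e (snd z)))"
      by (simp add: fun_eq_iff)
    show "((\<lambda>e z. (fst z, \<phi> e (snd z))), (\<lambda>e (t::real, s, x). (t, \<psi> e (s, x)))) \<in> colombeau_rel"
      unfolding eq colombeau_rel_iff using neg by (intro conjI mod \<phi> \<psi>)
  qed
  then show "flow_iterate (gclass \<phi>) = gclass (\<lambda>e z. \<phi> e (fst z, \<phi> e (snd z)))"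
    unfolding flow_iterate_def using gcomp_gclass[OF \<phi> mod[OF \<phi>] cb] by (simp add: comp_def)
  show "(\<lambda>e z. \<phi> e (fst z, \<phi> e (snd z))) \<in> moderate_vec"
    using moderate_vec_comp[OF \<phi> mod[OF \<phi>] cb] by (simp add: comp_def)
qed

section \<open>The generalized flow\<close>

text \<open>Stated as an equivalence so that flows constructed from different representatives of F
  can be identified with one and the same class.\<close>

lemma is_generalized_flow_iff:
  fixes f :: "real \<Rightarrow> real^'n \<Rightarrow> real^'n"
  assumes "picard f C"
  shows "is_generalized_flow (gclass f) \<Phi> \<longleftrightarrow> \<Phi> = gclass (picard.flow f)"
proof -
  interpret picard f C by fact
  have f_mod: "f \<in> moderate_vec" unfolding moderate_vec_iff using f by blast
  have flow_mod: "flow \<in> moderate_vec" unfolding moderate_vec_iff using moderate_upto_flow by blast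
  have flow_cb: "c_bounded flow" unfolding c_bounded_iff by (rule flow_locally_bounded)
  define flow' where "flow' e z = f e (iterate e (steps e) z)" for e z
  have flow': "((\<lambda>\<tau>. flow e (\<tau>, x)) has_vector_derivative flow' e (t, x)) (at t)"
    if "e \<in> {0<..1}" for e t x
    unfolding flow'_def using flow_has_vector_derivative[OF that] .
  have residual: "negligible_net (\<lambda>e z. flow' e z - f e (flow e z))"
    unfolding flow'_def by (rule flow_residual_negligible)
  have ddt_mod: "(\<lambda>e z. frechet_derivative (\<phi> e) (at z) (1, 0)) \<in> moderate_vec"
    if "\<phi> \<in> moderate_vec" for \<phi> :: "(real \<times> (real^'n), real^'n) fnet"
    unfolding moderate_vec_iff
    using moderate_upto_derivative[OF moderate_vecD[OF that], of "(1, 0)"] by (simp add: Basis_prod_def)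
  have at_0_mod: "(\<lambda>e x. \<phi> e (0, x)) \<in> moderate_vec"
    if "\<phi> \<in> moderate_vec" for \<phi> :: "(real \<times> (real^'n), real^'n) fnet"
  proof -
    have "bounded_linear (\<lambda>x::real^'n. (0::real, x))"
      by (intro bounded_linear_Pair bounded_linear_zero bounded_linear_ident)
    from moderate_upto_comp[OF locally_bounded_const[OF linear_continuous_on[OF this]]
        moderate_vecD[OF that] moderate_upto_linear[OF this]]
    show ?thesis unfolding moderate_vec_iff by blast
  qed
  have id_mod: "(\<lambda>e x::real^'n. x) \<in> moderate_vec"
    unfolding moderate_vec_iff using moderate_upto_linear[OF bounded_linear_ident] by blast
  have ddt_eq_iff: "ddt (gclass \<phi>) = gcomp (gclass f) (gclass \<phi>) \<longleftrightarrow>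
      negligible_net (\<lambda>e z. frechet_derivative (\<phi> e) (at z) (1, 0) - f e (\<phi> e z))"
    if "\<phi> \<in> moderate_vec" "c_bounded \<phi>" for \<phi>
    using gclass_eq_iff[OF ddt_mod[OF that(1)] moderate_vec_comp[OF f_mod that]]
    by (simp add: ddt_gclass[OF that(1)] gcomp_gclass[OF f_mod that] comp_def)
  have at_0_eq_iff: "at_time_0 (gclass \<phi>) = gclass (\<lambda>e x. x) \<longleftrightarrow>
      negligible_net (\<lambda>e x. \<phi> e (0, x) - x)" if "\<phi> \<in> moderate_vec"
    for \<phi> :: "(real \<times> (real^'n), real^'n) fnet"
    unfolding at_time_0_gclass[OF that] gclass_eq_iff[OF at_0_mod[OF that] id_mod] ..
  have sum_bounded: "locally_bounded (\<lambda>e (_::unit) z::real \<times> real \<times> (real^'n). (fst z + fst (snd z), snd (snd z)))"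
    by (rule locally_bounded_const[OF linear_continuous_on[OF bounded_linear_time_sum]])
  have "flow_sum (gclass flow) = flow_iterate (gclass flow)"
  proof -
    have "(\<lambda>e z. flow e (fst z + fst (snd z), snd (snd z))) \<in> moderate_vec"
      unfolding moderate_vec_iff
      using moderate_upto_comp[OF sum_bounded moderate_vecD[OF flow_mod]
          moderate_upto_linear[OF bounded_linear_time_sum]] by blast
    \<comment> \<open>For the fixed parameter (s, x), both sides solve the equation in t up to a
      negligible residual, the left one by time translation. At t = 0 both are exactly
      \<open>flow e (s, x)\<close>.\<close>
    moreover have "negligible_net (\<lambda>e z. flow e (fst z + fst (snd z), snd (snd z)) - flow e (fst z, flow e (snd z)))"
    proof (rule approximate_flows_negligible)
      show "locally_bounded (\<lambda>e (_::unit) z. flow e (fst z + fst (snd z), snd (snd z)))"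
        by (rule locally_bounded_comp[OF flow_locally_bounded sum_bounded])
      note iterate_bounded = flow_iterate_gclass(3)[OF flow_mod flow_cb, unfolded c_bounded_iff]
      show "locally_bounded (\<lambda>e (_::unit) z. flow e (fst z, flow e (snd z)))"
        by (rule locally_bounded_comp[OF flow_locally_bounded iterate_bounded])
      show "negligible_net (\<lambda>e w. flow' e (fst w + fst (snd w), snd (snd w)) -
          f e (flow e (fst w + fst (snd w), snd (snd w))))"
        by (rule negligible_net_comp[OF residual sum_bounded])
      show "negligible_net (\<lambda>e w. flow' e (fst w, flow e (snd w)) - f e (flow e (fst w, flow e (snd w))))"
        by (rule negligible_net_comp[OF residual iterate_bounded])
      show "((\<lambda>\<tau>. flow e (fst (\<tau>, p) + fst (snd (\<tau>, p)), snd (snd (\<tau>, p)))) has_vector_derivative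
          flow' e (fst (t, p) + fst (snd (t, p)), snd (snd (t, p)))) (at t)"
        if e: "e \<in> {0<..1}" for e t p
      proof -
        have "((\<lambda>\<tau>. \<tau> + fst p) has_vector_derivative 1) (at t)"
          by (auto intro!: derivative_eq_intros)
        from vector_diff_chain_at[OF this flow'[OF e]] show ?thesis by (simp add: comp_def)
      qed
      show "((\<lambda>\<tau>. flow e (fst (\<tau>, p), flow e (snd (\<tau>, p)))) has_vector_derivative
          flow' e (fst (t, p), flow e (snd (t, p)))) (at t)" if e: "e \<in> {0<..1}" for e t p
        using flow'[OF e] by simp
      show "negligible_net (\<lambda>e p. flow e (fst (0, p) + fst (snd (0, p)), snd (snd (0, p))) -
          flow e (fst (0, p), flow e (snd (0, p))))"
        using negligible_net_zero by (simp add: flow_at_time_0)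
    qed
    ultimately show ?thesis
      unfolding flow_sum_gclass[OF flow_mod] flow_iterate_gclass(1)[OF flow_mod flow_cb]
      by (simp add: gclass_eq_iff flow_iterate_gclass(2)[OF flow_mod flow_cb])
  qed
  moreover have "ddt (gclass flow) = gcomp (gclass f) (gclass flow)"
    unfolding ddt_eq_iff[OF flow_mod flow_cb]
  proof (rule negligible_net_cong[OF residual])
    fix e :: real and z :: "real \<times> (real^'n)" assume e: "e \<in> {0<..1}"
    show "flow' e z - f e (flow e z) = frechet_derivative (flow e) (at z) (1, 0) - f e (flow e z)"
      using vector_derivative_unique_at[OF flow'[OF e, of "snd z" "fst z"]
          moderate_vec_has_time_derivative[OF flow_mod e]] by simp
  qed
  moreover have "at_time_0 (gclass flow) = gclass (\<lambda>e x. x)"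
    unfolding at_0_eq_iff[OF flow_mod] using negligible_net_zero by (simp add: flow_at_time_0)
  ultimately have existence: "is_generalized_flow (gclass f) (gclass flow)"
    unfolding is_generalized_flow_def using gclass_in_colombeau_cb[OF flow_mod flow_cb] by blast
  have uniqueness: "\<Phi> = gclass flow" if \<Phi>: "is_generalized_flow (gclass f) \<Phi>"
  proof -
    obtain \<psi> where \<psi>: "\<psi> \<in> moderate_vec" "c_bounded \<psi>" "\<Phi> = gclass \<psi>"
      using \<Phi> unfolding is_generalized_flow_def by (blast elim: colombeau_cbE)
    \<comment> \<open>For c-bounded nets, the equations between classes say precisely that the
      residual and the error in the initial value of \<psi> are negligible, which is what the
      Gronwall comparison asks for.\<close>
    have "negligible_net (\<lambda>e z. \<psi> e z - flow e z)"
    proof (rule approximate_flows_negligible)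
      show "locally_bounded (\<lambda>e (_::unit). \<psi> e)" using \<psi>(2) by (simp add: c_bounded_iff)
      show "locally_bounded (\<lambda>e (_::unit). flow e)" by (rule flow_locally_bounded)
      show "((\<lambda>\<tau>. \<psi> e (\<tau>, p)) has_vector_derivative frechet_derivative (\<psi> e) (at (t, p)) (1, 0)) (at t)"
        if "e \<in> {0<..1}" for e t p
        by (rule moderate_vec_has_time_derivative[OF \<psi>(1) that])
      show "negligible_net (\<lambda>e w. frechet_derivative (\<psi> e) (at w) (1, 0) - f e (\<psi> e w))"
        using \<Phi> ddt_eq_iff[OF \<psi>(1,2)] unfolding is_generalized_flow_def \<psi>(3) by blast
      show "negligible_net (\<lambda>e w. flow' e w - f e (flow e w))" by (rule residual)
      show "((\<lambda>\<tau>. flow e (\<tau>, p)) has_vector_derivative flow' e (t, p)) (at t)"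
        if "e \<in> {0<..1}" for e t p
        by (rule flow'[OF that])
      show "negligible_net (\<lambda>e p. \<psi> e (0, p) - flow e (0, p))"
        using \<Phi> at_0_eq_iff[OF \<psi>(1)] unfolding is_generalized_flow_def \<psi>(3) flow_at_time_0 by blast
    qed
    then show ?thesis using \<psi> flow_mod by (simp add: gclass_eq_iff)
  qed
  show ?thesis using existence uniqueness by blast
qed

section \<open>C-boundedness of the derivatives of the flow\<close>

lemma ddt_flow_c_bounded:
  fixes f :: "real \<Rightarrow> real^'n \<Rightarrow> real^'n"
  assumes "picard f C"
  shows "c_bounded_gfun (ddt (gclass (picard.flow f)))"
proof -
  interpret picard f C by fact
  have f_mod: "f \<in> moderate_vec" unfolding moderate_vec_iff using f by blast
  have flow_mod: "flow \<in> moderate_vec" unfolding moderate_vec_iff using moderate_upto_flow by blast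
  have flow_cb: "c_bounded flow" unfolding c_bounded_iff by (rule flow_locally_bounded)
  have "ddt (gclass flow) = gcomp (gclass f) (gclass flow)"
    using is_generalized_flow_iff[OF assms, of "gclass flow"] unfolding is_generalized_flow_def by blast
  moreover have "c_bounded (\<lambda>e. f e \<circ> flow e)"
    unfolding c_bounded_iff comp_def by (rule f_comp_locally_bounded[OF flow_locally_bounded])
  ultimately show ?thesis
    using c_bounded_gfun_gclass[OF moderate_vec_comp[OF f_mod flow_mod flow_cb]]
    by (simp add: gcomp_gclass[OF f_mod flow_mod flow_cb])
qed

text \<open>The matrix is read off the full derivative in the directions (0, axis j 1), so that
  every entry is a component of a directional derivative and inherits moderateness and
  negligibility. It agrees with the Jacobian in x on (0, 1].\<close>

definition space_gradient :: "(real \<times> (real^'n), real^'n) fnet \<Rightarrow> (real \<times> (real^'n), real^'n^'n) fnet" where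
  "space_gradient \<phi> e z = (\<chi> i j. frechet_derivative (\<phi> e) (at z) (0, axis j 1) $ i)"

lemma jacobian_nth: "jacobian g (at x) $ i $ j = frechet_derivative g (at x) (axis j 1) $ i"
  by (simp add: jacobian_def matrix_def)

lemma matrix_Basis_cases:
  fixes b :: "real^'n^'m"
  assumes "b \<in> Basis"
  obtains i j where "b = axis i (axis j 1)"
  using assms by (auto simp: Basis_vec_def)

lemma space_axis_in_Basis: "(0, axis j 1) \<in> (Basis :: (real \<times> (real^'n)) set)"
  by (rule Basis_space) (simp add: axis_in_Basis_iff)

lemma space_gradient_inner:
  "space_gradient \<phi> e z \<bullet> axis i (axis j 1) = frechet_derivative (\<phi> e) (at z) (0, axis j 1) \<bullet> axis i 1"
  by (simp add: space_gradient_def inner_axis)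

lemma space_gradient_moderate:
  assumes \<phi>: "\<phi> \<in> moderate_vec"
  shows "space_gradient \<phi> \<in> moderate_vec"
proof -
  have "moderate_upto m (\<lambda>e (_::unit) z. space_gradient \<phi> e z \<bullet> b)" if "b \<in> Basis" for m b
    using that
  proof (cases rule: matrix_Basis_cases)
    case (1 i j)
    show ?thesis unfolding 1 space_gradient_inner
      by (rule moderate_upto_linear_comp[OF bounded_linear_inner_left
            moderate_upto_derivative[OF moderate_vecD[OF \<phi>] space_axis_in_Basis]])
  qed
  then show ?thesis
    unfolding moderate_vec_iff moderate_upto_componentwise[where u="\<lambda>e _. space_gradient \<phi> e"] by blast
qed

lemma grad_x_gclass:
  fixes \<phi> :: "(real \<times> (real^'n), real^'n) fnet"
  assumes \<phi>: "\<phi> \<in> moderate_vec"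
  shows "grad_x (gclass \<phi>) = gclass (space_gradient \<phi>)"
  unfolding grad_x_def
proof (rule gmap_gclass[OF \<phi>])
  fix \<psi> :: "(real \<times> (real^'n), real^'n) fnet" assume rel: "(\<phi>, \<psi>) \<in> colombeau_rel"
  then have \<psi>: "\<psi> \<in> moderate_vec" by (simp add: colombeau_rel_iff)
  have "negligible_net (\<lambda>e z. (space_gradient \<phi> e z - space_gradient \<psi> e z) \<bullet> b)" if "b \<in> Basis" for b
    using that
  proof (cases rule: matrix_Basis_cases)
    case (1 i j)
    have neg: "negligible_net (\<lambda>e z. frechet_derivative (\<phi> e) (at z) (0, axis j 1) - frechet_derivative (\<psi> e) (at z) (0, axis j 1))"
      using colombeau_rel_frechet_derivative[OF rel space_axis_in_Basis] unfolding colombeau_rel_iff by blast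
    have "(axis i 1 :: real^'n) \<in> Basis" by (simp add: axis_in_Basis_iff)
    from bspec[OF iffD1[OF negligible_net_componentwise neg] this]
    show ?thesis unfolding 1 inner_diff_left space_gradient_inner .
  qed
  then have "negligible_net (\<lambda>e z. space_gradient \<phi> e z - space_gradient \<psi> e z)"
    unfolding negligible_net_componentwise[of "\<lambda>e z. space_gradient \<phi> e z - space_gradient \<psi> e z"] by blast
  then have "(space_gradient \<phi>, space_gradient \<psi>) \<in> colombeau_rel"
    by (simp add: colombeau_rel_iff space_gradient_moderate \<phi> \<psi>)
  then show "(space_gradient \<phi>, (\<lambda>e (t, x). jacobian (\<lambda>y. \<psi> e (t, y)) (at x))) \<in> colombeau_rel"
  proof (rule colombeau_rel_trans[OF _ colombeau_rel_cong[OF space_gradient_moderate[OF \<psi>]]])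
    fix e :: real and z :: "real \<times> (real^'n)" assume e: "e \<in> {0<..1}"
    obtain t x where z: "z = (t, x)" by (cases z)
    have "((\<lambda>y. (t, y)) has_derivative (\<lambda>h. (0, h))) (at x)"
      by (auto intro!: derivative_eq_intros)
    from has_derivative_compose[OF this moderate_vec_has_derivative[OF \<psi> e]]
    have "frechet_derivative (\<lambda>y. \<psi> e (t, y)) (at x) = (\<lambda>h. frechet_derivative (\<psi> e) (at z) (0, h))"
      unfolding z by (rule frechet_derivative_at[symmetric])
    then show "space_gradient \<psi> e z = (case z of (t, x) \<Rightarrow> jacobian (\<lambda>y. \<psi> e (t, y)) (at x))"
      by (simp add: vec_eq_iff space_gradient_def jacobian_nth z)
  qed
qed

lemma grad_x_flow_c_bounded:
  fixes f :: "real \<Rightarrow> real^'n \<Rightarrow> real^'n"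
  assumes "picard f C"
    and M: "M \<ge> 0" "\<And>e x b. e \<in> {0<..1} \<Longrightarrow> b \<in> Basis \<Longrightarrow>
      norm (frechet_derivative (f e) (at x) b) \<le> M"
  shows "c_bounded_gfun (grad_x (gclass (picard.flow f)))"
proof -
  interpret picard f C by fact
  have flow_mod: "flow \<in> moderate_vec" unfolding moderate_vec_iff using moderate_upto_flow by blast
  have "c_bounded (space_gradient flow)"
    unfolding c_bounded_iff locally_bounded_def
  proof (intro allI impI)
    fix K :: "(real \<times> (real^'n)) set" assume K: "compact K"
    have "\<forall>j. \<exists>R. \<forall>\<^sub>F e in at_right 0. \<forall>z\<in>K. norm (frechet_derivative (flow e) (at z) (0, axis j 1)) \<le> R"
    proof
      fix j
      have "(axis j 1 :: real^'n) \<in> Basis" by (simp add: axis_in_Basis_iff)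
      from flow_gradient_locally_bounded[OF M this] K
      show "\<exists>R. \<forall>\<^sub>F e in at_right 0. \<forall>z\<in>K. norm (frechet_derivative (flow e) (at z) (0, axis j 1)) \<le> R"
        unfolding locally_bounded_def by simp
    qed
    from choice[OF this] obtain R where
      "\<forall>j. \<forall>\<^sub>F e in at_right 0. \<forall>z\<in>K. norm (frechet_derivative (flow e) (at z) (0, axis j 1)) \<le> R j" by blast
    then have "\<forall>\<^sub>F e in at_right 0. \<forall>j. \<forall>z\<in>K. norm (frechet_derivative (flow e) (at z) (0, axis j 1)) \<le> R j"
      by (simp add: eventually_all_finite)
    then have "\<forall>\<^sub>F e in at_right 0. \<forall>k::unit. \<forall>z\<in>K. norm (space_gradient flow e z) \<le> (\<Sum>i::'n\<in>UNIV. \<Sum>j\<in>UNIV. R j)"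
    proof eventually_elim
      case (elim e)
      have "norm (space_gradient flow e z) \<le> (\<Sum>i::'n\<in>UNIV. \<Sum>j\<in>UNIV. R j)" if z: "z \<in> K" for z
      proof -
        let ?A = "space_gradient flow e z"
        have "norm ?A \<le> (\<Sum>i\<in>UNIV. norm (?A $ i))"
          by (simp add: norm_vec_def L2_set_le_sum)
        also have "\<dots> \<le> (\<Sum>i\<in>UNIV. \<Sum>j\<in>UNIV. \<bar>?A $ i $ j\<bar>)"
          by (intro sum_mono norm_le_l1_cart)
        also have "\<dots> \<le> (\<Sum>i::'n\<in>UNIV. \<Sum>j\<in>UNIV. R j)"
        proof (intro sum_mono)
          fix i j :: 'n
          have "\<bar>?A $ i $ j\<bar> \<le> norm (frechet_derivative (flow e) (at z) (0, axis j 1))"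
            by (simp add: space_gradient_def component_le_norm_cart)
          also have "\<dots> \<le> R j" using elim z by blast
          finally show "\<bar>?A $ i $ j\<bar> \<le> R j" .
        qed
        finally show ?thesis .
      qed
      then show ?case by blast
    qed
    then show "\<exists>R. \<forall>\<^sub>F e in at_right 0. \<forall>k::unit. \<forall>z\<in>K. norm (space_gradient flow e z) \<le> R" by blast
  qed
  then show ?thesis
    unfolding grad_x_gclass[OF flow_mod]
    by (rule c_bounded_gfun_gclass[OF space_gradient_moderate[OF flow_mod]])
qed

section \<open>Choice of representatives\<close>

lemma locally_moderate_truncate:
  fixes u :: "real \<Rightarrow> 'k \<Rightarrow> 'a::euclidean_space \<Rightarrow> 'b::euclidean_space"
  assumes e0: "e0 > 0" and u: "locally_moderate u"
  shows "locally_moderate (\<lambda>e k x. if e < e0 then u e k x else 0)"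
proof (rule locally_moderateI)
  fix K :: "'a set" assume K: "compact K"
  obtain N where "\<forall>\<^sub>F e in at_right 0. \<forall>k. \<forall>x\<in>K. norm (u e k x) \<le> (1 / e) ^ N"
    using locally_moderateD[OF u K] .
  then have "\<forall>\<^sub>F e in at_right 0. \<forall>k. \<forall>x\<in>K. norm (if e < e0 then u e k x else 0) \<le> 1 * (1 / e) ^ N"
    using eventually_small[OF e0] by eventually_elim simp
  then show "\<exists>N c. \<forall>\<^sub>F e in at_right 0. \<forall>k. \<forall>x\<in>K. norm (if e < e0 then u e k x else 0) \<le> c * (1 / e) ^ N"
    by blast
qed

lemma moderate_upto_truncate:
  assumes e0: "e0 > 0"
  shows "moderate_upto m u \<Longrightarrow> moderate_upto m (\<lambda>e k x. if e < e0 then u e k x else 0)"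
proof (induction m arbitrary: u)
  case (0 u)
  have "continuous_on UNIV (\<lambda>x. if e < e0 then u e k x else 0)" if "e \<in> {0<..1}" for e k
    using 0 that by (cases "e < e0") simp_all
  then show ?case using 0 locally_moderate_truncate[OF e0, of u] by simp
next
  case (Suc m u)
  let ?D = "\<lambda>e k x b. if e < e0 then frechet_derivative (u e k) (at x) b else 0"
  show ?case
  proof (rule moderate_upto_SucI)
    show "locally_moderate (\<lambda>e k x. if e < e0 then u e k x else 0)"
      using Suc.prems by (intro locally_moderate_truncate[OF e0]) simp
    show "((\<lambda>x. if e < e0 then u e k x else 0) has_derivative ?D e k x) (at x)"
      if "e \<in> {0<..1}" for e k x
      using moderate_upto_has_derivative[OF Suc.prems that] by (cases "e < e0") simp_all
    show "moderate_upto m (\<lambda>e k x. ?D e k x b)" if "b \<in> Basis" for b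
      by (rule Suc.IH[OF moderate_upto_derivative[OF Suc.prems that]])
  qed
qed

text \<open>The cut is made in e and not in x: each member of the net is the old function or zero,
  so smoothness survives, and both nets coincide for e < e0.\<close>

lemma colombeau_rel_truncate:
  assumes u: "u \<in> moderate_vec" and e0: "e0 > 0"
  shows "(u, (\<lambda>e x. if e < e0 then u e x else 0)) \<in> colombeau_rel"
proof -
  have "(\<lambda>e x. if e < e0 then u e x else 0) \<in> moderate_vec"
    unfolding moderate_vec_iff using moderate_upto_truncate[OF e0 moderate_vecD[OF u]] by blast
  moreover have "negligible_net (\<lambda>e x. u e x - (if e < e0 then u e x else 0))"
    unfolding negligible_net_def
  proof (intro allI impI)
    fix K :: "'a set" and q :: nat
    show "\<forall>\<^sub>F e in at_right 0. \<forall>x\<in>K. norm (u e x - (if e < e0 then u e x else 0)) \<le> e ^ q"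
      using eventually_small[OF e0] by eventually_elim simp
  qed
  ultimately show ?thesis using u by (simp add: colombeau_rel_iff)
qed

lemma norm_frechet_derivative_le_jacobian:
  fixes g :: "real^'n \<Rightarrow> real^'m"
  assumes "b \<in> Basis"
  shows "norm (frechet_derivative g (at x) b) \<le> real CARD('m) * norm (jacobian g (at x))"
proof -
  obtain j where b: "b = axis j 1" using assms by (auto simp: Basis_vec_def)
  have "norm (frechet_derivative g (at x) b) \<le> (\<Sum>i\<in>UNIV. \<bar>jacobian g (at x) $ i $ j\<bar>)"
    unfolding b jacobian_nth by (rule norm_le_l1_cart)
  also have "\<dots> \<le> (\<Sum>i::'m\<in>UNIV. norm (jacobian g (at x)))"
  proof (rule sum_mono)
    fix i :: 'm
    have "\<bar>jacobian g (at x) $ i $ j\<bar> \<le> norm (jacobian g (at x) $ i)" by (rule component_le_norm_cart)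
    also have "\<dots> \<le> norm (jacobian g (at x))" by (rule Finite_Cartesian_Product.norm_nth_le)
    finally show "\<bar>jacobian g (at x) $ i $ j\<bar> \<le> norm (jacobian g (at x))" .
  qed
  finally show ?thesis by simp
qed

text \<open>Allows constants to be absorbed into \<open>\<bar>ln e\<bar>\<close>. An error of at
  most 1, or a gradient bounded independently of e, then satisfies a logarithmic bound.\<close>

lemma eventually_abs_ln_ge_1: "\<forall>\<^sub>F e in at_right 0. 1 \<le> \<bar>ln (e::real)\<bar>"
proof (rule eventually_mono[OF eventually_small[of "exp (- 1)"]])
  fix e :: real assume "0 < e \<and> e \<le> 1 \<and> e < exp (- 1)"
  then have "ln e < ln (exp (- 1))" by (subst ln_less_cancel_iff) auto
  then show "1 \<le> \<bar>ln e\<bar>" by simp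
qed simp

lemma log_bounded_negligible_diff:
  fixes u v :: "real \<Rightarrow> 'a::euclidean_space \<Rightarrow> 'b::euclidean_space"
  assumes "log_bounded (\<lambda>e (_::unit). u e)" "negligible_net (\<lambda>e x. u e x - v e x)"
  shows "log_bounded (\<lambda>e (_::unit). v e)"
  unfolding log_bounded_def
proof (intro allI impI)
  fix K :: "'a set" assume K: "compact K"
  then obtain L where L: "\<forall>\<^sub>F e in at_right 0. \<forall>k::unit. \<forall>x\<in>K. norm (u e x) \<le> L * \<bar>ln e\<bar>"
    using assms(1) unfolding log_bounded_def by blast
  have "\<forall>\<^sub>F e in at_right 0. \<forall>k::unit. \<forall>x\<in>K. norm (v e x) \<le> (L + 1) * \<bar>ln e\<bar>"
    using L negligible_netD[OF assms(2) K, of 0] eventually_abs_ln_ge_1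
  proof eventually_elim
    case (elim e)
    have "norm (v e x) \<le> (L + 1) * \<bar>ln e\<bar>" if "x \<in> K" for x
    proof -
      have "norm (u e x) \<le> L * \<bar>ln e\<bar>" "norm (u e x - v e x) \<le> 1" using elim(1,2) that by auto
      moreover have "(L + 1) * \<bar>ln e\<bar> = L * \<bar>ln e\<bar> + \<bar>ln e\<bar>" by (simp add: distrib_right)
      moreover have "norm (v e x) \<le> norm (u e x) + norm (u e x - v e x)"
        using norm_triangle_ineq4[of "u e x" "u e x - v e x"] by simp
      ultimately show ?thesis using elim(3) by linarith
    qed
    then show ?case by blast
  qed
  then show "\<exists>L. \<forall>\<^sub>F e in at_right 0. \<forall>k::unit. \<forall>x\<in>K. norm (v e x) \<le> L * \<bar>ln e\<bar>" by blast
qed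

text \<open>Makes the supremum in condition (ii) a supremum of a bounded set, so that pointwise
  bounds can be read off from it.\<close>

lemma continuous_on_norm_jacobian:
  fixes u :: "(real^'n, real^'m) fnet"
  assumes u: "u \<in> moderate_vec" and e: "e \<in> {0<..1}"
  shows "continuous_on K (\<lambda>x. norm (jacobian (u e) (at x)))"
proof -
  have "continuous_on K (\<lambda>x. frechet_derivative (u e) (at x) (axis j 1))" for j
  proof -
    have "(axis j 1 :: real^'n) \<in> Basis" by (simp add: axis_in_Basis_iff)
    from moderate_upto_continuous_on[OF moderate_upto_derivative[OF moderate_vecD[OF u] this] e]
    show ?thesis by (rule continuous_on_subset) simp
  qed
  then show ?thesis unfolding jacobian_def matrix_def by (intro continuous_intros)
qed

lemma log_bounded_frechet_derivative:
  fixes u :: "(real^'n, real^'m) fnet"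
  assumes u: "u \<in> moderate_vec" and b: "b \<in> Basis"
    and jac: "\<forall>K. compact K \<and> K \<noteq> {} \<longrightarrow>
      (\<lambda>e. SUP x\<in>K. norm (jacobian (u e) (at x))) \<in> O[at_right 0](\<lambda>e. \<bar>ln e\<bar>)"
  shows "log_bounded (\<lambda>e (_::unit) x. frechet_derivative (u e) (at x) b)"
  unfolding log_bounded_def
proof (intro allI impI)
  fix K :: "(real^'n) set" assume K: "compact K"
  show "\<exists>L. \<forall>\<^sub>F e in at_right 0. \<forall>k::unit. \<forall>x\<in>K. norm (frechet_derivative (u e) (at x) b) \<le> L * \<bar>ln e\<bar>"
  proof (cases "K = {}")
    case False
    have "\<exists>c. \<forall>\<^sub>F e in at_right 0. \<forall>x\<in>K. norm (jacobian (u e) (at x)) \<le> c * \<bar>\<bar>ln e\<bar>\<bar>"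
    proof (rule iffD1[OF SUP_bigo_iff])
      show "(\<lambda>e. SUP x\<in>K. norm (jacobian (u e) (at x))) \<in> O[at_right 0](\<lambda>e. \<bar>ln e\<bar>)"
        using jac K False by blast
    qed (use K False continuous_on_norm_jacobian[OF u] in auto)
    then obtain c where c: "\<forall>\<^sub>F e in at_right 0. \<forall>x\<in>K. norm (jacobian (u e) (at x)) \<le> c * \<bar>ln e\<bar>"
      by auto
    have "\<forall>\<^sub>F e in at_right 0. \<forall>k::unit. \<forall>x\<in>K.
        norm (frechet_derivative (u e) (at x) b) \<le> (real CARD('m) * c) * \<bar>ln e\<bar>"
      using c
    proof eventually_elim
      case (elim e)
      have "norm (frechet_derivative (u e) (at x) b) \<le> (real CARD('m) * c) * \<bar>ln e\<bar>" if "x \<in> K" for x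
      proof -
        have "norm (frechet_derivative (u e) (at x) b) \<le> real CARD('m) * norm (jacobian (u e) (at x))"
          using b by (rule norm_frechet_derivative_le_jacobian)
        also have "\<dots> \<le> real CARD('m) * (c * \<bar>ln e\<bar>)" using elim that by (intro mult_left_mono) auto
        finally show ?thesis by (simp add: mult.assoc)
      qed
      then show ?case by blast
    qed
    then show ?thesis by blast
  qed simp
qed

text \<open>
  The growth bound holds for small \<open>e\<close> only; replacing \<open>f e\<close> by \<open>0\<close> for the other \<open>e\<close> keeps the
  class and makes all Picard iterates globally controlled.
\<close>

lemma picard_of_linear_growth:
  fixes F :: "(real^'n, real^'n) gfun"
  assumes F: "F \<in> colombeau" "f \<in> F" "g \<in> F" and C: "C > 0" and e0: "e0 > 0"
    and growth: "\<forall>x. \<forall>e \<in> {0<..1}. e < e0 \<longrightarrow> norm (f e x) \<le> C * (1 + norm x)"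
    and log: "\<And>b. b \<in> Basis \<Longrightarrow> log_bounded (\<lambda>e (_::unit) x. frechet_derivative (g e) (at x) b)"
  defines "h \<equiv> \<lambda>e x. if e < e0 then f e x else 0"
  shows "picard h C" "F = gclass h"
proof -
  note f = colombeau_eq_gclass[OF F(1,2)]
  have fh: "(f, h) \<in> colombeau_rel" unfolding h_def by (rule colombeau_rel_truncate[OF f(2) e0])
  then show Fh: "F = gclass h" unfolding f(1) by (rule gclass_eqI)
  have h: "h \<in> moderate_vec" using fh by (simp add: colombeau_rel_iff)
  have "(h, g) \<in> colombeau_rel" using F(3) unfolding Fh mem_gclass_iff .
  then have gh: "(g, h) \<in> colombeau_rel"
    unfolding colombeau_rel_iff using negligible_net_diff_sym by blast
  show "picard h C"
  proof
    show "moderate_upto m (\<lambda>e (_::unit). h e)" for m using h by (rule moderate_vecD)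
    show "norm (h e x) \<le> C * (1 + norm x)" if "e \<in> {0<..1}" for e x
      unfolding h_def using growth that C by simp
    \<comment> \<open>The growth bound is inherited from f, but the logarithmic one is known for g.
      As g and h differ by a negligible net, so do their partial derivatives, and the bound carries
      over.\<close>
    show "log_bounded (\<lambda>e (_::unit) x. frechet_derivative (h e) (at x) b)" if "b \<in> Basis" for b
      using log_bounded_negligible_diff[OF log[OF that]]
        colombeau_rel_frechet_derivative[OF gh that] by (simp add: colombeau_rel_iff)
  qed (rule C)
qed

text \<open>The representative witnessing the stronger condition fulfils the requirements of
  \<open>picard\<close> by itself: the mean value inequality from 0 to x gives linear growth, and a
  bounded gradient is logarithmically bounded. After truncation the gradient bound holds for all e
  in (0, 1].\<close>

lemma picard_of_bounded_gradient:
  fixes F :: "(real^'n, real^'n) gfun"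
  assumes F: "F \<in> colombeau" "f \<in> F" and C: "C > 0" and e0: "e0 > 0"
    and f: "\<forall>e \<in> {0<..1}. e < e0 \<longrightarrow>
      norm (f e 0) \<le> C \<and> (\<forall>x. norm (jacobian (f e) (at x)) \<le> C)"
  obtains h C' M where "picard h C'" "F = gclass h" "M \<ge> 0"
    "\<And>e x b. e \<in> {0<..1} \<Longrightarrow> b \<in> Basis \<Longrightarrow> norm (frechet_derivative (h e) (at x) b) \<le> M"
proof -
  note m = colombeau_eq_gclass[OF F]
  define M where "M = real CARD('n) * C"
  have M: "M \<ge> 0" unfolding M_def using C by simp
  have fM: "norm (frechet_derivative (f e) (at x) b) \<le> M"
    if "e \<in> {0<..1}" "e < e0" "b \<in> Basis" for e x b
  proof -
    have "norm (frechet_derivative (f e) (at x) b) \<le> real CARD('n) * norm (jacobian (f e) (at x))"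
      using that(3) by (rule norm_frechet_derivative_le_jacobian)
    also have "\<dots> \<le> M" unfolding M_def using f that by (intro mult_left_mono) auto
    finally show ?thesis .
  qed
  \<comment> \<open>The bound C at the origin plus the Lipschitz constant that the partial
    derivatives yield on the ball of radius \<open>norm x\<close>.\<close>
  define C' where "C' = C + real DIM(real^'n) * M"
  have C': "C' > 0" unfolding C'_def using C M by (intro add_pos_nonneg) auto
  have growth: "norm (f e x) \<le> C' * (1 + norm x)" if e: "e \<in> {0<..1}" "e < e0" for e x
  proof -
    have "norm (f e x - f e 0) \<le> real DIM(real^'n) * M * norm (x - 0)"
    proof (rule lipschitz_on_cball_if_partials_le[where R="norm x"])
      show "f e differentiable at y" for y
        using moderate_vec_has_derivative[OF m(2) e(1)] by (rule differentiableI)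
      show "norm (frechet_derivative (f e) (at y) b) \<le> M" if "b \<in> Basis" for y b
        using fM[OF e that] .
    qed (use M in auto)
    moreover have "norm (f e 0) \<le> C" using f e by blast
    moreover have "norm (f e x) \<le> norm (f e 0) + norm (f e x - f e 0)" by (rule norm_triangle_sub)
    ultimately have "norm (f e x) \<le> C + real DIM(real^'n) * M * norm x" by simp
    also have "\<dots> \<le> C' * (1 + norm x)"
      unfolding C'_def using C M by (simp add: algebra_simps)
    finally show ?thesis .
  qed
  have log: "log_bounded (\<lambda>e (_::unit) x. frechet_derivative (f e) (at x) b)" if b: "b \<in> Basis" for b
    unfolding log_bounded_def
  proof (intro allI impI)
    fix K :: "(real^'n) set"
    have "\<forall>\<^sub>F e in at_right 0. \<forall>k::unit. \<forall>x\<in>K. norm (frechet_derivative (f e) (at x) b) \<le> M * \<bar>ln e\<bar>"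
      using eventually_abs_ln_ge_1 eventually_small[OF e0]
    proof eventually_elim
      case (elim e)
      have "norm (frechet_derivative (f e) (at x) b) \<le> M * \<bar>ln e\<bar>" for x
      proof -
        have "norm (frechet_derivative (f e) (at x) b) \<le> M" using elim(2) b by (intro fM) auto
        also have "\<dots> \<le> M * \<bar>ln e\<bar>" using mult_left_mono[OF elim(1) M] by simp
        finally show ?thesis .
      qed
      then show ?case by blast
    qed
    then show "\<exists>L. \<forall>\<^sub>F e in at_right 0. \<forall>k::unit. \<forall>x\<in>K. norm (frechet_derivative (f e) (at x) b) \<le> L * \<bar>ln e\<bar>"
      by blast
  qed
  define h where "h = (\<lambda>e x. if e < e0 then f e x else 0)"
  have "picard h C'" "F = gclass h"
    unfolding h_def using picard_of_linear_growth[OF F F(2) C' e0 _ log] growth by blast+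
  moreover have "norm (frechet_derivative (h e) (at x) b) \<le> M" if "e \<in> {0<..1}" "b \<in> Basis" for e x b
  proof (cases "e < e0")
    case True
    then have "h e = f e" by (simp add: h_def)
    then show ?thesis using fM[OF that(1) True that(2)] by simp
  next
    case False
    then have "h e = (\<lambda>x. 0)" by (simp add: h_def)
    then show ?thesis using M by simp
  qed
  ultimately show ?thesis using that M by blast
qed

theorem theorem3p3:
  fixes F :: "(real^'n, real^'n) gfun"
  assumes "F \<in> colombeau"
    and "\<exists>f \<in> F. \<exists>C>0. \<exists>\<epsilon>\<^sub>0>0. \<forall>x. \<forall>\<epsilon> \<in> {0<..1}. \<epsilon> < \<epsilon>\<^sub>0 \<longrightarrow>
           norm (f \<epsilon> x) \<le> C * (1 + norm x)"
    and "\<exists>f \<in> F. \<forall>K. compact K \<and> K \<noteq> {} \<longrightarrow>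
           (\<lambda>\<epsilon>. SUP x\<in>K. norm (jacobian (f \<epsilon>) (at x))) \<in> O[at_right 0](\<lambda>\<epsilon>. \<bar>ln \<epsilon>\<bar>)"
  shows "(\<exists>!\<Phi>. is_generalized_flow F \<Phi>) \<and>
    (\<forall>\<Phi>. is_generalized_flow F \<Phi> \<longrightarrow>
       c_bounded_gfun (ddt \<Phi>) \<and>
       ((\<exists>f \<in> F. \<exists>C>0. \<exists>\<epsilon>\<^sub>0>0. \<forall>\<epsilon> \<in> {0<..1}. \<epsilon> < \<epsilon>\<^sub>0 \<longrightarrow>
            norm (f \<epsilon> 0) \<le> C \<and> (\<forall>x. norm (jacobian (f \<epsilon>) (at x)) \<le> C))
        \<longrightarrow> c_bounded_gfun (grad_x \<Phi>)))"
proof -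
  from assms(2) obtain f C \<epsilon>\<^sub>0 where f: "f \<in> F" "C > 0" "\<epsilon>\<^sub>0 > 0"
    "\<forall>x. \<forall>\<epsilon> \<in> {0<..1}. \<epsilon> < \<epsilon>\<^sub>0 \<longrightarrow> norm (f \<epsilon> x) \<le> C * (1 + norm x)" by blast
  from assms(3) obtain g where g: "g \<in> F" "\<forall>K. compact K \<and> K \<noteq> {} \<longrightarrow>
    (\<lambda>\<epsilon>. SUP x\<in>K. norm (jacobian (g \<epsilon>) (at x))) \<in> O[at_right 0](\<lambda>\<epsilon>. \<bar>ln \<epsilon>\<bar>)" by blast
  \<comment> \<open>The witnesses f of (i) and g of (ii) may be different nets of the same
    class.\<close>
  note log = log_bounded_frechet_derivative[OF colombeau_eq_gclass(2)[OF assms(1) g(1)] _ g(2)]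
  obtain h where h: "picard h C" "F = gclass h"
    using picard_of_linear_growth[OF assms(1) f(1) g(1) f(2,3,4) log] by blast
  have flow_iff: "is_generalized_flow F \<Phi> \<longleftrightarrow> \<Phi> = gclass (picard.flow h)" for \<Phi>
    unfolding h(2) by (rule is_generalized_flow_iff[OF h(1)])
  have grad: "c_bounded_gfun (grad_x \<Phi>)" if \<Phi>: "is_generalized_flow F \<Phi>"
    and grad: "\<exists>f \<in> F. \<exists>C>0. \<exists>\<epsilon>\<^sub>0>0. \<forall>\<epsilon> \<in> {0<..1}. \<epsilon> < \<epsilon>\<^sub>0 \<longrightarrow>
      norm (f \<epsilon> 0) \<le> C \<and> (\<forall>x. norm (jacobian (f \<epsilon>) (at x)) \<le> C)" for \<Phi>
  proof -
    from grad obtain f\<^sub>1 C\<^sub>1 \<epsilon>\<^sub>1 where f1: "f\<^sub>1 \<in> F" "C\<^sub>1 > 0" "\<epsilon>\<^sub>1 > 0" "\<forall>\<epsilon> \<in> {0<..1}. \<epsilon> < \<epsilon>\<^sub>1 \<longrightarrow>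
      norm (f\<^sub>1 \<epsilon> 0) \<le> C\<^sub>1 \<and> (\<forall>x. norm (jacobian (f\<^sub>1 \<epsilon>) (at x)) \<le> C\<^sub>1)" by blast
    obtain k C' M where k: "picard k C'" "F = gclass k" "M \<ge> 0"
      "\<And>\<epsilon> x b. \<epsilon> \<in> {0<..1} \<Longrightarrow> b \<in> Basis \<Longrightarrow> norm (frechet_derivative (k \<epsilon>) (at x) b) \<le> M"
      by (rule picard_of_bounded_gradient[OF assms(1) f1]) blast
    \<comment> \<open>The class F is now represented by k, whose gradient is bounded; applied to k,
      the characterisation of generalized flows shows that the given \<Phi> is the class of its
      approximate flow too.\<close>
    have "\<Phi> = gclass (picard.flow k)" using \<Phi> is_generalized_flow_iff[OF k(1)] unfolding k(2) by blast
    then show ?thesis using grad_x_flow_c_bounded[OF k(1,3,4)] by simp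
  qed
  show ?thesis
  proof (intro conjI allI impI)
    show "\<exists>!\<Phi>. is_generalized_flow F \<Phi>" unfolding flow_iff by simp
    show "c_bounded_gfun (ddt \<Phi>)" if "is_generalized_flow F \<Phi>" for \<Phi>
      using that ddt_flow_c_bounded[OF h(1)] unfolding flow_iff by simp
  qed (rule grad)
qed

end
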